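(* Let $I\subset\mathbb{R}$ be a bounded open interval, let $\mu$ be a finite positive Borel measure on $I$, and let $\nu$ be a Borel probability measure on $\mathbb{R}$. Assume that there exists at least one $T\in H^1_\mu(I)$ with $T_\#\mu=\nu$. Then the problem $$\inf\left\{\int_I\left(|T(x)-x|^2+|\nabla_\mu T(x)|^2\right)d\mu(x)\ :\ T\in H^1_\mu(I),\ T_\#\mu=\nu\right\}$$ admits at least one solution (i.e. the infimum is attained).
   Context: Sobolev space and gradients with respect to $\mu$ (Zhikov's definition). A function $u\in L^2_\mu(I)$ belongs to $H^1_\mu(I)$ if there exist a sequence $(u_n)_n$ in $C^\infty(\overline{I})$ and $v\in L^2_\mu(I)$ such that $u_n\to u$ and $u_n'\to v$ in $L^2_\mu(I)$. The set of all such limits $v$ (over all such sequences) is denoted $\Gamma(u)$; it is a closed affine subspace of $L^2_\mu(I)$. The tangential gradient $\nabla_\mu u$ is the unique element of $\Gamma(u)$ with minimal $L^2_\mu$-norm. $T_\#\mu$ denotes the image (push-forward) measure of $\mu$ by $T$: $T_\#\mu(B)=\mu(T^{-1}(B))$ for Borel $B\subseteq\mathbb{R}$. *)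

theory Defs
  imports "HOL-Probability.Probability"
begin

text \<open>
  Elements of \<open>L\<^sup>2\<close> are represented by real functions rather than by
  equivalence classes; equality in \<open>L\<^sup>2\<close> is equality almost everywhere.
  The measures \<open>M\<close> below are meant to live on the interval \<open>I\<close>, that is
  \<open>sets M = sets (restrict_space borel I)\<close>, so values outside \<open>I\<close> are irrelevant.
\<close>

definition L2 :: "real measure \<Rightarrow> (real \<Rightarrow> real) set" where
  "L2 M = {f \<in> borel_measurable M. integrable M (\<lambda>x. (f x)\<^sup>2)}"

definition L2_norm :: "real measure \<Rightarrow> (real \<Rightarrow> real) \<Rightarrow> real" where
  "L2_norm M f = sqrt (\<integral>x. (f x)\<^sup>2 \<partial>M)"

definition L2_converges :: "real measure \<Rightarrow> (nat \<Rightarrow> real \<Rightarrow> real) \<Rightarrow> (real \<Rightarrow> real) \<Rightarrow> bool" where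
  "L2_converges M U u \<longleftrightarrow>
     (\<forall>n. U n \<in> L2 M) \<and> u \<in> L2 M \<and> (\<lambda>n. L2_norm M (\<lambda>x. U n x - u x)) \<longlonglongrightarrow> 0"

text \<open>
  Smoothness up to the boundary: derivatives of every order exist on the closed interval
  (one-sided at the end points). The witness \<open>D k\<close> is the \<open>k\<close>-th derivative; continuity of
  each \<open>D k\<close> on the closure follows from its differentiability.
\<close>

definition smooth_upto_boundary :: "real set \<Rightarrow> (real \<Rightarrow> real) set" where
  "smooth_upto_boundary I =
     {u. \<exists>D :: nat \<Rightarrow> real \<Rightarrow> real. D 0 = u \<and>
        (\<forall>k. \<forall>x \<in> closure I. (D k has_real_derivative D (Suc k) x) (at x within closure I))}"

text \<open>The set \<open>\<Gamma>(u)\<close>. As \<open>I\<close> is open, \<open>deriv\<close> is the ordinary derivative on \<open>I\<close>.\<close>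

definition gradients :: "real set \<Rightarrow> real measure \<Rightarrow> (real \<Rightarrow> real) \<Rightarrow> (real \<Rightarrow> real) set" where
  "gradients I M u =
     {v. \<exists>U :: nat \<Rightarrow> real \<Rightarrow> real. (\<forall>n. U n \<in> smooth_upto_boundary I) \<and>
        L2_converges M U u \<and> L2_converges M (\<lambda>n. deriv (U n)) v}"

definition H1 :: "real set \<Rightarrow> real measure \<Rightarrow> (real \<Rightarrow> real) set" where
  "H1 I M = {u \<in> L2 M. gradients I M u \<noteq> {}}"

text \<open>
  The element of \<open>\<Gamma>(u)\<close> of minimal norm is unique only as an element of \<open>L\<^sup>2\<close>, i.e. up to
  null sets, hence \<open>SOME\<close> (a choice of representative) instead of \<open>THE\<close>.
\<close>

definition tangential_gradient :: "real set \<Rightarrow> real measure \<Rightarrow> (real \<Rightarrow> real) \<Rightarrow> real \<Rightarrow> real" where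
  "tangential_gradient I M u =
     (SOME v. v \<in> gradients I M u \<and> (\<forall>w \<in> gradients I M u. L2_norm M v \<le> L2_norm M w))"

definition admissible_maps :: "real set \<Rightarrow> real measure \<Rightarrow> real measure \<Rightarrow> (real \<Rightarrow> real) set" where
  "admissible_maps I M N = {T \<in> H1 I M. distr M borel T = N}"

definition transport_energy :: "real set \<Rightarrow> real measure \<Rightarrow> (real \<Rightarrow> real) \<Rightarrow> real" where
  "transport_energy I M T =
     (\<integral>x. (\<bar>T x - x\<bar>\<^sup>2 + \<bar>tangential_gradient I M T x\<bar>\<^sup>2) \<partial>M)"

end

theory Submission
  imports Defs "HOL-Library.Diagonal_Subsequence"
begin

text \<open>
  The gradient term controls a minimising sequence only on a part of the interval, and on the
  complementary part nothing ties the values of a map at different points together. The proof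
  separates the two parts and uses a different compactness argument on each.

  Two points are called \<open>linked\<close> if, for increasing \<open>C\<^sup>1\<close> functions, the squared increment over
  every subinterval of the segment between them is bounded by a constant times the energy
  \<open>\<integral> \<bar>U'\<bar>\<^sup>2 d\<mu>\<close> over that subinterval. This is an equivalence relation whose classes are
  intervals. On one class a bound on the energy bounds the variation, so that Helly's selection
  theorem yields pointwise convergent subsequences. Every class with more than one point contains
  a rational number; hence the classes of the rational numbers and of the atoms of \<open>\<mu>\<close> form a
  countable family, whose union is the \<open>rigid_part\<close>, and a diagonal argument gives almost
  everywhere convergence there (lemma \<open>rigid_compactness\<close>).

  The remaining \<open>free_part\<close> contains no atoms and all its points are alone in their class. Between
  two points that are not linked a \<open>C\<^sup>1\<close> function can climb from 0 to 1 with arbitrarily little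
  energy. Therefore the indicator of an up-set that is a union of classes has the zero function
  among its gradients; Dynkin's theorem extends this to the generated \<open>\<sigma>\<close>-algebra, which
  contains all Borel subsets of the free part. So a map may be changed arbitrarily on the free
  part, within \<open>L\<^sup>2\<close>, and keeps its gradients (lemma \<open>vanishing_gradient_free_part\<close>). In
  particular it may be replaced there by its increasing rearrangement, which keeps the law and
  does not increase the distance to the identity (lemmas \<open>monotonise_law\<close>, \<open>monotonise_distance\<close>
  and \<open>monotonise_gradients\<close>). Increasing functions are again subject to Helly's theorem.

  A minimising sequence that is modified in this way thus has a subsequence that converges almost
  everywhere. The law passes to the limit, and since all \<open>L\<^sup>2\<close> norms equal the second moment of
  \<open>\<nu>\<close>, the convergence also holds in \<open>L\<^sup>2\<close>. It remains to pass to the limit in the gradients,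
  which are only bounded in \<open>L\<^sup>2\<close>: lemma \<open>gradient_lower_semicontinuity\<close> replaces weak compactness
  by the parallelogram identity, applied to nearly minimal gradients of maps close to the limit.
\<close>

section \<open>Square-integrable functions\<close>

text \<open>
  Estimates are stated for squared norms, with
  \<open>\<parallel>f + g\<parallel>\<^sup>2 \<le> 2 \<parallel>f\<parallel>\<^sup>2 + 2 \<parallel>g\<parallel>\<^sup>2\<close> in the role of the triangle inequality: constant factors
  do not matter in limits, and the parallelogram identity is about squares anyway.
\<close>
definition sqnorm :: "real measure \<Rightarrow> (real \<Rightarrow> real) \<Rightarrow> real" where
  "sqnorm M f = (\<integral>x. (f x)\<^sup>2 \<partial>M)"

lemma sqnorm_nonneg [simp]: "0 \<le> sqnorm M f"
  by (simp add: sqnorm_def)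

lemma L2_norm_sqnorm: "L2_norm M f = sqrt (sqnorm M f)"
  by (simp add: L2_norm_def sqnorm_def)

lemma L2_measurable: "f \<in> L2 M \<Longrightarrow> f \<in> borel_measurable M"
  and L2_square_integrable: "f \<in> L2 M \<Longrightarrow> integrable M (\<lambda>x. (f x)\<^sup>2)"
  by (auto simp: L2_def)

lemma L2_I: "f \<in> borel_measurable M \<Longrightarrow> integrable M (\<lambda>x. (f x)\<^sup>2) \<Longrightarrow> f \<in> L2 M"
  by (simp add: L2_def)

lemma L2_dominated:
  assumes "f \<in> borel_measurable M" and "g \<in> L2 M" and "\<And>x. x \<in> space M \<Longrightarrow> \<bar>f x\<bar> \<le> \<bar>g x\<bar>"
  shows "f \<in> L2 M" and "sqnorm M f \<le> sqnorm M g"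
proof -
  have le: "(f x)\<^sup>2 \<le> (g x)\<^sup>2" if "x \<in> space M" for x
    using assms(3)[OF that] by (simp add: abs_le_square_iff)
  note [measurable] = assms(1) L2_measurable[OF assms(2)]
  have "integrable M (\<lambda>x. (f x)\<^sup>2)"
    by (rule Bochner_Integration.integrable_bound[OF L2_square_integrable[OF assms(2)]])
       (auto intro!: AE_I2 le)
  then show "f \<in> L2 M"
    using assms(1) by (rule L2_I[rotated])
  then show "sqnorm M f \<le> sqnorm M g"
    unfolding sqnorm_def
    using assms(2) le by (intro integral_mono L2_square_integrable) auto
qed

lemma L2_mult_integrable:
  assumes "f \<in> L2 M" "g \<in> L2 M"
  shows "integrable M (\<lambda>x. f x * g x)"
proof (rule Bochner_Integration.integrable_bound)
  show "integrable M (\<lambda>x. (f x)\<^sup>2 + (g x)\<^sup>2)"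
    using assms by (intro Bochner_Integration.integrable_add L2_square_integrable)
  show "(\<lambda>x. f x * g x) \<in> borel_measurable M"
    using assms[THEN L2_measurable] by measurable
  have "\<bar>a * b\<bar> \<le> a\<^sup>2 + b\<^sup>2" for a b :: real
    using zero_le_power2[of "a - b"] zero_le_power2[of "a + b"] zero_le_power2[of a]
      zero_le_power2[of b] unfolding power2_diff power2_sum abs_le_iff by linarith
  then show "AE x in M. norm (f x * g x) \<le> norm ((f x)\<^sup>2 + (g x)\<^sup>2)"
    by (intro AE_I2) simp
qed

lemma L2_lincomb:
  assumes "f \<in> L2 M" "g \<in> L2 M"
  shows "(\<lambda>x. s * f x + t * g x) \<in> L2 M"
proof (rule L2_I)
  show "(\<lambda>x. s * f x + t * g x) \<in> borel_measurable M"
    using assms[THEN L2_measurable] by measurable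
  have "integrable M (\<lambda>x. s\<^sup>2 * (f x)\<^sup>2 + t\<^sup>2 * (g x)\<^sup>2 + 2 * s * t * (f x * g x))"
    using assms
    by (intro Bochner_Integration.integrable_add integrable_mult_right
          L2_square_integrable L2_mult_integrable)
  then show "integrable M (\<lambda>x. (s * f x + t * g x)\<^sup>2)"
    by (rule back_subst[of "integrable M"]) (simp add: power2_eq_square algebra_simps)
qed

lemma L2_add: "f \<in> L2 M \<Longrightarrow> g \<in> L2 M \<Longrightarrow> (\<lambda>x. f x + g x) \<in> L2 M"
  and L2_diff: "f \<in> L2 M \<Longrightarrow> g \<in> L2 M \<Longrightarrow> (\<lambda>x. f x - g x) \<in> L2 M"
  and L2_scale: "f \<in> L2 M \<Longrightarrow> (\<lambda>x. s * f x) \<in> L2 M"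
  using L2_lincomb[of f M g 1 1] L2_lincomb[of f M g 1 "-1"] L2_lincomb[of f M f s 0] by simp_all

lemma L2_zero [simp]: "(\<lambda>x. 0) \<in> L2 M"
  by (simp add: L2_def)

lemma sqnorm_lincomb:
  assumes "f \<in> L2 M" "g \<in> L2 M"
  shows "sqnorm M (\<lambda>x. s * f x + t * g x) =
    s\<^sup>2 * sqnorm M f + t\<^sup>2 * sqnorm M g + 2 * s * t * (\<integral>x. f x * g x \<partial>M)"
proof -
  have "sqnorm M (\<lambda>x. s * f x + t * g x) =
      (\<integral>x. s\<^sup>2 * (f x)\<^sup>2 + t\<^sup>2 * (g x)\<^sup>2 + 2 * s * t * (f x * g x) \<partial>M)"
    unfolding sqnorm_def
    by (rule Bochner_Integration.integral_cong) (simp_all add: power2_eq_square algebra_simps)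
  also have "\<dots> = s\<^sup>2 * sqnorm M f + t\<^sup>2 * sqnorm M g + 2 * s * t * (\<integral>x. f x * g x \<partial>M)"
    unfolding sqnorm_def using assms
    by (simp add: L2_square_integrable L2_mult_integrable)
  finally show ?thesis .
qed

lemma sqnorm_scale: "sqnorm M (\<lambda>x. s * f x) = s\<^sup>2 * sqnorm M f"
  by (simp add: sqnorm_def power_mult_distrib)

lemma parallelogram:
  assumes "f \<in> L2 M" "g \<in> L2 M"
  shows "sqnorm M (\<lambda>x. f x - g x) + sqnorm M (\<lambda>x. f x + g x) = 2 * sqnorm M f + 2 * sqnorm M g"
  using sqnorm_lincomb[OF assms, of 1 1] sqnorm_lincomb[OF assms, of 1 "-1"] by simp

lemma sqnorm_add_le:
  assumes "f \<in> L2 M" "g \<in> L2 M"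
  shows "sqnorm M (\<lambda>x. f x + g x) \<le> 2 * sqnorm M f + 2 * sqnorm M g"
  using parallelogram[OF assms] sqnorm_nonneg[of M "\<lambda>x. f x - g x"] by linarith

lemma sqnorm_minus_commute: "sqnorm M (\<lambda>x. f x - g x) = sqnorm M (\<lambda>x. g x - f x)"
  by (simp add: sqnorm_def power2_commute)

lemma sqnorm_triangle:
  assumes "f \<in> L2 M" "g \<in> L2 M" "h \<in> L2 M"
  shows "sqnorm M (\<lambda>x. f x - h x) \<le> 2 * sqnorm M (\<lambda>x. f x - g x) + 2 * sqnorm M (\<lambda>x. g x - h x)"
  using sqnorm_add_le[OF L2_diff[OF assms(1,2)] L2_diff[OF assms(2,3)]] by simp

lemma L2_converges_iff:
  "L2_converges M U u \<longleftrightarrow>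
     (\<forall>n. U n \<in> L2 M) \<and> u \<in> L2 M \<and> (\<lambda>n. sqnorm M (\<lambda>x. U n x - u x)) \<longlonglongrightarrow> 0"
proof -
  have "(\<lambda>n. sqrt (s n)) \<longlonglongrightarrow> 0 \<longleftrightarrow> s \<longlonglongrightarrow> 0" if "\<And>n. 0 \<le> s n" for s :: "nat \<Rightarrow> real"
  proof
    assume "(\<lambda>n. sqrt (s n)) \<longlonglongrightarrow> 0"
    from tendsto_power[OF this, of 2] show "s \<longlonglongrightarrow> 0" using that by simp
  next
    assume "s \<longlonglongrightarrow> 0"
    from tendsto_real_sqrt[OF this] show "(\<lambda>n. sqrt (s n)) \<longlonglongrightarrow> 0" by simp
  qed
  then show ?thesis
    unfolding L2_converges_def L2_norm_sqnorm by simp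
qed

text \<open>
  This follows from
  \<open>2 \<bar>f h\<bar> \<le> d f\<^sup>2 + h\<^sup>2 / d\<close> with a small \<open>d\<close>, where \<open>h\<close> is the difference to the limit.
\<close>
lemma sqnorm_lower_semicontinuous:
  assumes f: "f \<in> L2 M" and fn: "\<And>n. fn n \<in> L2 M"
    and lim: "(\<lambda>n. sqnorm M (\<lambda>x. fn n x - f x)) \<longlonglongrightarrow> 0" and e: "0 < e"
  shows "\<forall>\<^sub>F n in sequentially. sqnorm M f \<le> sqnorm M (fn n) + e"
proof -
  \<comment> \<open>The summand 1 only keeps the denominator positive.\<close>
  define d where "d = e / (2 * (sqnorm M f + 1))"
  have pos: "0 < sqnorm M f + 1"
    using sqnorm_nonneg[of M f] by linarith
  have d: "0 < d" using e pos by (simp add: d_def)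
  have df: "d * sqnorm M f \<le> e / 2"
  proof -
    have "d * sqnorm M f \<le> d * (sqnorm M f + 1)" using d by simp
    also have "\<dots> = e / 2"
    proof -
      have "e / (2 * p) * p = e / 2" if "0 < p" for p using that by simp
      then show ?thesis unfolding d_def using pos by blast
    qed
    finally show ?thesis .
  qed
  have "\<forall>\<^sub>F n in sequentially. sqnorm M (\<lambda>x. fn n x - f x) < d * e / 2"
    using lim d e by (intro order_tendstoD) auto
  then show ?thesis
  proof (rule eventually_mono)
    fix n assume n: "sqnorm M (\<lambda>x. fn n x - f x) < d * e / 2"
    define h where "h x = fn n x - f x" for x
    have h_eq: "h = (\<lambda>x. fn n x - f x)" by (simp add: h_def fun_eq_iff)
    have h: "h \<in> L2 M" unfolding h_eq by (intro L2_diff fn f)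
    \<comment> \<open>Young's inequality in integrated form, read off from a square being nonnegative.\<close>
    have "0 \<le> sqnorm M (\<lambda>x. d * f x + 1 * h x)" by simp
    also have "\<dots> = d\<^sup>2 * sqnorm M f + sqnorm M h + 2 * d * (\<integral>x. f x * h x \<partial>M)"
      using sqnorm_lincomb[OF f h, of d 1] by simp
    finally have "0 \<le> d * (d * sqnorm M f + 2 * (\<integral>x. f x * h x \<partial>M)) + sqnorm M h"
      by (simp add: power2_eq_square algebra_simps)
    moreover have "sqnorm M h \<le> d * (e / 2)" using n by (simp add: h_eq)
    ultimately have "0 \<le> d * (d * sqnorm M f + 2 * (\<integral>x. f x * h x \<partial>M) + e / 2)"
      by (simp add: algebra_simps)
    then have "0 \<le> d * sqnorm M f + 2 * (\<integral>x. f x * h x \<partial>M) + e / 2"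
      using d by (simp add: zero_le_mult_iff)
    moreover have "sqnorm M (fn n) = sqnorm M f + sqnorm M h + 2 * (\<integral>x. f x * h x \<partial>M)"
      using sqnorm_lincomb[OF f h, of 1 1] by (simp add: h_def)
    ultimately show "sqnorm M f \<le> sqnorm M (fn n) + e"
      using df sqnorm_nonneg[of M h] by linarith
  qed
qed

lemma sqnorm_tendsto_AE_subseq:
  assumes "\<And>n. f n \<in> L2 M" and "(\<lambda>n. sqnorm M (f n)) \<longlonglongrightarrow> 0"
  shows "\<exists>r. strict_mono r \<and> (AE x in M. (\<lambda>n. f (r n) x) \<longlonglongrightarrow> 0)"
proof -
  have "\<exists>r::nat\<Rightarrow>nat. strict_mono r \<and> (AE x in M. (\<lambda>n. (f (r n) x)\<^sup>2) \<longlonglongrightarrow> 0)"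
    using assms by (intro tendsto_L1_AE_subseq) (auto simp: sqnorm_def L2_square_integrable)
  then obtain r :: "nat \<Rightarrow> nat" where r: "strict_mono r" "AE x in M. (\<lambda>n. (f (r n) x)\<^sup>2) \<longlonglongrightarrow> 0"
    by auto
  from r(2) have "AE x in M. (\<lambda>n. f (r n) x) \<longlonglongrightarrow> 0"
  proof eventually_elim
    case (elim x)
    from tendsto_real_sqrt[OF elim] show ?case by (simp add: tendsto_rabs_zero_iff)
  qed
  with r(1) show ?thesis by auto
qed

lemma L2_Fatou:
  assumes [measurable]: "\<And>n. f n \<in> L2 M" "g \<in> borel_measurable M"
    and lim: "AE x in M. (\<lambda>n. f n x) \<longlonglongrightarrow> g x"
    and bound: "\<And>n. sqnorm M (f n) \<le> K"
  shows "g \<in> L2 M" and "sqnorm M g \<le> K"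
proof -
  have [measurable]: "f n \<in> borel_measurable M" for n using assms(1) by (rule L2_measurable)
  have K: "0 \<le> K" using bound[of 0] sqnorm_nonneg[of M "f 0"] by linarith
  have eq: "(\<integral>\<^sup>+x. ennreal ((f n x)\<^sup>2) \<partial>M) = ennreal (sqnorm M (f n))" for n
    unfolding sqnorm_def using assms(1) by (intro nn_integral_eq_integral L2_square_integrable) auto
  have "(\<integral>\<^sup>+x. ennreal ((g x)\<^sup>2) \<partial>M) = (\<integral>\<^sup>+x. liminf (\<lambda>n. ennreal ((f n x)\<^sup>2)) \<partial>M)"
    using lim
  proof (intro nn_integral_cong_AE, eventually_elim)
    case (elim x)
    then have "(\<lambda>n. ennreal ((f n x)\<^sup>2)) \<longlonglongrightarrow> ennreal ((g x)\<^sup>2)"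
      by (intro tendsto_ennrealI tendsto_power)
    then show ?case by (rule lim_imp_Liminf[OF trivial_limit_sequentially, symmetric])
  qed
  also have "\<dots> \<le> liminf (\<lambda>n. \<integral>\<^sup>+x. ennreal ((f n x)\<^sup>2) \<partial>M)"
    by (rule nn_integral_liminf) measurable
  also have "\<dots> \<le> liminf (\<lambda>n. ennreal K)"
    using bound by (intro Liminf_mono always_eventually allI) (simp add: eq ennreal_leI)
  also have "\<dots> = ennreal K" by (simp add: Liminf_const)
  finally have le: "(\<integral>\<^sup>+x. ennreal ((g x)\<^sup>2) \<partial>M) \<le> ennreal K" .
  have int: "integrable M (\<lambda>x. (g x)\<^sup>2)"
    using le by (intro integrableI_bounded) (auto simp: le_less_trans)
  then show "g \<in> L2 M" by (intro L2_I) auto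
  have "ennreal (sqnorm M g) \<le> ennreal K"
    using le unfolding sqnorm_def by (subst (asm) nn_integral_eq_integral[OF int]) auto
  then show "sqnorm M g \<le> K" using K by (simp add: ennreal_le_iff)
qed

text \<open>
  The weights \<open>4 ^ n\<close> lie between 1 and the assumed rate \<open>8 ^ n\<close>: the weighted squares of the
  increments still have a finite integral, so almost everywhere they tend to 0, and then the
  increments themselves are eventually below \<open>2 ^ -n\<close> and summable.
\<close>
lemma L2_fast_Cauchy_AE_convergent:
  assumes L: "\<And>n. f n \<in> L2 M"
    and fast: "\<And>n. sqnorm M (\<lambda>x. f (Suc n) x - f n x) \<le> (1/8) ^ n"
  shows "AE x in M. convergent (\<lambda>n. f n x)"
proof -
  have [measurable]: "f n \<in> borel_measurable M" for n using L by (rule L2_measurable)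
  define d where "d n x = 4 ^ n * (f (Suc n) x - f n x)\<^sup>2" for n x
  have d_int: "integrable M (d n)" for n
    unfolding d_def by (intro integrable_mult_right L2_square_integrable L2_diff L)
  have "AE x in M. summable (\<lambda>n. norm (d n x))"
  proof -
    have "(\<integral>\<^sup>+x. (\<Sum>n. ennreal (d n x)) \<partial>M) = (\<Sum>n. \<integral>\<^sup>+x. ennreal (d n x) \<partial>M)"
      unfolding d_def by (rule nn_integral_suminf) measurable
    also have "\<dots> \<le> (\<Sum>n. ennreal ((1/2) ^ n))"
    proof (intro suminf_le summableI)
      fix n
      have "(\<integral>\<^sup>+x. ennreal (d n x) \<partial>M) = ennreal (\<integral>x. d n x \<partial>M)"
        by (intro nn_integral_eq_integral d_int) (auto simp: d_def)
      also have "(\<integral>x. d n x \<partial>M) = 4 ^ n * sqnorm M (\<lambda>x. f (Suc n) x - f n x)"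
        by (simp add: d_def sqnorm_def)
      also have "\<dots> \<le> 4 ^ n * (1/8) ^ n" by (intro mult_left_mono fast) auto
      also have "\<dots> = (1/2) ^ n" by (simp add: power_mult_distrib[symmetric])
      finally show "(\<integral>\<^sup>+x. ennreal (d n x) \<partial>M) \<le> ennreal ((1/2) ^ n)"
        by (simp add: ennreal_leI)
    qed
    also have "\<dots> = ennreal (\<Sum>n. (1/2) ^ n)"
      by (intro suminf_ennreal2 summable_geometric) auto
    also have "\<dots> < \<infinity>" by simp
    finally have "(\<integral>\<^sup>+x. (\<Sum>n. ennreal (d n x)) \<partial>M) \<noteq> \<infinity>" by simp
    then have "AE x in M. (\<Sum>n. ennreal (d n x)) \<noteq> \<infinity>"
      unfolding d_def by (intro nn_integral_noteq_infinite) measurable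
    then show ?thesis
    proof eventually_elim
      case (elim x)
      then have "summable (\<lambda>n. d n x)"
        by (intro summable_suminf_not_top) (auto simp: d_def)
      then show ?case by (simp add: d_def)
    qed
  qed
  then show ?thesis
  proof eventually_elim
    case (elim x)
    have "\<forall>\<^sub>F n in sequentially. norm (d n x) < 1"
      using summable_LIMSEQ_zero[OF elim] by (rule order_tendstoD) simp
    then have "\<forall>\<^sub>F n in sequentially. norm (f (Suc n) x - f n x) \<le> (1/2) ^ n"
    proof eventually_elim
      case (elim n)
      have "(4::real) ^ n = (2 ^ n)\<^sup>2"
        by (simp add: power2_eq_square flip: power_mult_distrib)
      then have "(2 ^ n * \<bar>f (Suc n) x - f n x\<bar>)\<^sup>2 \<le> 1\<^sup>2"
        using elim by (simp add: d_def power_mult_distrib abs_mult)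
      then have "2 ^ n * \<bar>f (Suc n) x - f n x\<bar> \<le> 1"
        by (rule power2_le_imp_le) simp
      then show ?case by (simp add: field_simps)
    qed
    then have "summable (\<lambda>n. f (Suc n) x - f n x)"
      by (rule summable_comparison_test_ev) (simp add: summable_geometric)
    then have "convergent (\<lambda>n. f n x - f 0 x)"
      unfolding summable_iff_convergent by (simp add: sum_lessThan_telescope[of "\<lambda>n. f n x"])
    from convergent_add[OF this convergent_const[of "f 0 x"]] show "convergent (\<lambda>n. f n x)"
      by simp
  qed
qed

text \<open>
  The limit is built from a rapidly converging subsequence, and Fatou's lemma along this
  subsequence turns the Cauchy estimates into estimates for the distance to the limit.
\<close>
lemma L2_complete:
  assumes L: "\<And>n. f n \<in> L2 M"
    and Cauchy: "\<And>e. 0 < e \<Longrightarrow> \<exists>N. \<forall>m\<ge>N. \<forall>n\<ge>N. sqnorm M (\<lambda>x. f m x - f n x) < e"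
  shows "\<exists>g \<in> L2 M. (\<lambda>n. sqnorm M (\<lambda>x. f n x - g x)) \<longlonglongrightarrow> 0"
proof -
  have [measurable]: "f n \<in> borel_measurable M" for n using L by (rule L2_measurable)
  have "\<exists>N. \<forall>k. \<forall>m\<ge>N k. \<forall>n\<ge>N k. sqnorm M (\<lambda>x. f m x - f n x) < (1/8) ^ k"
    by (intro choice allI Cauchy) simp
  then obtain N :: "nat \<Rightarrow> nat"
    where N: "\<And>k m n. m \<ge> N k \<Longrightarrow> n \<ge> N k \<Longrightarrow> sqnorm M (\<lambda>x. f m x - f n x) < (1/8) ^ k"
    by blast
  define r where "r k = (\<Sum>i\<le>k. N i) + k" for k
  have rN: "N k \<le> r k" for k
    unfolding r_def by (rule trans_le_add1) (simp add: member_le_sum)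
  have r_Suc: "r k < r (Suc k)" for k by (simp add: r_def)
  have r: "strict_mono r" by (simp add: strict_mono_Suc_iff r_Suc)
  have "AE x in M. convergent (\<lambda>k. f (r k) x)"
  proof (rule L2_fast_Cauchy_AE_convergent[OF L])
    fix k
    have "N k \<le> r (Suc k)" using rN[of k] r_Suc[of k] by linarith
    then show "sqnorm M (\<lambda>x. f (r (Suc k)) x - f (r k) x) \<le> (1/8) ^ k"
      using N[of k "r (Suc k)" "r k"] rN[of k] by simp
  qed
  then have lim: "AE x in M. (\<lambda>k. f (r k) x) \<longlonglongrightarrow> lim (\<lambda>k. f (r k) x)"
    by (simp add: convergent_LIMSEQ_iff)
  define g where "g x = lim (\<lambda>k. f (r k) x)" for x
  have [measurable]: "g \<in> borel_measurable M" unfolding g_def by measurable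
  have near: "(\<lambda>x. f n x - g x) \<in> L2 M \<and> sqnorm M (\<lambda>x. f n x - g x) \<le> e"
    if e: "\<forall>m\<ge>K. \<forall>n\<ge>K. sqnorm M (\<lambda>x. f m x - f n x) < e" and n: "n \<ge> K" for e K n
  proof -
    have "AE x in M. (\<lambda>k. f n x - f (r (k + K)) x) \<longlonglongrightarrow> f n x - g x"
      using lim unfolding g_def
      by eventually_elim (intro tendsto_diff tendsto_const LIMSEQ_ignore_initial_segment)
    moreover have "sqnorm M (\<lambda>x. f n x - f (r (k + K)) x) \<le> e" for k
    proof -
      have "r (k + K) \<ge> K" using seq_suble[OF r, of "k + K"] by linarith
      then show ?thesis using e n by (simp add: less_imp_le)
    qed
    ultimately show ?thesis
      using L2_Fatou[of "\<lambda>k x. f n x - f (r (k + K)) x" M "\<lambda>x. f n x - g x" e] L2_diff[OF L L]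
      by auto
  qed
  obtain K where "\<forall>m\<ge>K. \<forall>n\<ge>K. sqnorm M (\<lambda>x. f m x - f n x) < 1"
    using Cauchy[of 1] by auto
  from near[OF this order_refl] have "(\<lambda>x. f K x - g x) \<in> L2 M" ..
  from L2_diff[OF L[of K] this] have "g \<in> L2 M" by simp
  moreover have "(\<lambda>n. sqnorm M (\<lambda>x. f n x - g x)) \<longlonglongrightarrow> 0"
  proof (rule LIMSEQ_I)
    fix e :: real assume e: "0 < e"
    obtain K where "\<forall>m\<ge>K. \<forall>n\<ge>K. sqnorm M (\<lambda>x. f m x - f n x) < e / 2"
      using Cauchy[of "e / 2"] e by auto
    from near[OF this] have "\<forall>n\<ge>K. sqnorm M (\<lambda>x. f n x - g x) \<le> e / 2" by auto
    then show "\<exists>K. \<forall>n\<ge>K. norm (sqnorm M (\<lambda>x. f n x - g x) - 0) < e"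
      using e by (intro exI[of _ K]) fastforce
  qed
  ultimately show ?thesis by blast
qed

section \<open>Selection theorems for monotone functions\<close>

text \<open>
  The diagonal argument in the form in which it is used below: a condition that can be met along a
  subsequence of any given sequence, for each of countably many indices, can be met for all indices
  at once.
\<close>
lemma common_convergent_subsequence:
  fixes f :: "nat \<Rightarrow> nat \<Rightarrow> 'a \<Rightarrow> real"
  assumes ex: "\<And>i (s :: nat \<Rightarrow> nat). strict_mono s \<Longrightarrow>
    \<exists>r. strict_mono r \<and> (\<forall>x \<in> K i. convergent (\<lambda>n. f i (s (r n)) x))"
  shows "\<exists>r. strict_mono r \<and> (\<forall>i. \<forall>x \<in> K i. convergent (\<lambda>n. f i (r n) x))"
proof -
  interpret subseqs "\<lambda>i s. \<forall>x \<in> K i. convergent (\<lambda>n. f i (s n) x)"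
  proof
    fix i and s :: "nat \<Rightarrow> nat" assume "strict_mono s"
    from ex[OF this, of i]
    show "\<exists>r. strict_mono r \<and> (\<forall>x \<in> K i. convergent (\<lambda>n. f i ((s \<circ> r) n) x))"
      by (simp add: o_def)
  qed
  have "\<forall>x \<in> K i. convergent (\<lambda>n. f i ((diagseq \<circ> (+) (Suc i)) n) x)" for i
  proof (rule diagseq_holds)
    fix r s :: "nat \<Rightarrow> nat" and i
    assume "strict_mono r" and "\<forall>x\<in>K i. convergent (\<lambda>n. f i (s n) x)"
    then show "\<forall>x\<in>K i. convergent (\<lambda>n. f i ((s \<circ> r) n) x)"
      using convergent_subseq_convergent[where f = r and X = "\<lambda>n. f i (s n) x" for x]
      by (auto simp: o_def)
  qed
  moreover have "(diagseq \<circ> (+) (Suc i)) n = diagseq (n + Suc i)" for i n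
    by (simp add: add.commute)
  ultimately have "\<forall>x \<in> K i. convergent (\<lambda>n. f i (diagseq (n + Suc i)) x)" for i
    by (simp only:)
  then have "\<forall>x \<in> K i. convergent (\<lambda>n. f i (diagseq n) x)" for i
    using convergent_ignore_initial_segment[of "\<lambda>n. f i (diagseq n) x" "Suc i" for x] by blast
  then show ?thesis
    using subseq_diagseq by blast
qed

lemma convergent_subsequence_on_countable:
  fixes f :: "nat \<Rightarrow> 'a \<Rightarrow> real"
  assumes C: "countable C" and bdd: "\<And>x. x \<in> C \<Longrightarrow> \<exists>B. \<forall>n. \<bar>f n x\<bar> \<le> B"
  shows "\<exists>r. strict_mono r \<and> (\<forall>x \<in> C. convergent (\<lambda>n. f (r n) x))"
proof (cases "C = {}")
  case True
  then show ?thesis by (intro exI[of _ "\<lambda>n. n"]) (simp add: strict_mono_def)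
next
  case False
  have "\<exists>r. strict_mono r \<and>
      (\<forall>i. \<forall>x \<in> {from_nat_into C i}. convergent (\<lambda>n. f (r n) x))"
  proof (rule common_convergent_subsequence)
    fix i and s :: "nat \<Rightarrow> nat"
    obtain B where "\<And>n. \<bar>f n (from_nat_into C i)\<bar> \<le> B"
      using bdd[OF from_nat_into[OF False]] by blast
    then have "bounded (range (\<lambda>n. f (s n) (from_nat_into C i)))"
      by (intro boundedI[of _ B]) auto
    then obtain l r where "strict_mono r" "((\<lambda>n. f (s n) (from_nat_into C i)) \<circ> r) \<longlonglongrightarrow> l"
      using bounded_imp_convergent_subsequence by blast
    then show "\<exists>r. strict_mono r \<and> (\<forall>x\<in>{from_nat_into C i}. convergent (\<lambda>n. f (s (r n)) x))"
      by (auto simp: o_def convergent_def)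
  qed
  then show ?thesis
    using from_nat_into_surj[OF C] by (metis singletonI)
qed

text \<open>
  Two extractions are made. The first one gives convergence on a countable subset \<open>Q\<close> that is dense
  and contains the end points of the interval that belong to it; the supremum \<open>F\<close> of the limits to
  the left of a point is monotone, and at its points of continuity monotonicity squeezes the sequence
  between values at neighbouring points of \<open>Q\<close>. The second extraction deals with the countably many
  discontinuities of \<open>F\<close>.
\<close>
lemma Helly_selection_on_interval:
  fixes f :: "nat \<Rightarrow> real \<Rightarrow> real"
  assumes K: "is_interval K" and mono: "\<And>n. mono_on K (f n)"
    and bdd: "\<And>x. x \<in> K \<Longrightarrow> \<exists>B. \<forall>n. \<bar>f n x\<bar> \<le> B"
  shows "\<exists>r. strict_mono r \<and> (\<forall>x \<in> K. convergent (\<lambda>n. f (r n) x))"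
proof -
  define Lo where "Lo = {x \<in> K. \<forall>y \<in> K. x \<le> y}"
  define Hi where "Hi = {x \<in> K. \<forall>y \<in> K. y \<le> x}"
  define Q where "Q = (K \<inter> \<rat>) \<union> Lo \<union> Hi"
  have single: "countable A" if "\<And>x y. x \<in> A \<Longrightarrow> y \<in> A \<Longrightarrow> x = y" for A :: "real set"
  proof (cases "A = {}")
    case False
    then obtain x where "x \<in> A" by blast
    with that have "A = {x}" by blast
    then show ?thesis by simp
  qed simp
  have "countable Lo" "countable Hi"
    by (rule single; force simp: Lo_def Hi_def intro: order_antisym)+
  then have "countable Q"
    unfolding Q_def by (auto intro!: countable_Int2 countable_rat)
  have QK: "Q \<subseteq> K" by (auto simp: Q_def Lo_def Hi_def)
  obtain r1 where r1: "strict_mono r1" "\<forall>x \<in> Q. convergent (\<lambda>n. f (r1 n) x)"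
    using convergent_subsequence_on_countable[OF \<open>countable Q\<close>, of f] bdd QK by blast
  define L where "L x = lim (\<lambda>n. f (r1 n) x)" for x
  have L: "(\<lambda>n. f (r1 n) x) \<longlonglongrightarrow> L x" if "x \<in> Q" for x
    using r1(2) that by (simp add: L_def convergent_LIMSEQ_iff)
  have L_mono: "L x \<le> L y" if "x \<in> Q" "y \<in> Q" "x \<le> y" for x y
    using that QK by (intro LIMSEQ_le[OF L L] exI[of _ 0] allI impI mono_onD[OF mono]) auto
  have below: "\<exists>q\<in>Q. q \<le> x" if "x \<in> K" for x
  proof (cases "x \<in> Lo")
    case False
    then obtain y where y: "y \<in> K" "y < x" using \<open>x \<in> K\<close> by (force simp: Lo_def)
    obtain q where q: "q \<in> \<rat>" "y < q" "q < x" using Rats_dense_in_real[OF y(2)] by blast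
    then have "q \<in> K" using K y \<open>x \<in> K\<close> unfolding is_interval_1 by (meson less_imp_le)
    then show ?thesis using q by (intro bexI[of _ q]) (auto simp: Q_def)
  qed (auto simp: Q_def)
  have above: "\<exists>q\<in>Q. x \<le> q" if "x \<in> K" for x
  proof (cases "x \<in> Hi")
    case False
    then obtain y where y: "y \<in> K" "x < y" using \<open>x \<in> K\<close> by (force simp: Hi_def)
    obtain q where q: "q \<in> \<rat>" "x < q" "q < y" using Rats_dense_in_real[OF y(2)] by blast
    then have "q \<in> K" using K y \<open>x \<in> K\<close> unfolding is_interval_1 by (meson less_imp_le)
    then show ?thesis using q by (intro bexI[of _ q]) (auto simp: Q_def)
  qed (auto simp: Q_def)
  \<comment> \<open>\<open>F\<close> extends the limit \<open>L\<close> on \<open>Q\<close> to a monotone function on all of \<open>K\<close>.\<close>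
  define F where "F x = Sup (L ` {q \<in> Q. q \<le> x})" for x
  have bddF: "bdd_above (L ` {q \<in> Q. q \<le> x})" if x: "x \<in> K" for x
  proof -
    obtain q' where "q' \<in> Q" "x \<le> q'" using above[OF x] by blast
    then show ?thesis by (intro bdd_aboveI[of _ "L q'"]) (auto intro: L_mono)
  qed
  have F_mono: "mono_on K F"
    unfolding F_def
    by (intro mono_onI cSup_subset_mono bddF image_mono) (use below in auto)
  have FL: "F q = L q" if "q \<in> Q" for q
    unfolding F_def by (rule cSup_eq_maximum) (use that L_mono in auto)
  define C where "C = {a \<in> K. \<not> continuous (at a within K) F}"
  have "countable C"
    unfolding C_def by (rule mono_on_ctble_discont[OF F_mono])
  then obtain r2 where r2: "strict_mono r2" "\<forall>x \<in> C. convergent (\<lambda>n. f (r1 (r2 n)) x)"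
    using convergent_subsequence_on_countable[of C "\<lambda>n. f (r1 n)"] bdd
    unfolding C_def by blast
  have "convergent (\<lambda>n. f (r1 (r2 n)) x)" if x: "x \<in> K" for x
  proof -
    consider "x \<in> Q" | "x \<in> C" | "x \<notin> Q" "x \<notin> C" by blast
    then show ?thesis
    proof cases
      case 1
      then have "convergent ((\<lambda>n. f (r1 n) x) \<circ> r2)"
        using r1(2) r2(1) by (intro convergent_subseq_convergent) auto
      then show ?thesis by (simp add: o_def)
    next
      case 2
      then show ?thesis using r2(2) by blast
    next
      case 3
      have cont: "continuous (at x within K) F" using 3 x by (simp add: C_def)
      obtain y z where yz: "y \<in> K" "y < x" "z \<in> K" "x < z"
        using 3 x by (force simp: Q_def Lo_def Hi_def)
      have "(\<lambda>n. f (r1 n) x) \<longlonglongrightarrow> F x"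
      proof (rule LIMSEQ_I)
        fix e :: real assume e: "0 < e"
        obtain d where d: "0 < d" "\<And>u. u \<in> K \<Longrightarrow> \<bar>u - x\<bar> < d \<Longrightarrow> \<bar>F u - F x\<bar> < e"
          using cont e unfolding continuous_within_eps_delta by (auto simp: dist_real_def)
        have "max y (x - d) < x" "x < min z (x + d)" using yz d by auto
        then obtain p q where pq: "p \<in> \<rat>" "max y (x - d) < p" "p < x"
          "q \<in> \<rat>" "x < q" "q < min z (x + d)"
          using Rats_dense_in_real by metis
        then have pqK: "p \<in> K" "q \<in> K"
          using K yz x unfolding is_interval_1 by (smt (verit))+
        then have pqQ: "p \<in> Q" "q \<in> Q" using pq by (auto simp: Q_def)
        have "\<bar>F p - F x\<bar> < e" "\<bar>F q - F x\<bar> < e" using d(2) pqK pq by auto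
        then have "L p > F x - e" "L q < F x + e" using FL pqQ by auto
        then have "\<forall>\<^sub>F n in sequentially. f (r1 n) p > F x - e \<and> f (r1 n) q < F x + e"
          using L[OF pqQ(1)] L[OF pqQ(2)] by (intro eventually_conj order_tendstoD) auto
        then have "\<forall>\<^sub>F n in sequentially. norm (f (r1 n) x - F x) < e"
        proof eventually_elim
          case (elim n)
          have "f (r1 n) p \<le> f (r1 n) x" "f (r1 n) x \<le> f (r1 n) q"
            using mono_onD[OF mono[of "r1 n"]] pqK x pq by auto
          then show ?case using elim by (auto simp: abs_less_iff)
        qed
        then show "\<exists>N. \<forall>n\<ge>N. norm (f (r1 n) x - F x) < e"
          by (simp add: eventually_sequentially)
      qed
      from LIMSEQ_subseq_LIMSEQ[OF this r2(1)] show ?thesis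
        by (auto simp: o_def convergent_def)
    qed
  qed
  then show ?thesis
    using strict_mono_o[OF r1(1) r2(1)] by (intro exI[of _ "r1 \<circ> r2"]) (auto simp: o_def)
qed

section \<open>Increasing rearrangements\<close>

text \<open>
  A finite measure space with a real coordinate whose distribution has no atoms. Exactly the absence
  of atoms makes the distribution function of the coordinate uniformly distributed, so that every
  law of the same total mass is the law of an increasing function of the coordinate.
\<close>
locale atomless_coordinate = finite_measure M for M :: "'a measure" +
  fixes X :: "'a \<Rightarrow> real"
  assumes X_measurable [measurable]: "X \<in> borel_measurable M"
    and atomless: "\<And>x. measure M {w \<in> space M. X w = x} = 0"
begin

definition mass :: real where "mass = measure M (space M)"

abbreviation F :: "real \<Rightarrow> real" where "F \<equiv> cdf (distr M borel X)"

text \<open>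
  The quantile function of the law of \<open>f\<close>, evaluated at the distribution function of the
  coordinate. Outside the range \<open>0 < F x < mass\<close>, which the coordinate almost surely avoids,
  the infimum could be taken over an empty or an unbounded set; the value 0 is a mere default.
\<close>
definition rearrangement :: "('a \<Rightarrow> real) \<Rightarrow> real \<Rightarrow> real" where
  "rearrangement f x =
     (if 0 < F x \<and> F x < mass then Inf {t. F x \<le> cdf (distr M borel f) t} else 0)"

lemma cdf_law: "f \<in> borel_measurable M \<Longrightarrow> cdf (distr M borel f) t = measure M {w \<in> space M. f w \<le> t}"
  by (auto simp: cdf_def measure_distr intro!: arg_cong[where f = "measure M"])

lemma law_finite_borel: "f \<in> borel_measurable M \<Longrightarrow> finite_borel_measure (distr M borel f)"
  by (intro finite_borel_measure.intro finite_borel_measure_axioms.intro finite_measure_distr) auto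

lemma cdf_law_right_continuous_mono:
  assumes f: "f \<in> borel_measurable M"
  shows "right_continuous_mono (cdf (distr M borel f)) 0 mass"
proof -
  interpret L: finite_borel_measure "distr M borel f" using f by (rule law_finite_borel)
  have "measure (distr M borel f) (space (distr M borel f)) = mass"
    using f by (simp add: mass_def measure_distr)
  then show ?thesis
    using L.cdf_lim_at_top L.cdf_lim_at_bot L.cdf_is_right_cont L.cdf_nondecreasing
    by unfold_locales (auto intro: monoI)
qed

interpretation F: right_continuous_mono F 0 mass
  by (rule cdf_law_right_continuous_mono) simp

interpretation FX: finite_borel_measure "distr M borel X"
  by (rule law_finite_borel) simp

lemma F_continuous: "isCont F x"
  unfolding FX.isCont_cdf using atomless by (simp add: measure_distr vimage_def Int_def conj_commute)

lemma F_mono: "x \<le> y \<Longrightarrow> F x \<le> F y"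
  by (rule monoD[OF F.mono])

lemma F_le_mass: "F x \<le> mass"
  by (simp add: cdf_law mass_def bounded_measure)

lemma F_borel [measurable]: "F \<in> borel_measurable borel"
  by (intro borel_measurable_mono F.mono)

lemma rearrangement_le_iff:
  assumes "f \<in> borel_measurable M" "0 < F x" "F x < mass"
  shows "rearrangement f x \<le> t \<longleftrightarrow> F x \<le> cdf (distr M borel f) t"
proof -
  have "rearrangement f x = Inf {t. F x \<le> cdf (distr M borel f) t}"
    unfolding rearrangement_def by (rule if_P) (use assms(2,3) in blast)
  then show ?thesis
    using right_continuous_mono.pseudoinverse[OF cdf_law_right_continuous_mono[OF assms(1)] assms(2,3),
        of t]
    by argo
qed

lemma rearrangement_mono:
  assumes "f \<in> borel_measurable M"
  shows "mono_on {x. 0 < F x \<and> F x < mass} (rearrangement f)"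
proof (rule mono_onI)
  fix x y assume x: "x \<in> {x. 0 < F x \<and> F x < mass}" and y: "y \<in> {x. 0 < F x \<and> F x < mass}"
    and "x \<le> y"
  have "F y \<le> cdf (distr M borel f) (rearrangement f y)"
    using rearrangement_le_iff[OF assms, of y "rearrangement f y"] y by simp
  then have "F x \<le> cdf (distr M borel f) (rearrangement f y)"
    using F_mono[OF \<open>x \<le> y\<close>] by simp
  then show "rearrangement f x \<le> rearrangement f y"
    using rearrangement_le_iff[OF assms, of x] x by simp
qed

lemma rearrangement_borel [measurable]:
  assumes [measurable]: "f \<in> borel_measurable M"
  shows "rearrangement f \<in> borel_measurable borel"
proof (rule borel_measurableI_le)
  fix t
  have "{x \<in> space borel. rearrangement f x \<le> t} =
      {x \<in> space borel. if 0 < F x \<and> F x < mass then F x \<le> cdf (distr M borel f) t else 0 \<le> t}"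
    using rearrangement_le_iff[OF assms] by (auto simp: rearrangement_def)
  also have "\<dots> \<in> sets borel" by measurable
  finally show "{x \<in> space borel. rearrangement f x \<le> t} \<in> sets borel" .
qed

text \<open>
  The largest solution \<open>z\<close> of \<open>F z = s\<close>, which exists since \<open>F\<close> is continuous; being the largest, it
  describes the whole sublevel set.
\<close>
lemma F_level:
  assumes "0 < s" "s < mass"
  obtains z where "F z = s" "\<And>x. F x \<le> s \<longleftrightarrow> x \<le> z"
proof -
  define Z where "Z = {x. F x \<le> s}"
  have "\<forall>\<^sub>F x in at_bot. F x < s" using F.bot assms(1) by (rule order_tendstoD)
  then obtain y where "F y < s" by (metis eventually_happens' trivial_limit_at_bot_linorder)
  then have ne: "Z \<noteq> {}" by (auto simp: Z_def intro: less_imp_le)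
  have "\<forall>\<^sub>F x in at_top. s < F x" using F.top assms(2) by (rule order_tendstoD)
  then obtain u where u: "s < F u" by (metis eventually_happens' trivial_limit_at_top_linorder)
  then have bdd: "bdd_above Z"
  proof (intro bdd_aboveI[of _ u])
    fix x assume "x \<in> Z"
    then have "F x < F u" using u by (simp add: Z_def)
    then show "x \<le> u" using F_mono[of u x] by linarith
  qed
  have "closed Z"
    unfolding Z_def using F_continuous
    by (intro closed_Collect_le continuous_on_const) (simp add: continuous_at_imp_continuous_on)
  then have sup: "Sup Z \<in> Z" using closed_contains_Sup ne bdd by blast
  have iff: "F x \<le> s \<longleftrightarrow> x \<le> Sup Z" for x
    using cSup_upper[OF _ bdd, of x] F_mono[of x "Sup Z"] sup by (auto simp: Z_def)
  obtain x where x: "F x = s"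
  proof -
    have "y \<le> u" using F_mono[of u y] \<open>F y < s\<close> u by linarith
    then show ?thesis
      using IVT[of F y s u] \<open>F y < s\<close> u F_continuous that by (meson less_imp_le)
  qed
  then have "x \<le> Sup Z" using iff by auto
  then have "F (Sup Z) = s" using F_mono[of x "Sup Z"] x sup by (auto simp: Z_def)
  with iff that show thesis by blast
qed

lemma F_uniform:
  assumes "0 \<le> s" "s \<le> mass"
  shows "measure M {w \<in> space M. F (X w) \<le> s} = s"
proof -
  have inner: "measure M {w \<in> space M. F (X w) \<le> s} = s" if s: "0 < s" "s < mass" for s
  proof -
    obtain z where z: "F z = s" "\<And>x. F x \<le> s \<longleftrightarrow> x \<le> z" using F_level[OF s] by blast
    show ?thesis using cdf_law[OF X_measurable, of z] z(1) unfolding z(2) by argo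
  qed
  consider "0 < s" "s < mass" | "s = mass" | "s = 0" "0 < mass" using assms by linarith
  then show ?thesis
  proof cases
    case 1
    then show ?thesis by (rule inner)
  next
    case 2
    then show ?thesis using F_le_mass by (simp add: mass_def)
  next
    case 3
    have "measure M {w \<in> space M. F (X w) \<le> 0} \<le> 0"
    proof (rule field_le_epsilon)
      fix e :: real assume "0 < e"
      define t where "t = min e (mass / 2)"
      have t: "0 < t" "t < mass" "t \<le> e" using \<open>0 < e\<close> 3 by (auto simp: t_def)
      have "measure M {w \<in> space M. F (X w) \<le> 0} \<le> measure M {w \<in> space M. F (X w) \<le> t}"
        using t by (intro finite_measure_mono) auto
      then show "measure M {w \<in> space M. F (X w) \<le> 0} \<le> 0 + e" using inner[OF t(1,2)] t by simp
    qed
    then show ?thesis using 3 by (simp add: measure_le_0_iff)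
  qed
qed

text \<open>
  Since \<open>F \<circ> X\<close> is uniformly distributed, the sublevel set of 0 has measure 0, and the set
  \<open>mass \<le> F \<circ> X\<close> lies in the complement of sublevel sets of measure arbitrarily close to \<open>mass\<close>.
\<close>
lemma AE_interior: "AE w in M. 0 < F (X w) \<and> F (X w) < mass"
proof -
  have mass: "0 \<le> mass" by (simp add: mass_def)
  have "AE w in M. w \<notin> {w \<in> space M. F (X w) \<le> 0}"
    using F_uniform[of 0] mass by (intro AE_not_in) (simp add: null_sets_def emeasure_eq_measure)
  moreover have "AE w in M. w \<notin> {w \<in> space M. mass \<le> F (X w)}"
  proof -
    have "measure M {w \<in> space M. mass \<le> F (X w)} \<le> 0"
    proof (rule field_le_epsilon)
      fix e :: real assume "0 < e"
      define t where "t = max 0 (mass - e)"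
      have t: "0 \<le> t" "t \<le> mass" "mass - t \<le> e" using \<open>0 < e\<close> mass by (auto simp: t_def)
      show "measure M {w \<in> space M. mass \<le> F (X w)} \<le> 0 + e"
      proof (cases "mass = 0")
        case True
        then show ?thesis 
          using \<open>0 < e\<close> bounded_measure[of "{w \<in> space M. mass \<le> F (X w)}"] by (simp add: mass_def)
      next
        case False
        then have "t < mass" using mass \<open>0 < e\<close> by (auto simp: t_def)
        then have "measure M {w \<in> space M. mass \<le> F (X w)} \<le>
            measure M (space M - {w \<in> space M. F (X w) \<le> t})"
          by (intro finite_measure_mono) auto
        also have "\<dots> = mass - t"
          using F_uniform[OF t(1,2)] by (subst finite_measure_compl) (auto simp: mass_def)
        finally show ?thesis using t by simp
      qed
    qed
    then have "measure M {w \<in> space M. mass \<le> F (X w)} = 0" by (simp add: measure_le_0_iff)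
    then show ?thesis by (intro AE_not_in) (simp add: null_sets_def emeasure_eq_measure)
  qed
  ultimately show ?thesis
    using AE_space by eventually_elim auto
qed

lemma rearrangement_equimeasurable:
  assumes [measurable]: "f \<in> borel_measurable M"
  shows "distr M borel (\<lambda>w. rearrangement f (X w)) = distr M borel f"
proof (rule cdf_unique')
  show "cdf (distr M borel (\<lambda>w. rearrangement f (X w))) = cdf (distr M borel f)"
  proof
    fix t
    have "measure M {w \<in> space M. rearrangement f (X w) \<le> t} =
        measure M {w \<in> space M. F (X w) \<le> cdf (distr M borel f) t}"
    proof (intro finite_measure_eq_AE)
      show "AE w in M. w \<in> {w \<in> space M. rearrangement f (X w) \<le> t} \<longleftrightarrow>
          w \<in> {w \<in> space M. F (X w) \<le> cdf (distr M borel f) t}"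
        using AE_interior
      proof eventually_elim
        case (elim w)
        then show ?case using rearrangement_le_iff[OF assms, of "X w" t] by blast
      qed
    qed measurable
    also have "\<dots> = cdf (distr M borel f) t"
      by (intro F_uniform) (auto simp: cdf_law mass_def bounded_measure)
    finally show "cdf (distr M borel (\<lambda>w. rearrangement f (X w))) t = cdf (distr M borel f) t"
      by (subst cdf_law) auto
  qed
qed (auto intro!: law_finite_borel)

lemma integral_rearrangement:
  fixes h :: "real \<Rightarrow> real"
  assumes [measurable]: "f \<in> borel_measurable M" "h \<in> borel_measurable borel"
  shows "(\<integral>w. h (rearrangement f (X w)) \<partial>M) = (\<integral>w. h (f w) \<partial>M)"
    and "integrable M (\<lambda>w. h (rearrangement f (X w))) \<longleftrightarrow> integrable M (\<lambda>w. h (f w))"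
proof -
  note eq = rearrangement_equimeasurable[OF assms(1)]
  show "(\<integral>w. h (rearrangement f (X w)) \<partial>M) = (\<integral>w. h (f w) \<partial>M)"
    using integral_distr[of "\<lambda>w. rearrangement f (X w)" M borel h]
      integral_distr[of f M borel h] eq by simp
  show "integrable M (\<lambda>w. h (rearrangement f (X w))) \<longleftrightarrow> integrable M (\<lambda>w. h (f w))"
    using integrable_distr_eq[of "\<lambda>w. rearrangement f (X w)" M borel h]
      integrable_distr_eq[of f M borel h] eq by simp
qed

lemma rearrangement_integrable:
  assumes "integrable M f"
  shows "integrable M (\<lambda>w. rearrangement f (X w))"
    and "(\<integral>w. rearrangement f (X w) \<partial>M) = integral\<^sup>L M f"
proof -
  have fm: "f \<in> borel_measurable M" and id: "(\<lambda>x::real. x) \<in> borel_measurable borel"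
    using assms by auto
  show "integrable M (\<lambda>w. rearrangement f (X w))"
    by (rule integral_rearrangement(2)[OF fm id, THEN iffD2, OF assms])
  show "(\<integral>w. rearrangement f (X w) \<partial>M) = integral\<^sup>L M f"
    by (rule integral_rearrangement(1)[OF fm id])
qed

lemma rearrangement_square_integrable:
  assumes "f \<in> borel_measurable M" "integrable M (\<lambda>w. (f w)\<^sup>2)"
  shows "integrable M (\<lambda>w. (rearrangement f (X w))\<^sup>2)"
    and "(\<integral>w. (rearrangement f (X w))\<^sup>2 \<partial>M) = (\<integral>w. (f w)\<^sup>2 \<partial>M)"
proof -
  have sq: "(\<lambda>x::real. x\<^sup>2) \<in> borel_measurable borel" by simp
  show "integrable M (\<lambda>w. (rearrangement f (X w))\<^sup>2)"
    by (rule integral_rearrangement(2)[OF assms(1) sq, THEN iffD2, OF assms(2)])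
  show "(\<integral>w. (rearrangement f (X w))\<^sup>2 \<partial>M) = (\<integral>w. (f w)\<^sup>2 \<partial>M)"
    by (rule integral_rearrangement(1)[OF assms(1) sq])
qed

text \<open>
  Among all functions with a given law, the increasing one puts the most mass on an up-set of the
  coordinate. With \<open>t\<close> the value of the rearrangement \<open>g\<close> at the edge of the up-set, \<open>f - t\<close> is
  at most its positive part, whose integral depends on the law alone, and for \<open>g\<close> the positive part
  of \<open>g - t\<close> lives exactly on the up-set.
\<close>
lemma bathtub:
  assumes "integrable M f"
  shows "(\<integral>w. (if s < X w then f w else 0) \<partial>M) \<le>
    (\<integral>w. (if s < X w then rearrangement f (X w) else 0) \<partial>M)"
proof -
  have [measurable]: "f \<in> borel_measurable M" using assms by simp
  define g where "g w = rearrangement f (X w)" for w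
  have [measurable]: "g \<in> borel_measurable M" unfolding g_def by measurable
  have g: "integrable M g"
    unfolding g_def by (rule rearrangement_integrable(1)[OF assms])
  have g_eq: "integral\<^sup>L M g = integral\<^sup>L M f"
    unfolding g_def by (rule rearrangement_integrable(2)[OF assms])
  have restr: "integrable M (\<lambda>w. if P w then h w else 0)"
    if "integrable M h" "Measurable.pred M P" for h :: "'a \<Rightarrow> real" and P
    using integrable_mult_indicator[of "{w \<in> space M. P w}" M h] that
    by (subst Bochner_Integration.integrable_cong[OF refl, where g = "\<lambda>w. indicator {w \<in> space M. P w} w *\<^sub>R h w"])
       (auto simp: indicator_def)
  consider "F s \<le> 0" | "mass \<le> F s" | "0 < F s" "F s < mass" by linarith
  then show ?thesis
  proof cases
    case 1
    have "AE w in M. s < X w"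
      using AE_interior 
    proof eventually_elim
      case (elim w)
      then show ?case using 1 F_mono[of "X w" s] by linarith
    qed
    then have "(\<integral>w. (if s < X w then h w else 0) \<partial>M) = integral\<^sup>L M h" 
      if [measurable]: "h \<in> borel_measurable M" for h :: "'a \<Rightarrow> real"
      by (intro integral_cong_AE) auto
    then show ?thesis using g_eq by (simp flip: g_def)
  next
    case 2
    have "AE w in M. \<not> s < X w"
      using AE_interior 
    proof eventually_elim
      case (elim w)
      then show ?case using 2 F_mono[of s "X w"] by linarith
    qed
    then have "(\<integral>w. (if s < X w then h w else 0) \<partial>M) = integral\<^sup>L M (\<lambda>w. 0)" 
      if [measurable]: "h \<in> borel_measurable M" for h :: "'a \<Rightarrow> real"
      by (intro integral_cong_AE) auto
    then show ?thesis by (simp flip: g_def)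
  next
    case 3
    define t where "t = rearrangement f s"
    have pos: "integrable M (\<lambda>w. max 0 (h w - t))" if "integrable M h" for h
      using that by (intro integrable_max) auto
    have split: "(\<integral>w. (if s < X w then h w else 0) \<partial>M) =
        (\<integral>w. (if s < X w then h w - t else 0) \<partial>M) + (\<integral>w. (if s < X w then t else 0) \<partial>M)"
      if "integrable M h" for h
      using that by (subst Bochner_Integration.integral_add[symmetric])
        (auto intro!: restr Bochner_Integration.integral_cong)
    have "(\<integral>w. (if s < X w then f w - t else 0) \<partial>M) \<le> (\<integral>w. max 0 (f w - t) \<partial>M)"
      using assms by (intro integral_mono restr pos) auto
    also have "\<dots> = (\<integral>w. max 0 (g w - t) \<partial>M)"
      unfolding g_def
      by (rule integral_rearrangement(1)[of f "\<lambda>x. max 0 (x - t)", symmetric]) measurable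
    also have "\<dots> = (\<integral>w. (if s < X w then g w - t else 0) \<partial>M)"
    proof (intro integral_cong_AE)
      show "AE w in M. max 0 (g w - t) = (if s < X w then g w - t else 0)"
        using AE_interior
      proof eventually_elim
        case (elim w)
        then show ?case
          using mono_onD[OF rearrangement_mono[of f], of s "X w"]
            mono_onD[OF rearrangement_mono[of f], of "X w" s] 3
          by (auto simp: g_def t_def)
      qed
    qed auto
    finally show ?thesis
      using split[OF assms] split[OF g] unfolding g_def[symmetric] by linarith
  qed
qed

end

text \<open>
  A staircase of step size \<open>h\<close> written as a sum of indicators of up-sets; it transfers
  statements about up-sets to the coordinate itself.
\<close>
lemma staircase_approximation:
  fixes x a h :: real
  assumes "a \<le> x" "0 \<le> h"
  shows "min (x - a) (real n * h) \<le> h * (\<Sum>i<n. if a + real i * h < x then 1 else 0)"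
    and "h * (\<Sum>i<n. if a + real i * h < x then 1 else 0) \<le> x - a + h"
proof -
  define S where "S n = (\<Sum>i<n. if a + real i * h < x then 1 else 0 :: real)" for n
  have S: "0 \<le> S n" "S n \<le> real n" for n
    unfolding S_def using sum_bounded_above[of "{..<n}" "\<lambda>i. if a + real i * h < x then 1 else 0" "1::real"]
    by (auto intro!: sum_nonneg)
  have full: "S n = real n" if "a + real n * h < x" for n
  proof -
    have "a + real i * h < x" if "i < n" for i
      using that \<open>a + real n * h < x\<close> assms(2) mult_right_mono[of "real i" "real n" h] by simp
    then show ?thesis by (simp add: S_def)
  qed
  have Suc: "S (Suc n) = S n + (if a + real n * h < x then 1 else 0)" for n
    by (simp add: S_def)
  have "min (x - a) (real n * h) \<le> h * S n \<and> h * S n \<le> x - a + h"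
  proof (induction n)
    case 0
    then show ?case using assms by (simp add: S_def)
  next
    case (Suc n)
    show ?case
    proof (cases "a + real n * h < x")
      case True
      then have "S (Suc n) = real n + 1" using full[OF True] Suc by (simp add: S_def)
      then show ?thesis using True by (simp add: algebra_simps)
    next
      case False
      then have "S (Suc n) = S n" by (simp add: S_def)
      then show ?thesis using False Suc.IH by auto
    qed
  qed
  then show "min (x - a) (real n * h) \<le> h * (\<Sum>i<n. if a + real i * h < x then 1 else 0)"
    and "h * (\<Sum>i<n. if a + real i * h < x then 1 else 0) \<le> x - a + h"
    by (auto simp: S_def)
qed

context atomless_coordinate
begin

text \<open>
  The Hardy--Littlewood inequality: the coordinate is a uniform limit of staircases, and for
  staircases the claim is a sum of instances of \<open>bathtub\<close>.
\<close>
lemma rearrangement_correlation: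
  assumes f: "integrable M f" and X: "\<And>w. w \<in> space M \<Longrightarrow> a \<le> X w \<and> X w \<le> b"
  shows "(\<integral>w. X w * f w \<partial>M) \<le> (\<integral>w. X w * rearrangement f (X w) \<partial>M)"
proof (rule LIMSEQ_le)
  have [measurable]: "f \<in> borel_measurable M" using f by simp
  define g where "g w = rearrangement f (X w)" for w
  have [measurable]: "g \<in> borel_measurable M" unfolding g_def by measurable
  have g: "integrable M g"
    unfolding g_def by (rule rearrangement_integrable(1)[OF f])
  have g_eq: "integral\<^sup>L M g = integral\<^sup>L M f"
    unfolding g_def by (rule rearrangement_integrable(2)[OF f])
  define h where "h n = \<bar>b - a\<bar> / real (Suc n)" for n
  define Y where "Y n w = a + h n * (\<Sum>i<Suc n. if a + real i * h n < X w then 1 else 0)" for n w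
  have [measurable]: "Y n \<in> borel_measurable M" for n unfolding Y_def by measurable
  have h0: "0 \<le> h n" for n by (simp add: h_def)
  have h_lim: "h \<longlonglongrightarrow> 0" unfolding h_def by (rule LIMSEQ_Suc) (rule lim_const_over_n)
  have Y_near: "\<bar>Y n w - X w\<bar> \<le> h n" if "w \<in> space M" for n w
  proof -
    have "real (Suc n) * h n = \<bar>b - a\<bar>" by (simp add: h_def del: of_nat_Suc)
    then show ?thesis
      using staircase_approximation[of a "X w" "h n" "Suc n"] X[OF that] h0[of n]
      unfolding Y_def by (simp add: abs_le_iff)
  qed
  have h_le: "h n \<le> \<bar>b - a\<bar>" for n
    unfolding h_def by (simp add: divide_le_eq mult_le_cancel_left1)
  have Y_bound: "\<bar>Y n w\<bar> \<le> \<bar>a\<bar> + \<bar>b\<bar> + \<bar>b - a\<bar>" if "w \<in> space M" for n w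
    using Y_near[OF that, of n] X[OF that] h_le[of n] by linarith
  have lim: "(\<lambda>n. \<integral>w. Y n w * k w \<partial>M) \<longlonglongrightarrow> (\<integral>w. X w * k w \<partial>M)" if k: "integrable M k" for k
  proof (rule integral_dominated_convergence)
    show "integrable M (\<lambda>w. (\<bar>a\<bar> + \<bar>b\<bar> + \<bar>b - a\<bar>) * \<bar>k w\<bar>)" using k by simp
    show "AE w in M. (\<lambda>n. Y n w * k w) \<longlonglongrightarrow> X w * k w"
    proof (intro AE_I2 tendsto_mult tendsto_const)
      fix w assume w: "w \<in> space M"
      have "(\<lambda>n. Y n w - X w) \<longlonglongrightarrow> 0"
        using Lim_null_comparison[OF _ h_lim, of "\<lambda>n. Y n w - X w"] Y_near[OF w] by simp
      then show "(\<lambda>n. Y n w) \<longlonglongrightarrow> X w" by (simp add: LIM_zero_iff)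
    qed
    show "AE w in M. norm (Y n w * k w) \<le> (\<bar>a\<bar> + \<bar>b\<bar> + \<bar>b - a\<bar>) * \<bar>k w\<bar>" for n
      using Y_bound by (intro AE_I2) (auto simp: abs_mult intro!: mult_right_mono)
  qed (use k in auto)
  from lim[OF f] show "(\<lambda>n. \<integral>w. Y n w * f w \<partial>M) \<longlonglongrightarrow> (\<integral>w. X w * f w \<partial>M)" .
  from lim[OF g] show "(\<lambda>n. \<integral>w. Y n w * g w \<partial>M) \<longlonglongrightarrow> (\<integral>w. X w * rearrangement f (X w) \<partial>M)"
    by (simp add: g_def)
  have expand: "(\<integral>w. Y n w * k w \<partial>M) =
      a * integral\<^sup>L M k + h n * (\<Sum>i<Suc n. \<integral>w. (if a + real i * h n < X w then k w else 0) \<partial>M)"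
    if k: "integrable M k" for n k
  proof -
    have int: "integrable M (\<lambda>w. if s < X w then k w else 0)" for s
      using integrable_mult_indicator[of "{w \<in> space M. s < X w}" M k] k
      by (subst Bochner_Integration.integrable_cong[OF refl, where g = "\<lambda>w. indicator {w \<in> space M. s < X w} w *\<^sub>R k w"])
         (auto simp: indicator_def)
    have "(\<integral>w. Y n w * k w \<partial>M) =
        (\<integral>w. a * k w + h n * (\<Sum>i<Suc n. if a + real i * h n < X w then k w else 0) \<partial>M)"
      unfolding Y_def
      by (intro Bochner_Integration.integral_cong)
         (auto simp: distrib_right sum_distrib_right mult.assoc if_distrib intro!: sum.cong cong: if_cong simp del: sum.lessThan_Suc)
    also have "\<dots> = a * integral\<^sup>L M k + h n * (\<Sum>i<Suc n. \<integral>w. (if a + real i * h n < X w then k w else 0) \<partial>M)"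
      using int k by (simp add: Bochner_Integration.integral_sum del: sum.lessThan_Suc)
    finally show ?thesis .
  qed
  show "\<exists>N. \<forall>n\<ge>N. (\<integral>w. Y n w * f w \<partial>M) \<le> (\<integral>w. Y n w * g w \<partial>M)"
    unfolding expand[OF f] expand[OF g] g_eq
    using bathtub[OF f] h0 unfolding g_def
    by (intro exI[of _ 0] allI impI add_left_mono mult_left_mono sum_mono) auto
qed

text \<open>
  Expanding the square, only the mixed term depends on more than the laws of \<open>f\<close> and of the
  coordinate.
\<close>
lemma rearrangement_distance:
  assumes f: "f \<in> borel_measurable M" "integrable M (\<lambda>w. (f w)\<^sup>2)"
    and X: "\<And>w. w \<in> space M \<Longrightarrow> a \<le> X w \<and> X w \<le> b"
  shows "(\<integral>w. (rearrangement f (X w) - X w)\<^sup>2 \<partial>M) \<le> (\<integral>w. (f w - X w)\<^sup>2 \<partial>M)"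
proof -
  have [measurable]: "f \<in> borel_measurable M" by fact
  define g where "g w = rearrangement f (X w)" for w
  have [measurable]: "g \<in> borel_measurable M" unfolding g_def by measurable
  have g2: "integrable M (\<lambda>w. (g w)\<^sup>2)" "(\<integral>w. (g w)\<^sup>2 \<partial>M) = (\<integral>w. (f w)\<^sup>2 \<partial>M)"
    unfolding g_def by (rule rearrangement_square_integrable[OF f])+
  have expand: "(\<integral>w. (k w - X w)\<^sup>2 \<partial>M) =
      (\<integral>w. (k w)\<^sup>2 \<partial>M) - 2 * (\<integral>w. X w * k w \<partial>M) + (\<integral>w. (X w)\<^sup>2 \<partial>M)"
    and k1: "integrable M k"
    if [measurable]: "k \<in> borel_measurable M" and k: "integrable M (\<lambda>w. (k w)\<^sup>2)" for k
  proof -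
    show k1: "integrable M k"
      using k by (rule square_integrable_imp_integrable[rotated]) simp
    have bd: "\<bar>X w\<bar> \<le> \<bar>a\<bar> + \<bar>b\<bar>" if "w \<in> space M" for w using X[OF that] by linarith
    have Xk: "integrable M (\<lambda>w. X w * k w)"
      by (rule Bochner_Integration.integrable_bound[of _ "\<lambda>w. (\<bar>a\<bar> + \<bar>b\<bar>) * k w"])
         (use k1 bd in \<open>auto intro!: AE_I2 mult_right_mono simp: abs_mult\<close>)
    have X2: "integrable M (\<lambda>w. (X w)\<^sup>2)"
      using bd by (intro integrable_const_bound[of _ "(\<bar>a\<bar> + \<bar>b\<bar>)\<^sup>2"])
        (auto intro!: AE_I2 power_mono simp: abs_le_square_iff[symmetric])
    have "(\<integral>w. (k w - X w)\<^sup>2 \<partial>M) = (\<integral>w. (k w)\<^sup>2 - 2 * (X w * k w) + (X w)\<^sup>2 \<partial>M)"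
      by (intro Bochner_Integration.integral_cong) (auto simp: power2_eq_square algebra_simps)
    then show "(\<integral>w. (k w - X w)\<^sup>2 \<partial>M) =
      (\<integral>w. (k w)\<^sup>2 \<partial>M) - 2 * (\<integral>w. X w * k w \<partial>M) + (\<integral>w. (X w)\<^sup>2 \<partial>M)"
      using k Xk X2 by simp
  qed
  show ?thesis
    using expand[OF f(1,2)] expand[of g] g2 rearrangement_correlation[OF k1[OF f] X]
    by (simp add: g_def)
qed

text \<open>
  Chebyshev's inequality: if the increasing function \<open>rearrangement f\<close> is nonnegative at \<open>x\<close>, its
  square is at least this large everywhere to the right of \<open>x\<close>, and if it is negative, everywhere to
  the left. This provides the pointwise bounds for Helly's theorem.
\<close>
lemma rearrangement_pointwise_bound:
  assumes f: "f \<in> borel_measurable M" "integrable M (\<lambda>w. (f w)\<^sup>2)"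
    and x: "0 < F x" "F x < mass"
  shows "(rearrangement f x)\<^sup>2 * min (F x) (mass - F x) \<le> (\<integral>w. (f w)\<^sup>2 \<partial>M)"
proof -
  have [measurable]: "f \<in> borel_measurable M" by fact
  define g where "g w = rearrangement f (X w)" for w
  have [measurable]: "g \<in> borel_measurable M" unfolding g_def by measurable
  have g2: "integrable M (\<lambda>w. (g w)\<^sup>2)" "(\<integral>w. (g w)\<^sup>2 \<partial>M) = (\<integral>w. (f w)\<^sup>2 \<partial>M)"
    unfolding g_def by (rule rearrangement_square_integrable[OF f])+
  have Chebyshev: "(rearrangement f x)\<^sup>2 * measure M A \<le> (\<integral>w. (g w)\<^sup>2 \<partial>M)"
    if [measurable]: "A \<in> sets M"
      and A: "AE w in M. w \<in> A \<longrightarrow> (rearrangement f x)\<^sup>2 \<le> (g w)\<^sup>2" for A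
  proof -
    have "(rearrangement f x)\<^sup>2 * measure M A = (\<integral>w. (rearrangement f x)\<^sup>2 * indicator A w \<partial>M)"
      using that by (simp add: measure_def)
    also have "\<dots> \<le> (\<integral>w. (g w)\<^sup>2 \<partial>M)"
    proof (intro integral_mono_AE g2(1))
      show "integrable M (\<lambda>w. (rearrangement f x)\<^sup>2 * indicator A w)"
        by (intro integrable_mult_right integrable_real_indicator) (auto simp: emeasure_eq_measure)
      show "AE w in M. (rearrangement f x)\<^sup>2 * indicator A w \<le> (g w)\<^sup>2"
        using A by eventually_elim (auto simp: indicator_def)
    qed
    finally show ?thesis .
  qed
  note rmono = mono_onD[OF rearrangement_mono[OF f(1)]]
  show ?thesis
  proof (cases "0 \<le> rearrangement f x")
    case True
    have "AE w in M. w \<in> space M - {w \<in> space M. X w \<le> x} \<longrightarrow> (rearrangement f x)\<^sup>2 \<le> (g w)\<^sup>2"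
      using AE_interior
    proof eventually_elim
      case (elim w)
      then show ?case using rmono[of x "X w"] x True by (auto simp: g_def intro!: power_mono)
    qed
    then have "(rearrangement f x)\<^sup>2 * measure M (space M - {w \<in> space M. X w \<le> x}) \<le> (\<integral>w. (g w)\<^sup>2 \<partial>M)"
      by (intro Chebyshev) auto
    moreover have "measure M (space M - {w \<in> space M. X w \<le> x}) = mass - F x"
      by (subst finite_measure_compl) (auto simp: cdf_law mass_def)
    ultimately have "(rearrangement f x)\<^sup>2 * (mass - F x) \<le> (\<integral>w. (f w)\<^sup>2 \<partial>M)" using g2 by simp
    then show ?thesis
      by (rule order_trans[rotated]) (intro mult_left_mono, auto)
  next
    case False
    have "AE w in M. w \<in> {w \<in> space M. X w \<le> x} \<longrightarrow> (rearrangement f x)\<^sup>2 \<le> (g w)\<^sup>2"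
      using AE_interior
    proof eventually_elim
      case (elim w)
      then show ?case
        using rmono[of "X w" x] x False by (auto simp: g_def abs_le_square_iff[symmetric])
    qed
    then have "(rearrangement f x)\<^sup>2 * measure M {w \<in> space M. X w \<le> x} \<le> (\<integral>w. (g w)\<^sup>2 \<partial>M)"
      by (intro Chebyshev) auto
    then have "(rearrangement f x)\<^sup>2 * F x \<le> (\<integral>w. (f w)\<^sup>2 \<partial>M)" using g2 by (simp add: cdf_law)
    then show ?thesis
      by (rule order_trans[rotated]) (intro mult_left_mono, auto)
  qed
qed

end

section \<open>Gradients as limits of continuously differentiable functions\<close>

definition C1_pair :: "(real \<Rightarrow> real) \<Rightarrow> (real \<Rightarrow> real) \<Rightarrow> bool" where
  "C1_pair U \<phi> \<longleftrightarrow> (\<forall>x. (U has_real_derivative \<phi> x) (at x)) \<and> continuous_on UNIV \<phi>"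

lemma C1_pairD: "C1_pair U \<phi> \<Longrightarrow> (U has_real_derivative \<phi> x) (at x)"
  by (simp add: C1_pair_def)

lemma C1_pair_continuous:
  assumes "C1_pair U \<phi>"
  shows "continuous_on A U" "continuous_on A \<phi>"
  using assms unfolding C1_pair_def
  by (meson DERIV_isCont continuous_at_imp_continuous_on, meson continuous_on_subset subset_UNIV)

lemma C1_pair_borel:
  assumes "C1_pair U \<phi>"
  shows "U \<in> borel_measurable borel" "\<phi> \<in> borel_measurable borel"
  using C1_pair_continuous[OF assms] by (auto intro: borel_measurable_continuous_onI)

lemma C1_pair_lincomb:
  assumes "C1_pair U \<phi>" "C1_pair V \<psi>"
  shows "C1_pair (\<lambda>x. s * U x + t * V x) (\<lambda>x. s * \<phi> x + t * \<psi> x)"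
  using assms C1_pair_continuous[of U \<phi> UNIV] C1_pair_continuous[of V \<psi> UNIV] unfolding C1_pair_def
  by (auto intro!: derivative_eq_intros continuous_intros)

lemma C1_pair_const: "C1_pair (\<lambda>x. c) (\<lambda>x. 0)"
  by (simp add: C1_pair_def)

lemma C1_pair_exists:
  assumes "continuous_on UNIV \<phi>"
  shows "\<exists>U. C1_pair U \<phi> \<and> U c = 0"
proof -
  have "\<exists>U. \<forall>x::real. - \<infinity> < ereal x \<longrightarrow> ereal x < \<infinity> \<longrightarrow> (U has_vector_derivative \<phi> x) (at x)"
    using assms by (intro einterval_antiderivative) (auto simp: continuous_on_eq_continuous_at)
  then obtain U where U: "\<And>x. (U has_vector_derivative \<phi> x) (at x)" by auto
  then have "C1_pair (\<lambda>x. U x - U c) \<phi>"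
    using assms unfolding C1_pair_def has_real_derivative_iff_has_vector_derivative
    by (auto intro!: derivative_eq_intros)
  then show ?thesis by (intro exI[of _ "\<lambda>x. U x - U c"]) simp
qed

lemma C1_pair_mono:
  assumes "C1_pair U \<phi>" "\<And>x. 0 \<le> \<phi> x" "s \<le> t"
  shows "U s \<le> U t"
  using assms by (intro DERIV_nonneg_imp_nondecreasing[of s t U]) (auto simp: C1_pair_def)

text \<open>
  Passing to the type of polynomials gives antiderivatives and all higher derivatives for free.
\<close>
lemma polynomial_antiderivative:
  assumes "real_polynomial_function (g :: real \<Rightarrow> real)"
  shows "\<exists>q. \<forall>x. poly (pderiv q) x = g x"
proof -
  obtain c n where g: "g = (\<lambda>x. \<Sum>i\<le>n. c i * x ^ i)"
    using real_polynomial_function_imp_sum[OF assms] by blast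
  define q where "q = (\<Sum>i\<le>n. monom (c i / real (Suc i)) (Suc i))"
  have "pderiv q = (\<Sum>i\<le>n. monom (c i) i)"
    unfolding q_def by (induction n) (simp_all add: pderiv_add pderiv_monom del: of_nat_Suc)
  then show ?thesis
    by (intro exI[of _ q]) (simp add: g poly_sum poly_monom)
qed

text \<open>
  The measure lives on the open interval as its space, so that a Borel function on the line
  represents an element of \<open>L\<^sup>2\<close> through its values inside the interval.
\<close>
locale interval_measure = finite_measure M for M :: "real measure" +
  fixes a b :: real and I :: "real set"
  assumes a_less_b: "a < b" and I_eq: "I = {a<..<b}"
    and sets_M: "sets M = sets (restrict_space borel I)"
begin

lemma space_M [simp]: "space M = I"
  using sets_eq_imp_space_eq[OF sets_M] by (simp add: space_restrict_space)

lemma I_borel [measurable]: "I \<in> sets borel"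
  by (simp add: I_eq)

lemma sets_M_iff: "A \<in> sets M \<longleftrightarrow> A \<in> sets borel \<and> A \<subseteq> I"
  unfolding sets_M by (subst sets_restrict_space_iff) auto

lemma borel_measurable_M [measurable (raw)]:
  "f \<in> borel_measurable borel \<Longrightarrow> f \<in> borel_measurable M"
  unfolding measurable_cong_sets[OF sets_M refl] by (rule measurable_restrict_space1)

lemma bounded_L2:
  assumes "f \<in> borel_measurable M" "\<And>x. x \<in> I \<Longrightarrow> \<bar>f x\<bar> \<le> B"
  shows "f \<in> L2 M" "sqnorm M f \<le> B\<^sup>2 * measure M I"
proof -
  have B: "(\<lambda>x. B) \<in> L2 M" by (rule L2_I) auto
  have le: "\<bar>f x\<bar> \<le> \<bar>B\<bar>" if "x \<in> space M" for x using assms(2)[of x] that by simp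
  show "f \<in> L2 M" using L2_dominated(1)[OF assms(1) B le] .
  have "sqnorm M (\<lambda>x. B) = B\<^sup>2 * measure M I" by (simp add: sqnorm_def)
  then show "sqnorm M f \<le> B\<^sup>2 * measure M I"
    using L2_dominated(2)[OF assms(1) B le] by simp
qed

lemma continuous_L2:
  assumes "continuous_on UNIV f" shows "f \<in> L2 M"
proof -
  have "compact (f ` {a..b})"
    by (intro compact_continuous_image continuous_on_subset[OF assms]) auto
  then obtain B where "\<And>x. x \<in> {a..b} \<Longrightarrow> \<bar>f x\<bar> \<le> B"
    by (metis bounded_iff compact_imp_bounded imageI real_norm_def)
  then show ?thesis
    using assms by (intro bounded_L2(1)[of f B] borel_measurable_M borel_measurable_continuous_onI)
      (auto simp: I_eq)
qed

lemma C1_pair_L2: "C1_pair U \<phi> \<Longrightarrow> U \<in> L2 M" "C1_pair U \<phi> \<Longrightarrow> \<phi> \<in> L2 M"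
  using C1_pair_continuous by (auto intro: continuous_L2)

text \<open>
  The derivative on the closed interval is extended to the line by constants, and the function by
  integration.
\<close>
lemma smooth_imp_C1_pair:
  assumes "U \<in> smooth_upto_boundary I"
  shows "\<exists>V \<phi>. C1_pair V \<phi> \<and> (\<forall>x \<in> I. V x = U x \<and> \<phi> x = deriv U x)"
proof -
  have cl: "closure I = {a..b}" using a_less_b by (simp add: I_eq)
  obtain D :: "nat \<Rightarrow> real \<Rightarrow> real" where D0: "D 0 = U"
    and D: "\<And>k x. x \<in> {a..b} \<Longrightarrow> (D k has_real_derivative D (Suc k) x) (at x within {a..b})"
    using assms unfolding smooth_upto_boundary_def cl by blast
  have cont: "continuous_on {a..b} (D 1)"
    using D[of _ 1] by (meson DERIV_continuous continuous_on_eq_continuous_within)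
  define \<phi> where "\<phi> x = D 1 (max a (min b x))" for x
  have U_deriv: "(U has_real_derivative \<phi> x) (at x within {a..b})" if x: "x \<in> {a..b}" for x
  proof -
    have "\<phi> x = D 1 x" using x by (auto simp: \<phi>_def max_def min_def)
    then show ?thesis using D[OF x, of 0] by (simp add: D0)
  qed
  have "continuous_on UNIV \<phi>"
    unfolding \<phi>_def
    by (rule continuous_on_compose2[OF cont]) (use a_less_b in \<open>auto intro!: continuous_intros\<close>)
  then obtain V where V: "C1_pair V \<phi>" using C1_pair_exists by blast
  have "\<exists>c. \<forall>x\<in>{a..b}. U x - V x = c"
  proof (rule has_field_derivative_zero_constant)
    fix x assume x: "x \<in> {a..b}"
    from DERIV_diff[OF U_deriv[OF x] has_field_derivative_at_within[OF C1_pairD[OF V]]]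
    show "((\<lambda>x. U x - V x) has_real_derivative 0) (at x within {a..b})" by simp
  qed simp
  then obtain c where c: "\<And>x. x \<in> {a..b} \<Longrightarrow> U x - V x = c" by blast
  have "C1_pair (\<lambda>x. V x + c) \<phi>"
    using C1_pair_lincomb[OF V C1_pair_const[of c], of 1 1] by simp
  moreover have "V x + c = U x \<and> \<phi> x = deriv U x" if "x \<in> I" for x
  proof -
    have x: "x \<in> {a..b}" "x \<in> interior {a..b}" using that by (auto simp: I_eq)
    have "(U has_real_derivative \<phi> x) (at x)"
      using U_deriv[OF x(1)] unfolding at_within_interior[OF x(2)] .
    then show ?thesis using c[OF x(1)] by (simp add: DERIV_imp_deriv)
  qed
  ultimately show ?thesis by blast
qed

text \<open>
  Weierstrass approximation of the derivative, followed by integration from the left end point.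
\<close>
lemma C1_pair_imp_smooth_approximation:
  assumes U: "C1_pair U \<phi>" and d: "0 < d"
  shows "\<exists>W \<in> smooth_upto_boundary I. W \<in> L2 M \<and> deriv W \<in> L2 M \<and>
    (\<forall>x \<in> I. \<bar>W x - U x\<bar> \<le> d \<and> \<bar>deriv W x - \<phi> x\<bar> \<le> d)"
proof -
  define \<epsilon> where "\<epsilon> = d / (1 + (b - a))"
  have \<epsilon>: "0 < \<epsilon>" "\<epsilon> \<le> d" "\<epsilon> * (b - a) \<le> d"
    using a_less_b d by (auto simp: \<epsilon>_def field_simps)
  obtain g where g: "real_polynomial_function g" "\<And>x. x \<in> {a..b} \<Longrightarrow> \<bar>\<phi> x - g x\<bar> < \<epsilon>"
    using Stone_Weierstrass_real_polynomial_function[OF compact_Icc C1_pair_continuous(2)[OF U] \<epsilon>(1)]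
    by metis
  obtain q where q: "\<And>x. poly (pderiv q) x = g x" using polynomial_antiderivative[OF g(1)] by blast
  define p where "p = q + [:U a - poly q a:]"
  have dp: "poly (pderiv p) x = g x" for x by (simp add: p_def pderiv_add pderiv_pCons q)
  have pa: "poly p a = U a" by (simp add: p_def)
  have deriv_p: "deriv (poly p) = poly (pderiv p)"
    by (rule ext) (rule DERIV_imp_deriv[OF poly_DERIV])
  have "poly p \<in> smooth_upto_boundary I"
    unfolding smooth_upto_boundary_def
    by (intro CollectI exI[of _ "\<lambda>k. poly ((pderiv ^^ k) p)"])
       (auto intro: has_field_derivative_at_within poly_DERIV)
  moreover have "poly p \<in> L2 M" "deriv (poly p) \<in> L2 M"
    unfolding deriv_p by (auto intro!: continuous_L2 continuous_intros)
  moreover have "\<bar>deriv (poly p) x - \<phi> x\<bar> \<le> d" if "x \<in> I" for x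
    using g(2)[of x] \<epsilon>(2) that by (auto simp: deriv_p dp I_eq abs_minus_commute)
  moreover have "\<bar>poly p x - U x\<bar> \<le> d" if "x \<in> I" for x
  proof -
    have "norm ((poly p x - U x) - (poly p a - U a)) \<le> \<epsilon> * norm (x - a)"
    proof (rule field_differentiable_bound[where S = "{a..b}" and f' = "\<lambda>z. g z - \<phi> z"])
      fix z assume z: "z \<in> {a..b}"
      have "((\<lambda>z. poly p z - U z) has_real_derivative g z - \<phi> z) (at z)"
        using DERIV_diff[OF poly_DERIV[of p z] C1_pairD[OF U, of z]] by (simp add: dp)
      then show "((\<lambda>z. poly p z - U z) has_real_derivative g z - \<phi> z) (at z within {a..b})"
        by (rule has_field_derivative_at_within)
      show "norm (g z - \<phi> z) \<le> \<epsilon>" using g(2)[OF z] by (simp add: abs_minus_commute)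
    qed (use that a_less_b in \<open>auto simp: I_eq\<close>)
    also have "\<dots> \<le> \<epsilon> * (b - a)" using that \<epsilon>(1) by (auto simp: I_eq)
    finally show ?thesis using \<epsilon>(3) pa by simp
  qed
  ultimately show ?thesis by blast
qed

text \<open>
  Smooth functions may be replaced by continuously differentiable functions on the whole line, and
  sequences by approximations up to an arbitrary error. Derivatives may thereby
  be multiplied by piecewise linear cut-offs and split into positive and negative parts.
\<close>
lemma gradients_iff:
  "v \<in> gradients I M u \<longleftrightarrow> u \<in> L2 M \<and> v \<in> L2 M \<and>
    (\<forall>e>0. \<exists>U \<phi>. C1_pair U \<phi> \<and> sqnorm M (\<lambda>x. U x - u x) < e \<and> sqnorm M (\<lambda>x. \<phi> x - v x) < e)"
  (is "_ \<longleftrightarrow> ?R")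
proof
  assume "v \<in> gradients I M u"
  then obtain U where U: "\<And>n. U n \<in> smooth_upto_boundary I" "L2_converges M U u"
      "L2_converges M (\<lambda>n. deriv (U n)) v"
    by (auto simp: gradients_def)
  have "\<exists>V \<phi>. C1_pair V \<phi> \<and> sqnorm M (\<lambda>x. V x - u x) < e \<and> sqnorm M (\<lambda>x. \<phi> x - v x) < e"
    if e: "0 < e" for e
  proof -
    have "\<forall>\<^sub>F n in sequentially. sqnorm M (\<lambda>x. U n x - u x) < e \<and> sqnorm M (\<lambda>x. deriv (U n) x - v x) < e"
      using U(2,3) e unfolding L2_converges_iff by (intro eventually_conj order_tendstoD) auto
    then obtain n where n: "sqnorm M (\<lambda>x. U n x - u x) < e" "sqnorm M (\<lambda>x. deriv (U n) x - v x) < e"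
      by (auto dest!: eventually_happens)
    obtain V \<phi> where V: "C1_pair V \<phi>" "\<And>x. x \<in> I \<Longrightarrow> V x = U n x" "\<And>x. x \<in> I \<Longrightarrow> \<phi> x = deriv (U n) x"
      using smooth_imp_C1_pair[OF U(1)] by blast
    have "sqnorm M (\<lambda>x. V x - u x) = sqnorm M (\<lambda>x. U n x - u x)"
      "sqnorm M (\<lambda>x. \<phi> x - v x) = sqnorm M (\<lambda>x. deriv (U n) x - v x)"
      unfolding sqnorm_def by (intro Bochner_Integration.integral_cong refl, simp add: V)+
    with V(1) n show ?thesis by metis
  qed
  then show ?R using U(2,3) by (auto simp: L2_converges_iff)
next
  assume R: ?R
  have "\<exists>W. W \<in> smooth_upto_boundary I \<and> W \<in> L2 M \<and> deriv W \<in> L2 M \<and>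
      sqnorm M (\<lambda>x. W x - u x) < 1 / real (Suc n) \<and> sqnorm M (\<lambda>x. deriv W x - v x) < 1 / real (Suc n)" for n
  proof -
    define e where "e = 1 / real (Suc n)"
    have e: "0 < e" by (simp add: e_def)
    \<comment> \<open>A uniform error \<open>d\<close> costs at most \<open>d\<^sup>2 \<mu>(I) < e / 4\<close> in the squared norm.\<close>
    define d where "d = sqrt (e / (4 * (measure M I + 1)))"
    have m: "0 < measure M I + 1" using measure_nonneg[of M I] by linarith
    have d: "0 < d" using e m by (simp add: d_def)
    have dm: "d\<^sup>2 * measure M I < e / 4"
    proof -
      have "d\<^sup>2 * measure M I < d\<^sup>2 * (measure M I + 1)" using d by simp
      also have "\<dots> = e / 4"
      proof -
        have "e / (4 * k) * k = e / 4" if "0 < k" for k using that by simp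
        moreover have "d\<^sup>2 = e / (4 * (measure M I + 1))" using e m by (simp add: d_def)
        ultimately show ?thesis using m by metis
      qed
      finally show ?thesis .
    qed
    have "0 < e / 4" using e by simp
    then obtain U \<phi> where U: "C1_pair U \<phi>" "sqnorm M (\<lambda>x. U x - u x) < e / 4"
        "sqnorm M (\<lambda>x. \<phi> x - v x) < e / 4"
      using R by meson
    obtain W where W: "W \<in> smooth_upto_boundary I" "W \<in> L2 M" "deriv W \<in> L2 M"
        "\<And>x. x \<in> I \<Longrightarrow> \<bar>W x - U x\<bar> \<le> d" "\<And>x. x \<in> I \<Longrightarrow> \<bar>deriv W x - \<phi> x\<bar> \<le> d"
      using C1_pair_imp_smooth_approximation[OF U(1) d] by blast
    note UL = C1_pair_L2[OF U(1)]
    have "sqnorm M (\<lambda>x. W x - U x) \<le> d\<^sup>2 * measure M I"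
      by (rule bounded_L2(2)[OF L2_measurable[OF L2_diff[OF W(2) UL(1)]] W(4)])
    moreover have "sqnorm M (\<lambda>x. deriv W x - \<phi> x) \<le> d\<^sup>2 * measure M I"
      by (rule bounded_L2(2)[OF L2_measurable[OF L2_diff[OF W(3) UL(2)]] W(5)])
    ultimately have "sqnorm M (\<lambda>x. W x - u x) < e" "sqnorm M (\<lambda>x. deriv W x - v x) < e"
      using sqnorm_triangle[OF W(2) UL(1), of u] sqnorm_triangle[OF W(3) UL(2), of v] R U(2,3) dm
      by linarith+
    then show ?thesis using W(1-3) unfolding e_def by blast
  qed
  then obtain W where W: "\<And>n. W n \<in> smooth_upto_boundary I" "\<And>n. W n \<in> L2 M" "\<And>n. deriv (W n) \<in> L2 M"
      "\<And>n. sqnorm M (\<lambda>x. W n x - u x) < 1 / real (Suc n)"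
      "\<And>n. sqnorm M (\<lambda>x. deriv (W n) x - v x) < 1 / real (Suc n)"
    by metis
  have lim: "s \<longlonglongrightarrow> 0" if "\<And>n. 0 \<le> s n" "\<And>n. s n < 1 / real (Suc n)" for s :: "nat \<Rightarrow> real"
    using that by (intro tendsto_sandwich[OF _ _ tendsto_const LIMSEQ_Suc[OF lim_const_over_n[of 1]]])
      (auto intro!: always_eventually less_imp_le)
  have "L2_converges M W u" "L2_converges M (\<lambda>n. deriv (W n)) v"
    unfolding L2_converges_iff using W R by (auto intro!: lim)
  with W(1) show "v \<in> gradients I M u" unfolding gradients_def by blast
qed

lemma gradients_L2: "v \<in> gradients I M u \<Longrightarrow> u \<in> L2 M" "v \<in> gradients I M u \<Longrightarrow> v \<in> L2 M"
  by (auto simp: gradients_iff)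

lemma C1_pair_gradients: "C1_pair U \<phi> \<Longrightarrow> \<phi> \<in> gradients I M U"
  unfolding gradients_iff
  by (intro conjI allI impI C1_pair_L2(1) C1_pair_L2(2)[of U] exI[of _ U] exI[of _ \<phi>])
     (simp_all add: sqnorm_def)

lemma gradients_closed:
  assumes u: "u \<in> L2 M" and v: "v \<in> L2 M"
    and approx: "\<And>e. 0 < e \<Longrightarrow> \<exists>u' v'. v' \<in> gradients I M u' \<and>
      sqnorm M (\<lambda>x. u' x - u x) < e \<and> sqnorm M (\<lambda>x. v' x - v x) < e"
  shows "v \<in> gradients I M u"
  unfolding gradients_iff
proof (intro conjI u v allI impI)
  fix e :: real assume "0 < e"
  then have e: "0 < e / 4" by simp
  obtain u' v' where 1: "v' \<in> gradients I M u'" "sqnorm M (\<lambda>x. u' x - u x) < e / 4"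
      "sqnorm M (\<lambda>x. v' x - v x) < e / 4"
    using approx[OF e] by blast
  obtain U \<phi> where 2: "C1_pair U \<phi>" "sqnorm M (\<lambda>x. U x - u' x) < e / 4"
      "sqnorm M (\<lambda>x. \<phi> x - v' x) < e / 4"
    using 1(1) e unfolding gradients_iff by meson
  have "sqnorm M (\<lambda>x. U x - u x) < e" "sqnorm M (\<lambda>x. \<phi> x - v x) < e"
    using sqnorm_triangle[OF C1_pair_L2(1)[OF 2(1)] gradients_L2(1)[OF 1(1)] u]
      sqnorm_triangle[OF C1_pair_L2(2)[OF 2(1)] gradients_L2(2)[OF 1(1)] v] 1 2 by linarith+
  with 2(1) show "\<exists>U \<phi>. C1_pair U \<phi> \<and> sqnorm M (\<lambda>x. U x - u x) < e \<and> sqnorm M (\<lambda>x. \<phi> x - v x) < e"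
    by blast
qed

lemma gradients_lincomb:
  assumes 1: "v \<in> gradients I M u" and 2: "v' \<in> gradients I M u'"
  shows "(\<lambda>x. s * v x + t * v' x) \<in> gradients I M (\<lambda>x. s * u x + t * u' x)"
  unfolding gradients_iff
proof (intro conjI allI impI L2_lincomb gradients_L2[OF 1] gradients_L2[OF 2])
  fix e :: real assume e: "0 < e"
  define k where "k = 2 * s\<^sup>2 + 2 * t\<^sup>2 + 1"
  have k: "0 < k" "2 * s\<^sup>2 + 2 * t\<^sup>2 < k" by (auto simp: k_def intro: add_nonneg_pos)
  have ek: "0 < e / k" using e k by simp
  obtain U \<phi> where U: "C1_pair U \<phi>" "sqnorm M (\<lambda>x. U x - u x) < e / k" "sqnorm M (\<lambda>x. \<phi> x - v x) < e / k"
    using 1 ek unfolding gradients_iff by meson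
  obtain V \<psi> where V: "C1_pair V \<psi>" "sqnorm M (\<lambda>x. V x - u' x) < e / k" "sqnorm M (\<lambda>x. \<psi> x - v' x) < e / k"
    using 2 ek unfolding gradients_iff by meson
  have est: "sqnorm M (\<lambda>x. (s * f x + t * g x) - (s * f' x + t * g' x)) < e"
    if "f \<in> L2 M" "f' \<in> L2 M" "g \<in> L2 M" "g' \<in> L2 M"
      and lt: "sqnorm M (\<lambda>x. f x - f' x) < e / k" "sqnorm M (\<lambda>x. g x - g' x) < e / k" for f f' g g'
  proof -
    have "sqnorm M (\<lambda>x. (s * f x + t * g x) - (s * f' x + t * g' x)) =
        sqnorm M (\<lambda>x. s * (f x - f' x) + t * (g x - g' x))"
      by (simp add: algebra_simps)
    also have "\<dots> \<le> 2 * sqnorm M (\<lambda>x. s * (f x - f' x)) + 2 * sqnorm M (\<lambda>x. t * (g x - g' x))"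
      using that by (intro sqnorm_add_le L2_scale L2_diff)
    also have "\<dots> = 2 * s\<^sup>2 * sqnorm M (\<lambda>x. f x - f' x) + 2 * t\<^sup>2 * sqnorm M (\<lambda>x. g x - g' x)"
      by (simp add: sqnorm_scale)
    also have "\<dots> \<le> 2 * s\<^sup>2 * (e / k) + 2 * t\<^sup>2 * (e / k)"
      using lt by (intro add_mono mult_left_mono) auto
    also have "\<dots> = (2 * s\<^sup>2 + 2 * t\<^sup>2) * (e / k)" by (simp only: distrib_right)
    also have "\<dots> < k * (e / k)" using k ek by (intro mult_strict_right_mono)
    also have "\<dots> = e" using k by simp
    finally show ?thesis .
  qed
  show "\<exists>U' \<phi>'. C1_pair U' \<phi>' \<and> sqnorm M (\<lambda>x. U' x - (s * u x + t * u' x)) < e \<and>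
      sqnorm M (\<lambda>x. \<phi>' x - (s * v x + t * v' x)) < e"
    using C1_pair_lincomb[OF U(1) V(1), of s t]
      est[OF C1_pair_L2(1)[OF U(1)] gradients_L2(1)[OF 1] C1_pair_L2(1)[OF V(1)] gradients_L2(1)[OF 2] U(2) V(2)]
      est[OF C1_pair_L2(2)[OF U(1)] gradients_L2(2)[OF 1] C1_pair_L2(2)[OF V(1)] gradients_L2(2)[OF 2] U(3) V(3)]
    by blast
qed

lemma gradients_add_null:
  assumes "v \<in> gradients I M u" "(\<lambda>x. 0) \<in> gradients I M f"
  shows "v \<in> gradients I M (\<lambda>x. u x + f x)"
  using gradients_lincomb[OF assms, of 1 1] by simp

text \<open>
  The gradients of maps within distance \<open>\<epsilon>\<close> of \<open>f\<close> form a convex set \<open>A \<epsilon>\<close> that shrinks with \<open>\<epsilon>\<close>. The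
  infima of the squared norms over these sets increase and are bounded by \<open>L\<close>, hence converge; by the
  parallelogram identity, elements of nearly minimal norm then form a Cauchy sequence. Its limit is a
  gradient of \<open>f\<close>. This argument gives a strongly convergent sequence where one would otherwise
  extract a weakly convergent one.
\<close>
lemma gradient_lower_semicontinuity:
  assumes f: "f \<in> L2 M"
    and approx: "\<And>e. 0 < e \<Longrightarrow> \<exists>f' v'. v' \<in> gradients I M f' \<and> sqnorm M (\<lambda>x. f' x - f x) < e \<and>
      sqnorm M v' \<le> L + e"
  shows "\<exists>w \<in> gradients I M f. sqnorm M w \<le> L"
proof -
  define A where "A e = {v. \<exists>f'. v \<in> gradients I M f' \<and> sqnorm M (\<lambda>x. f' x - f x) < e}" for e
  define d where "d e = Inf (sqnorm M ` A e)" for e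
  have bdd: "bdd_below (sqnorm M ` A e)" for e by (intro bdd_belowI[of _ 0]) auto
  have A_mono: "A e \<subseteq> A e'" if "e \<le> e'" for e e' using that by (force simp: A_def)
  have A_ne: "\<exists>v\<in>A e. sqnorm M v \<le> L + e'" if ee: "0 < e" "0 < e'" for e e'
  proof -
    have "0 < min e e'" using ee by simp
    from approx[OF this]
    obtain f' v' where "v' \<in> gradients I M f'" "sqnorm M (\<lambda>x. f' x - f x) < min e e'" "sqnorm M v' \<le> L + min e e'" by blast
    then show ?thesis by (intro bexI[of _ v']) (auto simp: A_def)
  qed
  have d_le: "d e \<le> sqnorm M v" if "v \<in> A e" for e v
    unfolding d_def using that by (intro cInf_lower bdd) auto
  have d_L: "d e \<le> L" if "0 < e" for e
  proof (rule field_le_epsilon)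
    fix e' :: real assume "0 < e'"
    then show "d e \<le> L + e'" using A_ne[OF that, of e'] d_le by fastforce
  qed
  have d_mono: "d e' \<le> d e" if "0 < e" "e \<le> e'" for e e'
    unfolding d_def using A_ne[OF that(1), of 1] A_mono[OF that(2)]
    by (intro cInf_superset_mono bdd image_mono) auto
  define \<epsilon> where "\<epsilon> n = 1 / real (Suc n)" for n
  have \<epsilon>: "0 < \<epsilon> n" for n by (simp add: \<epsilon>_def)
  have \<epsilon>_mono: "\<epsilon> m \<le> \<epsilon> n" if "n \<le> m" for m n using that by (simp add: \<epsilon>_def frac_le)
  have \<epsilon>_lim: "\<epsilon> \<longlonglongrightarrow> 0" unfolding \<epsilon>_def by (rule LIMSEQ_Suc) (rule lim_const_over_n)
  have "\<exists>v\<in>A (\<epsilon> n). sqnorm M v < d (\<epsilon> n) + \<epsilon> n" for n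
    using cInf_lessD[of "sqnorm M ` A (\<epsilon> n)" "d (\<epsilon> n) + \<epsilon> n"] A_ne[OF \<epsilon> \<epsilon>, of n n] \<epsilon>[of n]
    by (auto simp: d_def)
  then obtain w where w: "\<And>n. w n \<in> A (\<epsilon> n)" "\<And>n. sqnorm M (w n) < d (\<epsilon> n) + \<epsilon> n" by metis
  have wL: "w n \<in> L2 M" for n using w(1)[of n] gradients_L2(2) by (auto simp: A_def)
  have midpoint: "(\<lambda>x. (1/2) * v x + (1/2) * v' x) \<in> A e" if vv: "v \<in> A e" "v' \<in> A e" for v v' e
  proof -
    obtain g g' where g: "v \<in> gradients I M g" "sqnorm M (\<lambda>x. g x - f x) < e"
       "v' \<in> gradients I M g'" "sqnorm M (\<lambda>x. g' x - f x) < e"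
      using vv unfolding A_def by blast
    have "sqnorm M (\<lambda>x. (1/2) * g x + (1/2) * g' x - f x) =
        sqnorm M (\<lambda>x. (1/2) * ((g x - f x) + (g' x - f x)))"
      by (simp add: field_simps)
    also have "\<dots> = (1/4) * sqnorm M (\<lambda>x. (g x - f x) + (g' x - f x))"
      by (subst sqnorm_scale) (simp add: power2_eq_square)
    also have "\<dots> \<le> (1/4) * (2 * sqnorm M (\<lambda>x. g x - f x) + 2 * sqnorm M (\<lambda>x. g' x - f x))"
      using g f gradients_L2(1) by (intro mult_left_mono sqnorm_add_le L2_diff) auto
    also have "\<dots> < e" using g(2,4) by simp
    finally show ?thesis
      using gradients_lincomb[OF g(1,3), of "1/2" "1/2"] unfolding A_def by blast
  qed
  have dist_w: "sqnorm M (\<lambda>x. w m x - w n x) \<le> 2 * (d (\<epsilon> m) - d (\<epsilon> n)) + 4 * \<epsilon> n" if "n \<le> m" for m n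
  proof -
    have "w m \<in> A (\<epsilon> n)" using w(1)[of m] A_mono[OF \<epsilon>_mono[OF that]] by blast
    from d_le[OF midpoint[OF this w(1)[of n]]]
    have "d (\<epsilon> n) \<le> sqnorm M (\<lambda>x. (1/2) * (w m x + w n x))" by (simp add: distrib_left)
    then have "4 * d (\<epsilon> n) \<le> sqnorm M (\<lambda>x. w m x + w n x)"
      by (subst (asm) sqnorm_scale) (simp add: power2_eq_square)
    moreover have "P \<le> 2 * (dm - dn) + 4 * en"
      if "4 * dn \<le> Q" "P + Q = 2 * x + 2 * y" "x < dm + em" "y < dn + en" "em \<le> en"
      for P Q x y dm dn em en :: real
      using that by argo
    ultimately show ?thesis
      using parallelogram[OF wL[of m] wL[of n]] w(2)[of m] w(2)[of n] \<epsilon>_mono[OF that] by blast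
  qed
  have "\<exists>w\<^sub>0\<in>L2 M. (\<lambda>n. sqnorm M (\<lambda>x. w n x - w\<^sub>0 x)) \<longlonglongrightarrow> 0"
  proof (rule L2_complete[OF wL])
    fix e :: real assume e: "0 < e"
    have "incseq (\<lambda>n. d (\<epsilon> n))" using d_mono[OF \<epsilon> \<epsilon>_mono] by (simp add: incseq_def)
    then have "convergent (\<lambda>n. d (\<epsilon> n))"
      using incseq_convergent[of "\<lambda>n. d (\<epsilon> n)" L] d_L[OF \<epsilon>] by (metis convergentI)
    then have "Cauchy (\<lambda>n. d (\<epsilon> n))" by (simp add: Cauchy_convergent_iff)
    then obtain N1 where N1: "\<And>m n. m \<ge> N1 \<Longrightarrow> n \<ge> N1 \<Longrightarrow> \<bar>d (\<epsilon> m) - d (\<epsilon> n)\<bar> < e / 4"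
      using e CauchyD[of "\<lambda>n. d (\<epsilon> n)" "e / 4"] by auto
    have "\<forall>\<^sub>F n in sequentially. \<epsilon> n < e / 8" using \<epsilon>_lim e by (intro order_tendstoD) auto
    then obtain N2 where N2: "\<And>n. n \<ge> N2 \<Longrightarrow> \<epsilon> n < e / 8" by (auto simp: eventually_sequentially)
    have *: "sqnorm M (\<lambda>x. w m x - w n x) < e" if "max N1 N2 \<le> n" "n \<le> m" for m n
    proof -
      have "N1 \<le> n" "N1 \<le> m" "N2 \<le> n" using that by auto
      then have "d (\<epsilon> m) - d (\<epsilon> n) < e / 4" "\<epsilon> n < e / 8"
        using N1[of m n] N2[of n] by (blast intro: order_le_less_trans[OF abs_ge_self])+
      moreover have "P < e" if "P \<le> 2 * x + 4 * y" "x < e / 4" "y < e / 8" for P x y :: real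
        using that by argo
      ultimately show ?thesis using dist_w[OF that(2)] by blast
    qed
    have "sqnorm M (\<lambda>x. w m x - w n x) < e" if "max N1 N2 \<le> n" "max N1 N2 \<le> m" for m n
      using *[of n m] *[of m n] that sqnorm_minus_commute[of M "w m" "w n"] by (cases "n \<le> m") auto
    then show "\<exists>N. \<forall>m\<ge>N. \<forall>n\<ge>N. sqnorm M (\<lambda>x. w m x - w n x) < e" by blast
  qed
  then obtain w\<^sub>0 where w0: "w\<^sub>0 \<in> L2 M" "(\<lambda>n. sqnorm M (\<lambda>x. w n x - w\<^sub>0 x)) \<longlonglongrightarrow> 0" by blast
  have "w\<^sub>0 \<in> gradients I M f"
  proof (rule gradients_closed[OF f w0(1)])
    fix e :: real assume e: "0 < e"
    have "\<forall>\<^sub>F n in sequentially. sqnorm M (\<lambda>x. w n x - w\<^sub>0 x) < e \<and> \<epsilon> n < e"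
      using w0(2) \<epsilon>_lim e by (intro eventually_conj order_tendstoD) auto
    then obtain n where n: "sqnorm M (\<lambda>x. w n x - w\<^sub>0 x) < e" "\<epsilon> n < e"
      by (auto dest!: eventually_happens)
    obtain f' where "w n \<in> gradients I M f'" "sqnorm M (\<lambda>x. f' x - f x) < \<epsilon> n"
      using w(1)[of n] unfolding A_def by blast
    then show "\<exists>u' v'. v' \<in> gradients I M u' \<and> sqnorm M (\<lambda>x. u' x - f x) < e \<and>
        sqnorm M (\<lambda>x. v' x - w\<^sub>0 x) < e"
      using n by (blast intro: less_trans)
  qed
  moreover have "sqnorm M w\<^sub>0 \<le> L"
  proof (rule field_le_epsilon)
    fix e :: real assume e: "0 < e"
    have "\<forall>\<^sub>F n in sequentially. sqnorm M w\<^sub>0 \<le> sqnorm M (w n) + e / 2 \<and> \<epsilon> n < e / 2"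
      using w0 wL \<epsilon>_lim e by (intro eventually_conj sqnorm_lower_semicontinuous order_tendstoD) auto
    then obtain n where n: "sqnorm M w\<^sub>0 \<le> sqnorm M (w n) + e / 2" "\<epsilon> n < e / 2"
      by (auto dest!: eventually_happens)
    then show "sqnorm M w\<^sub>0 \<le> L + e" using w(2)[of n] d_L[OF \<epsilon>[of n]] by linarith
  qed
  ultimately show ?thesis by blast
qed

text \<open>
  Approximations that all equal \<open>u\<close> in \<open>gradient_lower_semicontinuity\<close> show that the minimal norm is
  attained, so that the choice in the definition of \<open>tangential_gradient\<close> is not vacuous.
\<close>
lemma tangential_gradient:
  assumes "u \<in> H1 I M"
  shows "tangential_gradient I M u \<in> gradients I M u"
    and "w \<in> gradients I M u \<Longrightarrow> sqnorm M (tangential_gradient I M u) \<le> sqnorm M w"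
proof -
  define L where "L = Inf (sqnorm M ` gradients I M u)"
  have ne: "gradients I M u \<noteq> {}" and u: "u \<in> L2 M" using assms by (auto simp: H1_def)
  have bdd: "bdd_below (sqnorm M ` gradients I M u)" by (intro bdd_belowI[of _ 0]) auto
  have "\<exists>v \<in> gradients I M u. sqnorm M v \<le> L"
  proof (rule gradient_lower_semicontinuity[OF u])
    fix e :: real assume e: "0 < e"
    then obtain v where "v \<in> gradients I M u" "sqnorm M v < L + e"
      using cInf_lessD[of "sqnorm M ` gradients I M u" "L + e"] ne by (auto simp: L_def)
    moreover have "sqnorm M (\<lambda>x. u x - u x) < e" using e by (simp add: sqnorm_def)
    ultimately show "\<exists>f' v'. v' \<in> gradients I M f' \<and> sqnorm M (\<lambda>x. f' x - u x) < e \<and> sqnorm M v' \<le> L + e"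
      by (meson less_imp_le)
  qed
  moreover have "L \<le> sqnorm M w" if "w \<in> gradients I M u" for w
    unfolding L_def using that by (intro cInf_lower bdd) auto
  ultimately have "\<exists>v. v \<in> gradients I M u \<and> (\<forall>w \<in> gradients I M u. L2_norm M v \<le> L2_norm M w)"
    unfolding L2_norm_sqnorm by (meson order_trans real_sqrt_le_mono)
  from someI_ex[OF this]
  have *: "tangential_gradient I M u \<in> gradients I M u \<and>
      (\<forall>w \<in> gradients I M u. sqnorm M (tangential_gradient I M u) \<le> sqnorm M w)"
    unfolding tangential_gradient_def L2_norm_sqnorm by simp
  then show "tangential_gradient I M u \<in> gradients I M u"
    and "w \<in> gradients I M u \<Longrightarrow> sqnorm M (tangential_gradient I M u) \<le> sqnorm M w"
    by auto
qed

end

section \<open>Linked points and functions of vanishing gradient\<close>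

context interval_measure
begin

lemma sqnorm_dominated_convergence:
  assumes f: "\<And>n. f n \<in> borel_measurable M" and g: "g \<in> borel_measurable M" and h: "h \<in> L2 M"
    and lim: "\<And>x. x \<in> I \<Longrightarrow> (\<lambda>n. f n x) \<longlonglongrightarrow> g x"
    and dom: "\<And>n x. x \<in> I \<Longrightarrow> \<bar>f n x - g x\<bar> \<le> \<bar>h x\<bar>"
  shows "(\<lambda>n. sqnorm M (\<lambda>x. f n x - g x)) \<longlonglongrightarrow> 0"
proof -
  note [measurable] = f g
  have "(\<lambda>n. \<integral>x. (f n x - g x)\<^sup>2 \<partial>M) \<longlonglongrightarrow> (\<integral>x. 0 \<partial>M)"
  proof (rule integral_dominated_convergence)
    show "integrable M (\<lambda>x. (h x)\<^sup>2)" using h by (rule L2_square_integrable)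
    show "AE x in M. (\<lambda>n. (f n x - g x)\<^sup>2) \<longlonglongrightarrow> 0"
    proof (intro AE_I2)
      fix x assume "x \<in> space M"
      then have "(\<lambda>n. f n x - g x) \<longlonglongrightarrow> 0" using lim by (simp add: LIM_zero)
      from tendsto_power[OF this, of 2] show "(\<lambda>n. (f n x - g x)\<^sup>2) \<longlonglongrightarrow> 0" by simp
    qed
    show "AE x in M. norm ((f n x - g x)\<^sup>2) \<le> (h x)\<^sup>2" for n
      using dom by (intro AE_I2) (simp add: abs_le_square_iff[symmetric])
  qed measurable
  then show ?thesis by (simp add: sqnorm_def)
qed

lemma gradients_limit:
  assumes v: "\<And>n. v \<in> gradients I M (f n)" and f: "f' \<in> L2 M"
    and lim: "(\<lambda>n. sqnorm M (\<lambda>x. f n x - f' x)) \<longlonglongrightarrow> 0"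
  shows "v \<in> gradients I M f'"
proof (rule gradients_closed[OF f gradients_L2(2)[OF v]])
  fix e :: real assume e: "0 < e"
  have "\<forall>\<^sub>F n in sequentially. sqnorm M (\<lambda>x. f n x - f' x) < e"
    using lim e by (intro order_tendstoD) auto
  then obtain n where "sqnorm M (\<lambda>x. f n x - f' x) < e" by (auto dest!: eventually_happens)
  moreover have "sqnorm M (\<lambda>x. v x - v x) < e" using e by (simp add: sqnorm_def)
  ultimately show "\<exists>u' v'. v' \<in> gradients I M u' \<and> sqnorm M (\<lambda>x. u' x - f' x) < e \<and>
      sqnorm M (\<lambda>x. v' x - v x) < e"
    using v[of n] by blast
qed

lemma vanishing_gradient_limit:
  assumes U: "\<And>n. C1_pair (U n) (\<phi> n)" "\<And>n x. \<bar>U n x\<bar> \<le> 1"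
    and \<phi>: "(\<lambda>n. sqnorm M (\<phi> n)) \<longlonglongrightarrow> 0"
    and g: "g \<in> borel_measurable borel" and lim: "\<And>x. (\<lambda>n. U n x) \<longlonglongrightarrow> g x"
  shows "(\<lambda>x. 0) \<in> gradients I M g"
proof (rule gradients_closed)
  have g1: "\<bar>g x\<bar> \<le> 1" for x
    using LIMSEQ_le_const2[OF tendsto_rabs[OF lim[of x]]] U(2) by blast
  show "g \<in> L2 M" using g1 by (intro bounded_L2(1)[of g 1] borel_measurable_M g) auto
  have "(\<lambda>n. sqnorm M (\<lambda>x. U n x - g x)) \<longlonglongrightarrow> 0"
  proof (rule sqnorm_dominated_convergence[where h = "\<lambda>x. 2"])
    show "\<bar>U n x - g x\<bar> \<le> \<bar>2\<bar>" for n x using U(2)[of n x] g1[of x] by linarith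
    show "U n \<in> borel_measurable M" for n by (intro borel_measurable_M C1_pair_borel(1)[OF U(1)])
  qed (use g lim in \<open>auto intro!: borel_measurable_M L2_I\<close>)
  moreover fix e :: real assume e: "0 < e"
  ultimately have "\<forall>\<^sub>F n in sequentially. sqnorm M (\<lambda>x. U n x - g x) < e \<and> sqnorm M (\<phi> n) < e"
    using \<phi> by (intro eventually_conj order_tendstoD) auto
  then obtain n where "sqnorm M (\<lambda>x. U n x - g x) < e" "sqnorm M (\<phi> n) < e"
    by (auto dest!: eventually_happens)
  then show "\<exists>u' v'. v' \<in> gradients I M u' \<and> sqnorm M (\<lambda>x. u' x - g x) < e \<and>
      sqnorm M (\<lambda>x. v' x - 0) < e"
    using C1_pair_gradients[OF U(1)[of n]] by auto
qed simp

definition energy_on :: "(real \<Rightarrow> real) \<Rightarrow> real \<Rightarrow> real \<Rightarrow> real" where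
  "energy_on \<phi> s t = (\<integral>x. indicator {s..t} x * (\<phi> x)\<^sup>2 \<partial>M)"

lemma energy_on_nonneg: "0 \<le> energy_on \<phi> s t"
  unfolding energy_on_def by (intro Bochner_Integration.integral_nonneg) simp

lemma energy_on_integrable:
  fixes \<phi> :: "real \<Rightarrow> real"
  assumes "continuous_on UNIV \<phi>"
  shows "integrable M (\<lambda>x. indicator {s..t} x * (\<phi> x)\<^sup>2)"
proof (rule Bochner_Integration.integrable_bound)
  show "integrable M (\<lambda>x. (\<phi> x)\<^sup>2)" using continuous_L2[OF assms] by (rule L2_square_integrable)
  have [measurable]: "\<phi> \<in> borel_measurable borel" using assms by (rule borel_measurable_continuous_onI)
  have "(\<lambda>x. indicator {s..t} x * (\<phi> x)\<^sup>2) \<in> borel_measurable borel" by measurable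
  then show "(\<lambda>x. indicator {s..t} x * (\<phi> x)\<^sup>2) \<in> borel_measurable M" by (rule borel_measurable_M)
qed (auto simp: indicator_def)

lemma energy_on_mono:
  assumes "continuous_on UNIV \<phi>" "s \<le> s'" "t' \<le> t"
  shows "energy_on \<phi> s' t' \<le> energy_on \<phi> s t"
  unfolding energy_on_def using assms
  by (intro integral_mono energy_on_integrable) (auto simp: indicator_def)

lemma energy_on_le_sqnorm:
  assumes "continuous_on UNIV \<phi>"
  shows "energy_on \<phi> s t \<le> sqnorm M \<phi>"
  unfolding energy_on_def sqnorm_def using continuous_L2[OF assms] assms
  by (intro integral_mono energy_on_integrable L2_square_integrable) (auto simp: indicator_def)

text \<open>
  The estimate is required on all subintervals, not only between \<open>x\<close> and \<open>y\<close>: convexity of the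
  classes is then immediate, and if it fails, a violating pair \<open>s, t\<close> is the place where a step
  of small energy can be put. The smallest such constant for one interval is a resistance: for
  \<open>\<mu> = w dx\<close> it is the integral of \<open>1 / w\<close>.
\<close>
definition link_const :: "real \<Rightarrow> real \<Rightarrow> real \<Rightarrow> bool" where
  "link_const C x y \<longleftrightarrow> 0 \<le> C \<and> (\<forall>U \<phi>. C1_pair U \<phi> \<longrightarrow> (\<forall>z. 0 \<le> \<phi> z) \<longrightarrow>
     (\<forall>s \<in> closed_segment x y. \<forall>t \<in> closed_segment x y. s \<le> t \<longrightarrow>
        (U t - U s)\<^sup>2 \<le> C * energy_on \<phi> s t))"

definition linked :: "real \<Rightarrow> real \<Rightarrow> bool" where
  "linked x y \<longleftrightarrow> (\<exists>C. link_const C x y)"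

lemma linked_refl: "linked x x"
  unfolding linked_def link_const_def by (intro exI[of _ 0]) auto

lemma linked_sym: "linked x y \<Longrightarrow> linked y x"
  unfolding linked_def link_const_def by (simp add: closed_segment_commute)

lemma linked_convex: "linked x z \<Longrightarrow> y \<in> closed_segment x z \<Longrightarrow> linked x y"
proof -
  assume "linked x z" and y: "y \<in> closed_segment x z"
  then obtain C where C: "link_const C x z" by (auto simp: linked_def)
  have "closed_segment x y \<subseteq> closed_segment x z" using y by (simp add: subset_closed_segment)
  then have "link_const C x y" using C unfolding link_const_def by blast
  then show "linked x y" by (auto simp: linked_def)
qed

lemma linked_trans:
  assumes "linked x y" "linked y z"
  shows "linked x z"
proof -
  obtain C1 C2 where C1: "link_const C1 x y" and C2: "link_const C2 y z"
    using assms by (auto simp: linked_def)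
  have nn: "0 \<le> C1" "0 \<le> C2" using C1 C2 by (auto simp: link_const_def)
  define C where "C = 2 * C1 + 2 * C2"
  have "link_const C x z"
    unfolding link_const_def
  proof (intro conjI allI impI ballI)
    show "0 \<le> C" using nn by (simp add: C_def)
    fix U \<phi> s t
    assume U: "C1_pair U \<phi>" "\<forall>z. 0 \<le> \<phi> z"
      and st: "s \<in> closed_segment x z" "t \<in> closed_segment x z" "s \<le> t"
    have cont: "continuous_on UNIV \<phi>" using U by (simp add: C1_pair_def)
    have le1: "(U q - U p)\<^sup>2 \<le> C1 * energy_on \<phi> p q" 
      if "p \<in> closed_segment x y" "q \<in> closed_segment x y" "p \<le> q" for p q
      using C1 U that unfolding link_const_def by blast
    have le2: "(U q - U p)\<^sup>2 \<le> C2 * energy_on \<phi> p q" 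
      if "p \<in> closed_segment y z" "q \<in> closed_segment y z" "p \<le> q" for p q
      using C2 U that unfolding link_const_def by blast
    have weaken: "Ci * energy_on \<phi> p q \<le> C * energy_on \<phi> s t / 2" 
      if "Ci = C1 \<or> Ci = C2" "s \<le> p" "q \<le> t" for Ci p q
    proof -
      have "Ci * energy_on \<phi> p q \<le> (C / 2) * energy_on \<phi> s t"
        using that nn by (intro mult_mono energy_on_mono[OF cont]) (auto simp: C_def energy_on_nonneg)
      then show ?thesis by simp
    qed
    have half: "C * energy_on \<phi> s t / 2 \<le> C * energy_on \<phi> s t"
      using mult_nonneg_nonneg[OF \<open>0 \<le> C\<close> energy_on_nonneg[of \<phi> s t]] by simp
    consider "s \<in> closed_segment x y \<and> t \<in> closed_segment x y"
      | "s \<in> closed_segment y z \<and> t \<in> closed_segment y z"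
      | "s \<in> closed_segment x y \<and> t \<in> closed_segment y z \<and> s \<le> y \<and> y \<le> t"
      | "s \<in> closed_segment y z \<and> t \<in> closed_segment x y \<and> s \<le> y \<and> y \<le> t"
    proof -
      have either: "p \<in> closed_segment x y \<or> p \<in> closed_segment y z" if "p \<in> closed_segment x z" for p
        using that unfolding closed_segment_eq_real_ivl by (auto split: if_splits)
      have between: "r \<in> closed_segment u v"
        if "p \<in> closed_segment u v" "q \<in> closed_segment u v" "p \<le> r" "r \<le> q" for p q r u v :: real
        using that unfolding closed_segment_eq_real_ivl by (auto split: if_splits)
      have "t \<in> closed_segment y z \<Longrightarrow> y \<le> s \<Longrightarrow> s \<in> closed_segment y z"
        "t \<in> closed_segment x y \<Longrightarrow> y \<le> s \<Longrightarrow> s \<in> closed_segment x y"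
        "s \<in> closed_segment x y \<Longrightarrow> t \<le> y \<Longrightarrow> t \<in> closed_segment x y"
        "s \<in> closed_segment y z \<Longrightarrow> t \<le> y \<Longrightarrow> t \<in> closed_segment y z"
        using between[of y y z t s] between[of y x y t s] between[of s x y y t] between[of s y z y t] st(3)
        by auto
      then show ?thesis
        using that either[OF st(1)] either[OF st(2)] linear[of y s] linear[of t y] by blast
    qed
    then show "(U t - U s)\<^sup>2 \<le> C * energy_on \<phi> s t"
    proof cases
      case 1
      then show ?thesis using le1[of s t] weaken[of C1 s t] half st(3) by auto
    next
      case 2
      then show ?thesis using le2[of s t] weaken[of C2 s t] half st(3) by auto
    next
      case 3
      then have "(U y - U s)\<^sup>2 \<le> C1 * energy_on \<phi> s y" "(U t - U y)\<^sup>2 \<le> C2 * energy_on \<phi> y t"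
        by (auto intro!: le1 le2)
      moreover have "(U t - U s)\<^sup>2 \<le> 2 * (U y - U s)\<^sup>2 + 2 * (U t - U y)\<^sup>2"
        using sum_squares_bound[of "U y - U s" "U t - U y"] by (simp add: power2_eq_square algebra_simps)
      moreover have "2 * (C1 * energy_on \<phi> s y) + 2 * (C2 * energy_on \<phi> y t) \<le> C * energy_on \<phi> s t"
        using 3 nn energy_on_mono[OF cont, of s s y t] energy_on_mono[OF cont, of s y t t]
        by (simp add: C_def distrib_right add_mono mult_left_mono)
      ultimately show ?thesis by linarith
    next
      case 4
      then have "(U y - U s)\<^sup>2 \<le> C2 * energy_on \<phi> s y" "(U t - U y)\<^sup>2 \<le> C1 * energy_on \<phi> y t"
        by (auto intro!: le1 le2)
      moreover have "(U t - U s)\<^sup>2 \<le> 2 * (U y - U s)\<^sup>2 + 2 * (U t - U y)\<^sup>2"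
        using sum_squares_bound[of "U y - U s" "U t - U y"] by (simp add: power2_eq_square algebra_simps)
      moreover have "2 * (C2 * energy_on \<phi> s y) + 2 * (C1 * energy_on \<phi> y t) \<le> C * energy_on \<phi> s t"
      proof -
        have "C2 * energy_on \<phi> s y \<le> C2 * energy_on \<phi> s t" "C1 * energy_on \<phi> y t \<le> C1 * energy_on \<phi> s t"
          using 4 nn by (auto intro!: mult_left_mono energy_on_mono[OF cont])
        then show ?thesis by (simp add: C_def distrib_right)
      qed
      ultimately show ?thesis by linarith
    qed
  qed
  then show ?thesis by (auto simp: linked_def)
qed

text \<open>
  Test the estimate with the identity, whose increment over a nondegenerate segment is positive.
\<close>
lemma linked_imp_mass:
  assumes "linked x y" "x \<noteq> y"
  shows "0 < measure M (closed_segment x y \<inter> I)"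
proof -
  obtain C where C: "link_const C x y" using assms by (auto simp: linked_def)
  define s t where "s = min x y" and "t = max x y"
  have st: "s < t" "closed_segment x y = {s..t}"
    using assms(2) by (auto simp: s_def t_def closed_segment_eq_real_ivl)
  have "C1_pair (\<lambda>x. x) (\<lambda>x. 1)" by (simp add: C1_pair_def)
  then have "(t - s)\<^sup>2 \<le> C * energy_on (\<lambda>x. 1) s t"
    using C st unfolding link_const_def
    by (elim conjE allE[of _ "\<lambda>x::real. x"] allE[of _ "\<lambda>x::real. 1"]) auto
  then have "energy_on (\<lambda>x. 1) s t \<noteq> 0" using st(1) by auto
  moreover have "energy_on (\<lambda>x. 1) s t = measure M ({s..t} \<inter> I)"
    by (simp add: energy_on_def)
  ultimately show ?thesis using st(2) by (simp add: zero_less_measure_iff)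
qed

text \<open>
  Some increasing \<open>C\<^sup>1\<close> function violates the estimate with the constant \<open>4 / e\<close> on a subinterval
  \<open>[s, t]\<close>. Cutting its derivative off near \<open>s\<close> and \<open>t\<close> loses at most half of the increment \<open>A\<close>, and
  rescaling to increment 1 gives a step with the energy claimed.
\<close>
lemma cheap_step_between_unlinked_points:
  assumes xy: "x < y" and not_linked: "\<not> linked x y" and e: "0 < e"
  shows "\<exists>U \<phi>. C1_pair U \<phi> \<and> (\<forall>t\<le>x. U t = 0) \<and> (\<forall>t\<ge>y. U t = 1) \<and> (\<forall>t. \<bar>U t\<bar> \<le> 1) \<and>
    sqnorm M \<phi> \<le> e"
proof -
  have "\<not> link_const (4 / e) x y" using not_linked by (auto simp: linked_def)
  then obtain U \<phi> s t where U: "C1_pair U \<phi>" and \<phi>: "\<And>z. 0 \<le> \<phi> z"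
      and st: "x \<le> s" "s \<le> t" "t \<le> y" and big: "4 / e * energy_on \<phi> s t < (U t - U s)\<^sup>2"
    using e xy unfolding link_const_def closed_segment_eq_real_ivl by (auto simp: not_le)
  define A where "A = U t - U s"
  have "0 \<le> A" using C1_pair_mono[OF U \<phi> st(2)] by (simp add: A_def)
  moreover have "A \<noteq> 0"
  proof -
    have "0 \<le> 4 / e * energy_on \<phi> s t" using e energy_on_nonneg by simp
    then show ?thesis using big by (auto simp: A_def)
  qed
  ultimately have A: "0 < A" by simp
  have "s < t" using A st(2) by (cases "s = t") (auto simp: A_def)
  have contU: "isCont U z" for z using C1_pairD[OF U] by (rule DERIV_isCont)
  obtain d1 where d1: "0 < d1" "\<And>z. \<bar>z - s\<bar> < d1 \<Longrightarrow> \<bar>U z - U s\<bar> < A / 4"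
    using contU[of s] A unfolding continuous_at_eps_delta by (metis dist_real_def divide_pos_pos zero_less_numeral)
  obtain d2 where d2: "0 < d2" "\<And>z. \<bar>z - t\<bar> < d2 \<Longrightarrow> \<bar>U z - U t\<bar> < A / 4"
    using contU[of t] A unfolding continuous_at_eps_delta by (metis dist_real_def divide_pos_pos zero_less_numeral)
  define d where "d = min (min d1 d2 / 2) ((t - s) / 3)"
  have d: "0 < d" "d < d1" "d < d2" "s + d \<le> t - d"
    using d1(1) d2(1) \<open>s < t\<close> by (auto simp: d_def min_def field_simps)
  have rise: "A / 2 < U (t - d) - U (s + d)"
  proof -
    have "\<bar>U (s + d) - U s\<bar> < A / 4" "\<bar>U (t - d) - U t\<bar> < A / 4"
      using d d1(2)[of "s + d"] d2(2)[of "t - d"] by auto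
    then show ?thesis unfolding abs_less_iff A_def by argo
  qed
  \<comment> \<open>A trapezoidal cut-off: 0 outside of \<open>[s, t]\<close>, and 1 on \<open>[s + d, t - d]\<close>.\<close>
  define \<kappa> where "\<kappa> z = min 1 (max 0 (min ((z - s) / d) ((t - z) / d)))" for z
  have \<kappa>: "0 \<le> \<kappa> z" "\<kappa> z \<le> 1" for z by (auto simp: \<kappa>_def)
  have \<kappa>0: "\<kappa> z = 0" if "z \<le> s \<or> t \<le> z" for z
  proof -
    have "(z - s) / d \<le> 0 \<or> (t - z) / d \<le> 0" using that d(1) by (auto simp: divide_le_0_iff)
    then have "min ((z - s) / d) ((t - z) / d) \<le> 0" by (simp add: min_le_iff_disj)
    then show ?thesis by (simp add: \<kappa>_def max_absorb1)
  qed
  have \<kappa>1: "\<kappa> z = 1" if "s + d \<le> z" "z \<le> t - d" for z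
    using that d(1) by (auto simp: \<kappa>_def max_def min_def field_simps)
  define \<psi> where "\<psi> z = \<phi> z * \<kappa> z" for z
  have \<psi>_nonneg: "0 \<le> \<psi> z" for z using \<phi> \<kappa> by (simp add: \<psi>_def)
  have "continuous_on UNIV \<psi>"
    unfolding \<psi>_def \<kappa>_def using C1_pair_continuous(2)[OF U] d(1) by (auto intro!: continuous_intros)
  then obtain V where V: "C1_pair V \<psi>" "V s = 0" using C1_pair_exists by blast
  have V_const: "V q = V p" if "p \<le> q" "\<And>z. p < z \<Longrightarrow> z < q \<Longrightarrow> \<psi> z = 0" for p q
  proof (cases "p = q")
    case False
    then show ?thesis
      using that C1_pairD[OF V(1)]
      by (intro DERIV_isconst_end C1_pair_continuous(1)[OF V(1)]) (auto, metis)
  qed simp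
  have V_left: "V z = 0" if "z \<le> s" for z
    using V_const[of z s] that V(2) by (simp add: \<psi>_def \<kappa>0)
  have V_right: "V z = V t" if "t \<le> z" for z
    using V_const[of t z] that by (simp add: \<psi>_def \<kappa>0)
  have V_mono: "V p \<le> V q" if "p \<le> q" for p q
    using C1_pair_mono[OF V(1) \<psi>_nonneg that] .
  define B where "B = V t"
  have "V (s + d) - U (s + d) \<le> V (t - d) - U (t - d)"
  proof (rule DERIV_nonneg_imp_nondecreasing[OF d(4)])
    fix z assume "s + d \<le> z" "z \<le> t - d"
    then show "\<exists>y. ((\<lambda>z. V z - U z) has_real_derivative y) (at z) \<and> 0 \<le> y"
      using DERIV_diff[OF C1_pairD[OF V(1), of z] C1_pairD[OF U, of z]]
      by (intro exI[of _ 0]) (simp add: \<psi>_def \<kappa>1)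
  qed
  moreover have "0 \<le> V (s + d)" using V_mono[of s "s + d"] V(2) d(1) by simp
  moreover have "V (t - d) \<le> B" using V_mono[of "t - d" t] d(1) by (simp add: B_def)
  ultimately have B: "A / 2 < B" using rise by linarith
  then have B0: "0 < B" using A by linarith
  have V_range: "0 \<le> V z \<and> V z \<le> B" for z
    using V_mono[of z t] V_mono[of s z] V_left[of z] V_right[of z] V(2) B0
    by (cases "z \<le> s"; cases "t \<le> z") (auto simp: B_def)
  have small: "energy_on \<phi> s t \<le> e * B\<^sup>2"
  proof -
    have "(A / 2)\<^sup>2 \<le> B\<^sup>2" using A B by (intro power_mono) auto
    moreover have "energy_on \<phi> s t \<le> e * (A / 2)\<^sup>2"
      using big e by (simp add: A_def field_simps power2_eq_square)
    ultimately show ?thesis using e by (meson mult_left_mono less_imp_le order_trans)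
  qed
  have "sqnorm M \<psi> \<le> energy_on \<phi> s t"
    unfolding sqnorm_def energy_on_def
  proof (intro integral_mono L2_square_integrable C1_pair_L2(2)[OF V(1)] energy_on_integrable
      C1_pair_continuous(2)[OF U])
    fix z
    have "(\<kappa> z)\<^sup>2 \<le> indicator {s..t} z"
      using \<kappa>[of z] \<kappa>0[of z] by (auto simp: indicator_def power_le_one)
    from mult_right_mono[OF this, of "(\<phi> z)\<^sup>2"] show "(\<psi> z)\<^sup>2 \<le> indicator {s..t} z * (\<phi> z)\<^sup>2"
      by (simp add: \<psi>_def power_mult_distrib mult.commute)
  qed
  then have "sqnorm M (\<lambda>z. 1 / B * \<psi> z) \<le> (1 / B)\<^sup>2 * (e * B\<^sup>2)"
    unfolding sqnorm_scale using small by (intro mult_left_mono) auto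
  also have "\<dots> = e" using B0 by (simp add: power_divide)
  finally have "sqnorm M (\<lambda>z. 1 / B * \<psi> z) \<le> e" .
  moreover have "C1_pair (\<lambda>z. 1 / B * V z) (\<lambda>z. 1 / B * \<psi> z)"
    using C1_pair_lincomb[OF V(1) V(1), of "1 / B" 0] by simp
  moreover have "\<forall>z\<le>x. 1 / B * V z = 0"
  proof (intro allI impI)
    fix z assume "z \<le> x"
    then have "z \<le> s" using st(1) by simp
    from V_left[OF this] show "1 / B * V z = 0" by simp
  qed
  moreover have "\<forall>z\<ge>y. 1 / B * V z = 1"
  proof (intro allI impI)
    fix z assume "y \<le> z"
    then have "t \<le> z" using st(3) by simp
    from V_right[OF this] have "V z = B" by (simp only: B_def)
    then show "1 / B * V z = 1" using B0 by simp
  qed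
  moreover have "\<forall>z. \<bar>1 / B * V z\<bar> \<le> 1" using V_range B0 by simp
  ultimately show ?thesis by blast
qed

definition saturated_upset :: "real set \<Rightarrow> bool" where
  "saturated_upset E \<longleftrightarrow> (\<forall>x\<in>E. \<forall>y\<ge>x. y \<in> E) \<and> (\<forall>x\<in>E. \<forall>y. linked x y \<longrightarrow> y \<in> E)"

lemma saturated_upset_borel:
  assumes "saturated_upset E" shows "E \<in> sets borel"
proof -
  have "mono (indicator E :: real \<Rightarrow> real)"
  proof (rule monoI)
    fix x y :: real assume "x \<le> y"
    then have "x \<in> E \<Longrightarrow> y \<in> E" using assms unfolding saturated_upset_def by blast
    then show "indicator E x \<le> (indicator E y :: real)" by (simp add: indicator_def)
  qed
  then have "(indicator E :: real \<Rightarrow> real) \<in> borel_measurable borel" by (rule borel_measurable_mono)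
  then show ?thesis by (simp add: borel_measurable_indicator_iff)
qed

text \<open>
  Let \<open>m\<close> be the infimum of the up-set. If \<open>m\<close> belongs to it, no point to the left of \<open>m\<close> is linked
  to \<open>m\<close>, and steps of vanishing energy that reach the value 1 exactly at \<open>m\<close> converge to the
  indicator. If not, no point to the right of \<open>m\<close> is linked to \<open>m\<close>, and the steps start at \<open>m\<close>.
\<close>
lemma indicator_saturated_upset:
  assumes E: "saturated_upset E"
  shows "(\<lambda>x. 0) \<in> gradients I M (indicator E)"
proof -
  note up = E[unfolded saturated_upset_def, THEN conjunct1, rule_format]
  note sat = E[unfolded saturated_upset_def, THEN conjunct2, rule_format]
  have meas: "(indicator E :: real \<Rightarrow> real) \<in> borel_measurable borel"
    using saturated_upset_borel[OF E] by simp
  have key: "(\<lambda>x. 0) \<in> gradients I M (indicator E)"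
    if xy: "\<And>n::nat. x n < y n" "\<And>n. \<not> linked (x n) (y n)"
      and in_E: "\<And>z. z \<in> E \<Longrightarrow> \<forall>\<^sub>F n in sequentially. y n \<le> z"
      and out_E: "\<And>z. z \<notin> E \<Longrightarrow> \<forall>\<^sub>F n in sequentially. z \<le> x n" for x y
  proof -
    have "\<exists>U \<phi>. C1_pair U \<phi> \<and> (\<forall>t\<le>x n. U t = 0) \<and> (\<forall>t\<ge>y n. U t = 1) \<and> (\<forall>t. \<bar>U t\<bar> \<le> 1) \<and>
        sqnorm M \<phi> \<le> 1 / real (Suc n)" for n
      using cheap_step_between_unlinked_points[OF xy(1)[of n] xy(2)[of n], of "1 / real (Suc n)"] by simp
    then obtain U \<phi> where U: "\<And>n. C1_pair (U n) (\<phi> n)" "\<And>n t. t \<le> x n \<Longrightarrow> U n t = 0"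
        "\<And>n t. y n \<le> t \<Longrightarrow> U n t = 1" "\<And>n t. \<bar>U n t\<bar> \<le> 1" "\<And>n. sqnorm M (\<phi> n) \<le> 1 / real (Suc n)"
      by metis
    show ?thesis
    proof (rule vanishing_gradient_limit[OF U(1) U(4) _ meas])
      show "(\<lambda>n. sqnorm M (\<phi> n)) \<longlonglongrightarrow> 0"
        using U(5) by (intro tendsto_sandwich[OF _ _ tendsto_const LIMSEQ_Suc[OF lim_const_over_n[of 1]]])
          (auto intro!: always_eventually)
      fix z
      have "\<forall>\<^sub>F n in sequentially. U n z = indicator E z"
        using in_E[of z] out_E[of z]
        by (cases "z \<in> E") (auto elim!: eventually_mono simp: U(2,3))
      then show "(\<lambda>n. U n z) \<longlonglongrightarrow> indicator E z" by (rule tendsto_eventually)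
    qed
  qed
  show ?thesis
  proof (cases "E = {} \<or> E = UNIV")
    case True
    moreover have "indicator {} = (\<lambda>x :: real. 0 :: real)" "indicator UNIV = (\<lambda>x :: real. 1 :: real)"
      by (auto simp: fun_eq_iff)
    ultimately show ?thesis
      using C1_pair_gradients[OF C1_pair_const[of 0]] C1_pair_gradients[OF C1_pair_const[of 1]]
      by (elim disjE) simp_all
  next
    case False
    then obtain z w where zw: "z \<in> E" "w \<notin> E" by blast
    have bdd: "bdd_below E" using zw up by (intro bdd_belowI[of _ w]) (metis linorder_linear)
    define m where "m = Inf E"
    have m_le: "m \<le> x" if "x \<in> E" for x unfolding m_def using that bdd by (rule cInf_lower)
    have m_less: "x \<in> E" if mx: "m < x" for x
    proof -
      obtain u where "u \<in> E" "u < x" using cInf_lessD[of E x] zw(1) mx by (auto simp: m_def)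
      then show ?thesis using up[of u x] by simp
    qed
    have lim: "(\<lambda>n. 1 / real (Suc n)) \<longlonglongrightarrow> 0" by (rule LIMSEQ_Suc) (rule lim_const_over_n)
    have ev: "\<forall>\<^sub>F n in sequentially. 1 / real (Suc n) \<le> r" if "0 < r" for r
      using order_tendstoD(2)[OF lim that] by (auto elim!: eventually_mono)
    show ?thesis
    proof (cases "m \<in> E")
      case True
      show ?thesis
      proof (rule key[of "\<lambda>n. m - 1 / real (Suc n)" "\<lambda>n. m"])
        fix n
        have "m - 1 / real (Suc n) \<notin> E" using m_le by (metis diff_gt_0_iff_gt diff_diff_eq2 
              add_diff_cancel_left' linorder_not_le of_nat_0_less_iff zero_less_Suc zero_less_divide_1_iff)
        then show "\<not> linked (m - 1 / real (Suc n)) m" using sat[OF True] linked_sym by blast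
      next
        fix z assume "z \<notin> E"
        then have "z < m" using up[OF True, of z] by (cases "m \<le> z") auto
        then show "\<forall>\<^sub>F n in sequentially. z \<le> m - 1 / real (Suc n)"
          using ev[of "m - z"] by (auto elim!: eventually_mono)
      qed (use m_le in auto)
    next
      case False
      show ?thesis
      proof (rule key[of "\<lambda>n. m" "\<lambda>n. m + 1 / real (Suc n)"])
        fix n
        have "m + 1 / real (Suc n) \<in> E" by (rule m_less) simp
        then show "\<not> linked m (m + 1 / real (Suc n))" using sat[of "m + 1 / real (Suc n)" m] False linked_sym by blast
      next
        fix z assume z: "z \<in> E"
        then have "m < z" using m_le[OF z] False by (cases "m = z") auto
        then show "\<forall>\<^sub>F n in sequentially. m + 1 / real (Suc n) \<le> z"
          using ev[of "z - m"] by (auto elim!: eventually_mono)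
      next
        fix z assume "z \<notin> E"
        then have "z \<le> m" using m_less[of z] by (cases "m < z") auto
        then show "\<forall>\<^sub>F n in sequentially. z \<le> m" by simp
      qed auto
    qed
  qed
qed

definition saturated_sets :: "real set set" where
  "saturated_sets = sigma_sets UNIV {E. saturated_upset E}"

lemma saturated_sets_borel: "A \<in> saturated_sets \<Longrightarrow> A \<in> sets borel"
  unfolding saturated_sets_def
  by (metis (no_types, lifting) mem_Collect_eq saturated_upset_borel sets.sigma_sets_subset space_borel subsetD subsetI)

text \<open>
  The sets whose indicator has vanishing gradient are closed under complements and disjoint unions,
  because these amount to linear combinations and limits of indicators, unlike intersections, which
  amount to products. By Dynkin's theorem it is enough that saturated up-sets are closed under
  intersection.
\<close>
lemma indicator_saturated_set:
  assumes "A \<in> saturated_sets"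
  shows "(\<lambda>x. 0) \<in> gradients I M (indicator A)"
proof -
  have "Int_stable {E. saturated_upset E}"
    by (rule Int_stableI) (unfold saturated_upset_def mem_Collect_eq, blast)
  moreover have "{E. saturated_upset E} \<subseteq> Pow UNIV" by simp
  ultimately show ?thesis using assms unfolding saturated_sets_def
  proof (induction rule: sigma_sets_induct_disjoint)
    case (basic A)
    then show ?case by (simp add: indicator_saturated_upset)
  next
    case empty
    show ?case using C1_pair_gradients[OF C1_pair_const[of 0]] by simp
  next
    case (compl A)
    from gradients_lincomb[OF C1_pair_gradients[OF C1_pair_const[of 1]] compl(2), of 1 "-1"]
    show ?case by (simp add: indicator_compl Compl_eq_Diff_UNIV[symmetric])
  next
    case (union A)
    have A: "A i \<in> sets borel" for i
      using union(2) saturated_sets_borel unfolding saturated_sets_def by blast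
    have partial: "(\<lambda>x. 0) \<in> gradients I M (\<lambda>x. \<Sum>i<n. indicator (A i) x)" for n
    proof (induction n)
      case 0
      show ?case using C1_pair_gradients[OF C1_pair_const[of 0]] by simp
    next
      case (Suc n)
      from gradients_lincomb[OF Suc union(3)[of n], of 1 1] show ?case by simp
    qed
    have eq: "(\<Sum>i<n. indicator (A i) x :: real) = indicator (\<Union>i<n. A i) x" for n x
      using union(1) by (intro indicator_UN_disjoint[symmetric])
        (auto simp: disjoint_family_on_def)
    show ?case
    proof (rule gradients_limit[OF partial])
      show "indicator (\<Union> (range A)) \<in> L2 M"
        using A by (intro bounded_L2(1)[of _ 1] borel_measurable_M) (auto simp: indicator_def)
      show "(\<lambda>n. sqnorm M (\<lambda>x. (\<Sum>i<n. indicator (A i) x) - indicator (\<Union> (range A)) x)) \<longlonglongrightarrow> 0"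
        unfolding eq
      proof (rule sqnorm_dominated_convergence[where h = "\<lambda>x. 1"])
        fix x
        show "(\<lambda>n. indicator (\<Union>i<n. A i) x :: real) \<longlonglongrightarrow> indicator (\<Union> (range A)) x"
          by (rule LIMSEQ_indicator_UN)
      qed (use A in \<open>auto intro!: borel_measurable_M L2_I simp: indicator_def\<close>)
    qed
  qed
qed

end

section \<open>Laws and norms of almost everywhere limits\<close>

text \<open>
  The characteristic functions converge by dominated convergence, and they determine the law.
\<close>
lemma AE_limit_same_law:
  assumes "prob_space M"
    and f [measurable]: "\<And>n. f n \<in> borel_measurable M" and g [measurable]: "g \<in> borel_measurable M"
    and law: "\<And>n. distr M borel (f n) = N"
    and lim: "AE x in M. (\<lambda>n. f n x) \<longlonglongrightarrow> (g x :: real)"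
  shows "distr M borel g = N"
proof -
  interpret prob_space M by fact
  have dist: "real_distribution (distr M borel h)" if "h \<in> borel_measurable M" for h :: "'a \<Rightarrow> real"
    using that by (rule real_distribution_distr)
  have char: "char (distr M borel h) t = (CLINT x|M. iexp (t * h x))"
    if [measurable]: "h \<in> borel_measurable M" for h :: "'a \<Rightarrow> real" and t
    unfolding char_def by (subst integral_distr) auto
  have "char (distr M borel g) = char N"
  proof
    fix t
    have "(\<lambda>n. CLINT x|M. iexp (t * f n x)) \<longlonglongrightarrow> (CLINT x|M. iexp (t * g x))"
    proof (rule integral_dominated_convergence[where w = "\<lambda>x. 1"])
      show "AE x in M. (\<lambda>n. iexp (t * f n x)) \<longlonglongrightarrow> iexp (t * g x)"
        using lim by eventually_elim (auto intro!: tendsto_intros)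
    qed auto
    then have "(\<lambda>n. char N t) \<longlonglongrightarrow> char (distr M borel g) t"
      using char[OF f] by (simp add: char g law)
    then show "char (distr M borel g) t = char N t" by (simp add: LIMSEQ_const_iff)
  qed
  then show ?thesis
    using Levy_uniqueness[OF dist[OF g] dist[OF f[of 0]]] by (simp add: law)
qed

text \<open>
  If the distance stayed above \<open>e\<close> along a subsequence, the parallelogram identity would push the
  squared norm of the sum \<open>f n + g\<close> below \<open>4 \<parallel>g\<parallel>\<^sup>2 - e\<close>, whereas Fatou's lemma makes it at least
  \<open>\<parallel>2 g\<parallel>\<^sup>2\<close> in the limit.
\<close>
lemma AE_and_norm_convergence_imp_L2:
  assumes f: "\<And>n. f n \<in> L2 M" and g: "g \<in> L2 M"
    and lim: "AE x in M. (\<lambda>n. f n x) \<longlonglongrightarrow> g x"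
    and norm: "\<And>n. sqnorm M (f n) = sqnorm M g"
  shows "(\<lambda>n. sqnorm M (\<lambda>x. f n x - g x)) \<longlonglongrightarrow> 0"
proof (rule ccontr)
  define s where "s n = sqnorm M (\<lambda>x. f n x - g x)" for n
  assume "\<not> (\<lambda>n. sqnorm M (\<lambda>x. f n x - g x)) \<longlonglongrightarrow> 0"
  then have "\<not> s \<longlonglongrightarrow> 0" by (simp add: s_def[abs_def])
  then obtain e where e: "0 < e" "\<And>N. \<exists>n\<ge>N. e \<le> s n"
    unfolding LIMSEQ_iff by (auto simp: s_def not_less)
  then have "infinite {n. e \<le> s n}" unfolding infinite_nat_iff_unbounded_le by auto
  from infinite_enumerate[OF this] obtain r :: "nat \<Rightarrow> nat"
    where r: "strict_mono r" "\<And>n. e \<le> s (r n)" by auto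
  have bound: "sqnorm M (\<lambda>x. f (r n) x + g x) \<le> 4 * sqnorm M g - e" for n
    using parallelogram[OF f[of "r n"] g] norm[of "r n"] r(2)[of n] unfolding s_def by linarith
  have "AE x in M. (\<lambda>n. f (r n) x + g x) \<longlonglongrightarrow> 2 * g x"
    using lim
  proof eventually_elim
    case (elim x)
    then have "(\<lambda>n. f (r n) x) \<longlonglongrightarrow> g x"
      using LIMSEQ_subseq_LIMSEQ[OF elim r(1)] by (simp add: o_def)
    from tendsto_add[OF this tendsto_const[of "g x"]] show ?case by simp
  qed
  from L2_Fatou(2)[OF L2_add[OF f g] _ this bound]
  have "sqnorm M (\<lambda>x. 2 * g x) \<le> 4 * sqnorm M g - e"
    using L2_measurable[OF g] by simp
  then show False using e(1) unfolding sqnorm_scale by simp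
qed

section \<open>The rigid and the free part of the interval\<close>

context interval_measure
begin

text \<open>
  Every class of linked points that has more than one point, or whose only point is an atom, contains
  an anchor.
\<close>
definition anchors :: "real set" where
  "anchors = \<rat> \<union> {x. measure M {x} \<noteq> 0}"

definition rigid_part :: "real set" where
  "rigid_part = {x. \<exists>q\<in>anchors. linked q x}"

definition free_part :: "real set" where
  "free_part = I - rigid_part"

lemma countable_anchors: "countable anchors"
  unfolding anchors_def using countable_support countable_rat by simp

lemma linked_non_rigid:
  assumes x: "x \<notin> rigid_part" and "linked x y"
  shows "y = x"
proof (rule ccontr)
  assume "y \<noteq> x"
  then have "min x y < max x y" by auto
  then obtain q where q: "q \<in> \<rat>" "min x y < q" "q < max x y"
    using Rats_dense_in_real by blast
  then have "q \<in> closed_segment x y" by (auto simp: closed_segment_eq_real_ivl split: if_splits)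
  from linked_sym[OF linked_convex[OF assms(2) this]] x q(1) show False
    by (auto simp: rigid_part_def anchors_def)
qed

lemma non_rigid_not_atom: "x \<notin> rigid_part \<Longrightarrow> measure M {x} = 0"
  using linked_refl[of x] by (auto simp: rigid_part_def anchors_def)

lemma saturated_sigma_algebra: "sigma_algebra UNIV saturated_sets"
  unfolding saturated_sets_def by (rule sigma_algebra_sigma_sets) simp

text \<open>
  A class is the difference of two saturated up-sets: the points that are above some element, and
  those that are above all elements of it.
\<close>
lemma link_class_saturated: "{x. linked q x} \<in> saturated_sets"
proof -
  interpret sigma_algebra UNIV saturated_sets by (rule saturated_sigma_algebra)
  have between: "linked q y" if "linked q x" "linked q z" "x \<le> y" "y \<le> z" for x y z
  proof -
    have "linked x z" using that linked_sym linked_trans by blast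
    moreover have "y \<in> closed_segment x z" using that by (simp add: closed_segment_eq_real_ivl)
    ultimately show ?thesis using that(1) linked_convex linked_trans by blast
  qed
  define above where "above = {x. \<forall>y. linked q y \<longrightarrow> y < x}"
  define upper where "upper = {x. \<exists>y. linked q y \<and> y \<le> x}"
  have "saturated_upset above"
    unfolding saturated_upset_def
  proof (intro conjI ballI allI impI)
    fix x y assume "x \<in> above" "x \<le> y"
    then show "y \<in> above" by (auto simp: above_def intro: less_le_trans)
  next
    fix x x' assume x: "x \<in> above" and l: "linked x x'"
    show "x' \<in> above"
      unfolding above_def
    proof (intro CollectI allI impI, rule ccontr)
      fix y assume y: "linked q y" and "\<not> y < x'"
      then have "y \<in> closed_segment x' x" using x by (auto simp: above_def closed_segment_eq_real_ivl)
      then have "linked x' y" using linked_convex linked_sym l by blast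
      then have "linked q x" using y l linked_sym linked_trans by blast
      then show False using x by (auto simp: above_def)
    qed
  qed
  moreover have "saturated_upset upper"
    unfolding saturated_upset_def
  proof (intro conjI ballI allI impI)
    fix x y assume "x \<in> upper" "x \<le> y"
    then show "y \<in> upper" by (auto simp: upper_def intro: order_trans)
  next
    fix x x' assume x: "x \<in> upper" and l: "linked x x'"
    then obtain y where y: "linked q y" "y \<le> x" by (auto simp: upper_def)
    show "x' \<in> upper"
    proof (cases "y \<le> x'")
      case False
      then have "y \<in> closed_segment x' x" using y by (auto simp: closed_segment_eq_real_ivl)
      then have "linked x' y" using linked_convex linked_sym l by blast
      then have "linked q x'" using y linked_sym linked_trans by blast
      then show ?thesis by (auto simp: upper_def)
    qed (use y in \<open>auto simp: upper_def\<close>)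
  qed
  ultimately have "above \<in> saturated_sets" "upper \<in> saturated_sets"
    unfolding saturated_sets_def by (auto intro: sigma_sets.Basic)
  then have "upper - above \<in> saturated_sets" by (rule Diff[rotated])
  moreover have "upper - above = {x. linked q x}"
  proof (intro equalityI subsetI)
    fix x assume "x \<in> upper - above"
    then obtain y z where "linked q y" "y \<le> x" "linked q z" "x \<le> z"
      unfolding above_def upper_def by (auto simp: not_less)
    then show "x \<in> {x. linked q x}" using between[of y z x] by simp
  next
    fix x assume "x \<in> {x. linked q x}"
    then show "x \<in> upper - above" unfolding above_def upper_def by auto
  qed
  ultimately show ?thesis by simp
qed

lemma rigid_part_saturated: "rigid_part \<in> saturated_sets"
proof -
  interpret sigma_algebra UNIV saturated_sets by (rule saturated_sigma_algebra)
  have "rigid_part = (\<Union>q\<in>anchors. {x. linked q x})" by (auto simp: rigid_part_def)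
  then show ?thesis using countable_anchors link_class_saturated by (auto intro!: countable_UN')
qed

lemma rigid_part_borel [measurable]: "rigid_part \<in> sets borel"
  by (rule saturated_sets_borel[OF rigid_part_saturated])

lemma free_part_sets [measurable]: "free_part \<in> sets M"
  by (auto simp: sets_M_iff free_part_def)

text \<open>
  Outside of the rigid part a half-line \<open>t < x\<close> agrees with the set of all points whose whole class
  lies in this half-line, and the latter is a saturated up-set. Half-lines generate the Borel sets.
\<close>
lemma non_rigid_borel_saturated:
  assumes B: "B \<in> sets borel"
  shows "B - rigid_part \<in> saturated_sets"
proof -
  interpret sigma_algebra UNIV saturated_sets by (rule saturated_sigma_algebra)
  define N where "N = restrict_space (sigma UNIV saturated_sets) (- rigid_part)"
  have sets: "sets (sigma UNIV saturated_sets) = saturated_sets"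
    by (simp add: sets_measure_of_conv sigma_sets_eq)
  have comp: "- rigid_part \<in> saturated_sets"
    using compl_sets[OF rigid_part_saturated] by (simp add: Compl_eq_Diff_UNIV)
  have sets_N: "A \<in> sets N \<longleftrightarrow> A \<subseteq> - rigid_part \<and> A \<in> saturated_sets" for A
    unfolding N_def using comp by (subst sets_restrict_space_iff) (auto simp: sets)
  have space_N: "space N = - rigid_part" by (simp add: N_def space_restrict_space)
  have "(\<lambda>x. x) \<in> borel_measurable N"
  proof (rule borel_measurableI_greater)
    fix t
    define E where "E = {x. \<forall>y. linked x y \<longrightarrow> t < y}"
    have "saturated_upset E"
      unfolding saturated_upset_def
    proof (intro conjI ballI allI impI)
      fix x x' assume x: "x \<in> E" and "x \<le> x'"
      show "x' \<in> E"
        unfolding E_def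
      proof (intro CollectI allI impI, rule ccontr)
        fix y assume y: "linked x' y" "\<not> t < y"
        have "t < x" using x linked_refl by (auto simp: E_def)
        then have "x \<in> closed_segment y x'" using y(2) \<open>x \<le> x'\<close> by (simp add: closed_segment_eq_real_ivl)
        then have "linked x y" using linked_convex linked_sym y(1) by blast
        then show False using x y(2) by (auto simp: E_def)
      qed
    next
      fix x x' assume "x \<in> E" "linked x x'"
      then show "x' \<in> E" using linked_trans by (auto simp: E_def)
    qed
    then have "E \<in> saturated_sets" unfolding saturated_sets_def by (auto intro: sigma_sets.Basic)
    moreover have "{x \<in> space N. t < x} = E - rigid_part"
      using linked_non_rigid linked_refl by (auto simp: space_N E_def)
    ultimately show "{x \<in> space N. t < x} \<in> sets N"
      using rigid_part_saturated by (auto simp: sets_N)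
  qed
  from measurable_sets[OF this B] have "B \<inter> - rigid_part \<in> saturated_sets"
    by (simp add: sets_N space_N)
  then show ?thesis by (simp add: Diff_eq)
qed

lemma vanishing_gradient_sum:
  assumes "finite S" "\<And>y. y \<in> S \<Longrightarrow> (\<lambda>x. 0) \<in> gradients I M (g y)"
  shows "(\<lambda>x. 0) \<in> gradients I M (\<lambda>x. \<Sum>y\<in>S. c y * g y x)"
  using assms
proof (induction S)
  case empty
  show ?case using C1_pair_gradients[OF C1_pair_const[of 0]] by simp
next
  case (insert y S)
  from gradients_lincomb[OF insert.prems[of y] insert.IH, of "c y" 1] insert
  show ?case by simp
qed

text \<open>
  Simple functions that approximate \<open>f\<close> and are dominated by a multiple of \<open>f\<close> vanish on the rigid
  part as well, so their nonzero level sets are Borel sets outside of the rigid part.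
\<close>
lemma vanishing_gradient_free_part:
  assumes f: "f \<in> L2 M" and supp: "\<And>x. x \<in> I \<Longrightarrow> x \<in> rigid_part \<Longrightarrow> f x = 0"
  shows "(\<lambda>x. 0) \<in> gradients I M f"
proof -
  obtain s where s0: "\<forall>i. simple_function M (s i)" "\<forall>x\<in>space M. (\<lambda>i. s i x) \<longlonglongrightarrow> f x"
      "\<forall>i. \<forall>x\<in>space M. dist (s i x) 0 \<le> 2 * dist (f x) 0"
    using borel_measurable_implies_sequence_metric[OF L2_measurable[OF f], of 0] by blast
  then have s: "\<And>i. simple_function M (s i)" "\<And>x. x \<in> I \<Longrightarrow> (\<lambda>i. s i x) \<longlonglongrightarrow> f x"
      "\<And>i x. x \<in> I \<Longrightarrow> \<bar>s i x\<bar> \<le> 2 * \<bar>f x\<bar>"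
    by simp_all
  \<comment> \<open>The level of 0 may meet the rigid part, but contributes nothing to the sum; it is emptied.\<close>
  define level where "level i y = (if y = 0 then {} else s i -` {y} \<inter> I)" for i y
  have "level i y \<in> saturated_sets" for i y
  proof -
    have "s i -` {y} \<inter> I \<in> sets borel"
      using simple_functionD(2)[OF s(1)[of i], of "{y}"] by (simp add: sets_M_iff)
    then have "level i y \<in> sets borel" by (simp add: level_def)
    moreover have "level i y - rigid_part = level i y"
    proof -
      have "s i x = 0" if "x \<in> I" "x \<in> rigid_part" for x
        using s(3)[OF that(1), of i] supp[OF that] by simp
      then show ?thesis by (auto simp: level_def)
    qed
    ultimately show ?thesis using non_rigid_borel_saturated by metis
  qed
  then have v: "(\<lambda>x. 0) \<in> gradients I M (\<lambda>x. \<Sum>y\<in>s i ` I. y * indicator (level i y) x)" for i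
    using simple_functionD(1)[OF s(1)[of i]]
    by (intro vanishing_gradient_sum indicator_saturated_set) auto
  have eq: "(\<Sum>y\<in>s i ` I. y * indicator (level i y) x) = s i x" if "x \<in> I" for i x
  proof -
    have "s i x = (\<Sum>y\<in>s i ` I. indicator (s i -` {y} \<inter> I) x *\<^sub>R y)"
      using simple_function_indicator_representation_banach[OF s(1)[of i], of x] that
      unfolding space_M by blast
    also have "\<dots> = (\<Sum>y\<in>s i ` I. y * indicator (level i y) x)"
    proof (rule sum.cong[OF refl])
      fix y
      show "indicator (s i -` {y} \<inter> I) x *\<^sub>R y = y * indicator (level i y) x"
        by (cases "y = 0") (simp_all add: level_def)
    qed
    finally show ?thesis by simp
  qed
  show ?thesis
  proof (rule gradients_limit[OF v f])
    show "(\<lambda>n. sqnorm M (\<lambda>x. (\<Sum>y\<in>s n ` I. y * indicator (level n y) x) - f x)) \<longlonglongrightarrow> 0"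
    proof (rule sqnorm_dominated_convergence[OF _ L2_measurable[OF f] L2_scale[OF f, of 3]])
      show "(\<lambda>x. \<Sum>y\<in>s n ` I. y * indicator (level n y) x) \<in> borel_measurable M" for n
        by (rule L2_measurable[OF gradients_L2(1)[OF v]])
      show "(\<lambda>n. \<Sum>y\<in>s n ` I. y * indicator (level n y) x) \<longlonglongrightarrow> f x" if "x \<in> I" for x
        using s(2)[OF that] by (simp add: eq[OF that])
      show "\<bar>(\<Sum>y\<in>s n ` I. y * indicator (level n y) x) - f x\<bar> \<le> \<bar>3 * f x\<bar>" if "x \<in> I" for n x
      proof -
        have "\<bar>s n x - f x\<bar> \<le> \<bar>s n x\<bar> + \<bar>f x\<bar>" by (rule abs_triangle_ineq4)
        also have "\<dots> \<le> \<bar>3 * f x\<bar>" using s(3)[OF that, of n] by simp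
        finally show ?thesis by (simp add: eq[OF that])
      qed
    qed
  qed
qed

definition free_measure :: "real measure" where
  "free_measure = restrict_space M free_part"

lemma free_part_Int [simp]: "free_part \<inter> space M \<in> sets M"
  by measurable

lemma free_part_subset: "free_part \<subseteq> I"
  by (auto simp: free_part_def)

lemma space_free_measure: "space free_measure = free_part"
  using free_part_subset by (auto simp: free_measure_def space_restrict_space)

lemma free_measure_measurable: "f \<in> borel_measurable M \<Longrightarrow> f \<in> borel_measurable free_measure"
  unfolding free_measure_def by (rule measurable_restrict_space1)

sublocale free: atomless_coordinate free_measure "\<lambda>x. x"
proof (intro atomless_coordinate.intro atomless_coordinate_axioms.intro)
  show "finite_measure free_measure"
    unfolding free_measure_def by (rule finite_measure_restrict_space) (auto intro: finite_measure_axioms)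
  show "(\<lambda>x. x) \<in> borel_measurable free_measure"
    by (intro free_measure_measurable borel_measurable_M) simp
  fix x
  have "measure free_measure {w \<in> space free_measure. w = x} = measure M {w \<in> free_part. w = x}"
    unfolding space_free_measure unfolding free_measure_def by (intro measure_restrict_space) auto
  also have "\<dots> = 0"
  proof (cases "x \<in> free_part")
    case True
    then have single: "{w \<in> free_part. w = x} = {x}" by auto
    show ?thesis unfolding single by (rule non_rigid_not_atom) (use True in \<open>simp add: free_part_def\<close>)
  next
    case False
    then have empty: "{w \<in> free_part. w = x} = {}" by auto
    show ?thesis unfolding empty by simp
  qed
  finally show "measure free_measure {w \<in> space free_measure. w = x} = 0" .
qed

text \<open>
  Rearrangement on the free part alone: there it does not affect the gradients, and on the rigid part
  the values must be kept.
\<close>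
definition monotonise :: "(real \<Rightarrow> real) \<Rightarrow> real \<Rightarrow> real" where
  "monotonise f x = (if x \<in> rigid_part then f x else free.rearrangement f x)"

lemma monotonise_measurable:
  assumes f [measurable]: "f \<in> borel_measurable M"
  shows "monotonise f \<in> borel_measurable M"
proof -
  have [measurable]: "rigid_part \<inter> I \<in> sets M" by (simp add: sets_M_iff)
  have [measurable]: "free.rearrangement f \<in> borel_measurable M"
    by (intro borel_measurable_M free.rearrangement_borel free_measure_measurable f)
  have "(\<lambda>x. if x \<in> rigid_part \<inter> I then f x else free.rearrangement f x) \<in> borel_measurable M"
    by measurable
  then show ?thesis
    by (rule measurable_cong[THEN iffD1, rotated]) (auto simp: monotonise_def)
qed

text \<open>
  The law is the sum of the contributions of the two parts, and rearrangement preserves that of the free part.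
\<close>
lemma monotonise_law:
  assumes f [measurable]: "f \<in> borel_measurable M"
  shows "distr M borel (monotonise f) = distr M borel f"
proof (rule measure_eqI)
  note [measurable] = monotonise_measurable[OF f]
  fix B assume "B \<in> sets (distr M borel (monotonise f))"
  then have B [measurable]: "B \<in> sets borel" by simp
  have split: "emeasure (distr M borel h) B =
      emeasure M ({x \<in> I \<inter> rigid_part. h x \<in> B}) + emeasure (distr free_measure borel h) B"
    if h [measurable]: "h \<in> borel_measurable M" for h
  proof -
    have meas: "{x \<in> I. h x \<in> B} \<in> sets M" using measurable_sets[OF h B] by (simp add: vimage_def Int_def conj_commute)
    have r: "rigid_part \<inter> I \<in> sets M" by (simp add: sets_M_iff)
    have "{x \<in> I. h x \<in> B} = {x \<in> I \<inter> rigid_part. h x \<in> B} \<union> {x \<in> free_part. h x \<in> B}"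
      by (auto simp: free_part_def)
    moreover have "{x \<in> I \<inter> rigid_part. h x \<in> B} \<in> sets M"
      using sets.Int[OF meas r] by (rule back_subst[of "\<lambda>A. A \<in> sets M"]) auto
    moreover have "{x \<in> free_part. h x \<in> B} \<in> sets M"
      using sets.Int[OF meas free_part_sets] by (rule back_subst[of "\<lambda>A. A \<in> sets M"]) (auto simp: free_part_def)
    ultimately have "emeasure M {x \<in> I. h x \<in> B} =
        emeasure M {x \<in> I \<inter> rigid_part. h x \<in> B} + emeasure M {x \<in> free_part. h x \<in> B}"
      by (subst plus_emeasure) (auto simp: free_part_def)
    moreover have "emeasure (distr free_measure borel h) B = emeasure M {x \<in> free_part. h x \<in> B}"
    proof -
      have "emeasure (distr free_measure borel h) B = emeasure free_measure {x \<in> free_part. h x \<in> B}"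
        using free_measure_measurable[OF h]
        by (subst emeasure_distr) (auto simp: space_free_measure intro!: arg_cong[where f = "emeasure free_measure"])
      then show ?thesis by (simp add: free_measure_def emeasure_restrict_space)
    qed
    moreover have "emeasure (distr M borel h) B = emeasure M {x \<in> I. h x \<in> B}"
      by (subst emeasure_distr) (auto intro!: arg_cong[where f = "emeasure M"])
    ultimately show ?thesis by simp
  qed
  have "distr free_measure borel (monotonise f) = distr free_measure borel (free.rearrangement f)"
    by (intro distr_cong) (auto simp: monotonise_def space_free_measure free_part_def)
  also have "\<dots> = distr free_measure borel f"
    by (rule free.rearrangement_equimeasurable[OF free_measure_measurable[OF f]])
  finally have "distr free_measure borel (monotonise f) = distr free_measure borel f" .
  moreover have "{x \<in> I \<inter> rigid_part. monotonise f x \<in> B} = {x \<in> I \<inter> rigid_part. f x \<in> B}"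
    by (auto simp: monotonise_def)
  ultimately show "emeasure (distr M borel (monotonise f)) B = emeasure (distr M borel f) B"
    by (simp add: split f)
qed simp

lemma same_law_L2:
  assumes "f \<in> L2 M" and g: "g \<in> borel_measurable M" and law: "distr M borel g = distr M borel f"
  shows "g \<in> L2 M" and "sqnorm M g = sqnorm M f"
proof -
  have f: "f \<in> borel_measurable M" "integrable M (\<lambda>x. (f x)\<^sup>2)"
    using assms(1) by (auto simp: L2_def)
  have "integrable (distr M borel f) (\<lambda>y::real. y\<^sup>2)"
    using f by (subst integrable_distr_eq) auto
  then have "integrable (distr M borel g) (\<lambda>y::real. y\<^sup>2)" by (simp add: law)
  then have "integrable M (\<lambda>x. (g x)\<^sup>2)" using g by (subst (asm) integrable_distr_eq) auto
  then show "g \<in> L2 M" using g by (intro L2_I)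
  have "sqnorm M h = (\<integral>y. y\<^sup>2 \<partial>distr M borel h)" if "h \<in> borel_measurable M" for h :: "real \<Rightarrow> real"
    unfolding sqnorm_def using that by (subst integral_distr) auto
  then show "sqnorm M g = sqnorm M f" using f g law by simp
qed

lemma monotonise_L2:
  assumes "f \<in> L2 M"
  shows "monotonise f \<in> L2 M" and "sqnorm M (monotonise f) = sqnorm M f"
proof -
  note m = L2_measurable[OF assms]
  show "monotonise f \<in> L2 M" and "sqnorm M (monotonise f) = sqnorm M f"
    using same_law_L2[OF assms monotonise_measurable[OF m] monotonise_law[OF m]] by auto
qed

lemma identity_L2: "(\<lambda>x. x) \<in> L2 M"
  by (rule continuous_L2) simp

lemma monotonise_distance:
  assumes f: "f \<in> L2 M"
  shows "sqnorm M (\<lambda>x. monotonise f x - x) \<le> sqnorm M (\<lambda>x. f x - x)"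
proof -
  have split: "sqnorm M (\<lambda>x. h x - x) =
      (\<integral>x. indicator (I \<inter> rigid_part) x * (h x - x)\<^sup>2 \<partial>M) + (\<integral>x. (h x - x)\<^sup>2 \<partial>free_measure)"
    if h: "h \<in> L2 M" for h
  proof -
    have int: "integrable M (\<lambda>x. (h x - x)\<^sup>2)"
      using L2_diff[OF h identity_L2] by (rule L2_square_integrable)
    have "I \<inter> rigid_part \<in> sets M" by (simp add: sets_M_iff)
    from integrable_mult_indicator[OF this int]
    have 1: "integrable M (\<lambda>x. indicator (I \<inter> rigid_part) x * (h x - x)\<^sup>2)" by simp
    from integrable_mult_indicator[OF free_part_sets int]
    have 2: "integrable M (\<lambda>x. indicator free_part x * (h x - x)\<^sup>2)" by simp
    have "sqnorm M (\<lambda>x. h x - x) =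
        (\<integral>x. indicator (I \<inter> rigid_part) x * (h x - x)\<^sup>2 + indicator free_part x * (h x - x)\<^sup>2 \<partial>M)"
      unfolding sqnorm_def
      by (intro Bochner_Integration.integral_cong) (auto simp: indicator_def free_part_def)
    also have "\<dots> = (\<integral>x. indicator (I \<inter> rigid_part) x * (h x - x)\<^sup>2 \<partial>M) +
        (\<integral>x. (h x - x)\<^sup>2 \<partial>free_measure)"
      using 1 2 by (simp add: free_measure_def integral_restrict_space)
    finally show ?thesis .
  qed
  have "integrable free_measure (\<lambda>x. (f x)\<^sup>2)"
    unfolding free_measure_def
    using integrable_mult_indicator[OF free_part_sets L2_square_integrable[OF f]]
    by (subst integrable_restrict_space) auto
  then have "(\<integral>x. (free.rearrangement f x - x)\<^sup>2 \<partial>free_measure) \<le> (\<integral>x. (f x - x)\<^sup>2 \<partial>free_measure)"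
  proof (intro free.rearrangement_distance[of f a b] free_measure_measurable L2_measurable[OF f])
    fix x assume "x \<in> space free_measure"
    then have "x \<in> I" using free_part_subset by (auto simp: space_free_measure)
    then show "a \<le> x \<and> x \<le> b" by (simp add: I_eq)
  qed
  moreover have "(\<integral>x. (monotonise f x - x)\<^sup>2 \<partial>free_measure) = (\<integral>x. (free.rearrangement f x - x)\<^sup>2 \<partial>free_measure)"
    by (intro Bochner_Integration.integral_cong) (auto simp: monotonise_def space_free_measure free_part_def)
  moreover have "(\<integral>x. indicator (I \<inter> rigid_part) x * (monotonise f x - x)\<^sup>2 \<partial>M) =
      (\<integral>x. indicator (I \<inter> rigid_part) x * (f x - x)\<^sup>2 \<partial>M)"
    by (intro Bochner_Integration.integral_cong) (auto simp: monotonise_def indicator_def)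
  ultimately show ?thesis
    unfolding split[OF f] split[OF monotonise_L2(1)[OF f]] by simp
qed

lemma monotonise_gradients:
  assumes "v \<in> gradients I M f"
  shows "v \<in> gradients I M (monotonise f)"
proof -
  note f = gradients_L2(1)[OF assms]
  have "(\<lambda>x. 0) \<in> gradients I M (\<lambda>x. monotonise f x - f x)"
    by (intro vanishing_gradient_free_part L2_diff monotonise_L2 f) (simp add: monotonise_def)
  from gradients_add_null[OF assms this] show ?thesis by simp
qed

end

section \<open>Compactness of monotonised sequences and existence of minimisers\<close>

context interval_measure
begin

lemma link_const_bound:
  assumes C: "link_const C x y" and z: "z \<in> closed_segment x y"
    and P: "C1_pair P \<psi>" "\<And>t. 0 \<le> \<psi> t"
  shows "(P z - P x)\<^sup>2 \<le> C * sqnorm M \<psi>"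
proof -
  have C0: "0 \<le> C" using C by (simp add: link_const_def)
  define s t where "s = min x z" and "t = max x z"
  have "s \<in> closed_segment x y" "t \<in> closed_segment x y" "s \<le> t"
    using z by (auto simp: s_def t_def min_def max_def)
  then have "(P t - P s)\<^sup>2 \<le> C * energy_on \<psi> s t"
    using C P unfolding link_const_def by blast
  moreover have "(P t - P s)\<^sup>2 = (P z - P x)\<^sup>2"
    by (auto simp: s_def t_def min_def max_def power2_commute)
  moreover have "C * energy_on \<psi> s t \<le> C * sqnorm M \<psi>"
    using C0 energy_on_le_sqnorm[OF C1_pair_continuous(2)[OF P(1)]] by (rule mult_left_mono[rotated])
  ultimately show ?thesis by linarith
qed

text \<open>
  The Jordan decomposition of a function of bounded variation, obtained by integrating the positive
  and the negative part of the derivative; it brings arbitrary \<open>C\<^sup>1\<close> functions into the reach of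
  \<open>link_const\<close> and of Helly's theorem, both of which concern monotone functions.
\<close>
lemma C1_pair_monotone_decomposition:
  assumes U: "C1_pair U \<phi>"
  shows "\<exists>P N. C1_pair P (\<lambda>x. max 0 (\<phi> x)) \<and> C1_pair N (\<lambda>x. max 0 (- \<phi> x)) \<and>
    P q = 0 \<and> N q = 0 \<and> (\<forall>x. U x = U q + P x - N x)"
proof -
  note cont = C1_pair_continuous(2)[OF U, of UNIV]
  have "continuous_on UNIV (\<lambda>x. max 0 (\<phi> x))" "continuous_on UNIV (\<lambda>x. max 0 (- \<phi> x))"
    using cont by (auto intro!: continuous_on_max continuous_on_minus)
  note parts = this[THEN C1_pair_exists[where c = q]]
  obtain P where P: "C1_pair P (\<lambda>x. max 0 (\<phi> x))" "P q = 0"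
    using parts(1) by blast
  obtain N where N: "C1_pair N (\<lambda>x. max 0 (- \<phi> x))" "N q = 0"
    using parts(2) by blast
  have "\<forall>x. ((\<lambda>x. U x - P x + N x) has_real_derivative 0) (at x)"
  proof
    fix x
    have "((\<lambda>x. U x - P x + N x) has_real_derivative \<phi> x - max 0 (\<phi> x) + max 0 (- \<phi> x)) (at x)"
      by (intro DERIV_add DERIV_diff C1_pairD[OF U] C1_pairD[OF P(1)] C1_pairD[OF N(1)])
    moreover have "\<phi> x - max 0 (\<phi> x) + max 0 (- \<phi> x) = 0" by (simp add: max_def)
    ultimately show "((\<lambda>x. U x - P x + N x) has_real_derivative 0) (at x)" by (simp only:)
  qed
  from DERIV_isconst_all[OF this] have "U x - P x + N x = U q - P q + N q" for x .
  then have "\<forall>x. U x = U q + P x - N x" using P(2) N(2) by (simp add: algebra_simps)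
  with P N show ?thesis by blast
qed

lemma sqnorm_parts_le:
  assumes "C1_pair U \<phi>"
  shows "sqnorm M (\<lambda>x. max 0 (\<phi> x)) \<le> sqnorm M \<phi>" "sqnorm M (\<lambda>x. max 0 (- \<phi> x)) \<le> sqnorm M \<phi>"
proof -
  note L = C1_pair_L2(2)[OF assms]
  note m = L2_measurable[OF L]
  have "(\<lambda>x. max 0 (\<phi> x)) \<in> borel_measurable M" "(\<lambda>x. max 0 (- \<phi> x)) \<in> borel_measurable M"
    using m by (auto intro: borel_measurable_max)
  then show "sqnorm M (\<lambda>x. max 0 (\<phi> x)) \<le> sqnorm M \<phi>" "sqnorm M (\<lambda>x. max 0 (- \<phi> x)) \<le> sqnorm M \<phi>"
    by (auto intro!: L2_dominated(2)[OF _ L])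
qed

lemma C1_pair_oscillation:
  assumes U: "C1_pair U \<phi>" and C: "link_const C q y" and x: "x \<in> closed_segment q y"
  shows "(U x - U q)\<^sup>2 \<le> 4 * C * sqnorm M \<phi>"
proof -
  have C0: "0 \<le> C" using C by (simp add: link_const_def)
  obtain P N where P: "C1_pair P (\<lambda>x. max 0 (\<phi> x))" "P q = 0" and N: "C1_pair N (\<lambda>x. max 0 (- \<phi> x))" "N q = 0"
    and U_eq: "\<forall>x. U x = U q + P x - N x"
    using C1_pair_monotone_decomposition[OF U, of q] by blast
  have "(P x)\<^sup>2 \<le> C * sqnorm M (\<lambda>x. max 0 (\<phi> x))" "(N x)\<^sup>2 \<le> C * sqnorm M (\<lambda>x. max 0 (- \<phi> x))"
    using link_const_bound[OF C x P(1)] link_const_bound[OF C x N(1)] P(2) N(2) by auto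
  moreover have "C * sqnorm M (\<lambda>x. max 0 (\<phi> x)) \<le> C * sqnorm M \<phi>"
      "C * sqnorm M (\<lambda>x. max 0 (- \<phi> x)) \<le> C * sqnorm M \<phi>"
    by (intro mult_left_mono sqnorm_parts_le[OF U] C0)+
  moreover have "(U x - U q)\<^sup>2 \<le> 2 * (P x)\<^sup>2 + 2 * (N x)\<^sup>2"
  proof -
    have "U x - U q = P x - N x" using U_eq[rule_format, of x] by simp
    moreover have "(P x - N x)\<^sup>2 \<le> 2 * (P x)\<^sup>2 + 2 * (N x)\<^sup>2"
      using zero_le_power2[of "P x + N x"] by (simp add: power2_eq_square algebra_simps)
    ultimately show ?thesis by (simp only:)
  qed
  ultimately show ?thesis by simp
qed

text \<open>
  Some segment of the class that contains \<open>q\<close> has positive mass: the single point \<open>q\<close>, or a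
  nondegenerate one by \<open>linked_imp_mass\<close>. On it the oscillation is bounded, so the \<open>L\<^sup>2\<close> bound gives a
  bound for the value at \<open>q\<close>.
\<close>
lemma bounded_at_class_point:
  fixes U \<phi> :: "nat \<Rightarrow> real \<Rightarrow> real"
  assumes U: "\<And>n. C1_pair (U n) (\<phi> n)" and K: "\<And>n. sqnorm M (U n) \<le> K" "\<And>n. sqnorm M (\<phi> n) \<le> K"
    and mass: "measure M ({x. linked q x} \<inter> I) \<noteq> 0"
  shows "\<exists>B. \<forall>n. \<bar>U n q\<bar> \<le> B"
proof -
  obtain y where y: "linked q y" "0 < measure M (closed_segment q y \<inter> I)"
  proof (cases "\<exists>y. linked q y \<and> y \<noteq> q")
    case True
    then show ?thesis using that linked_imp_mass by metis
  next
    case False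
    then have "{x. linked q x} = {q}" using linked_refl by auto
    then show ?thesis
      using that[of q] mass linked_refl by (simp add: zero_less_measure_iff)
  qed
  obtain C where C: "link_const C q y" using y(1) by (auto simp: linked_def)
  have C0: "0 \<le> C" using C by (simp add: link_const_def)
  define S where "S = closed_segment q y \<inter> I"
  have S: "S \<in> sets M" by (auto simp: S_def sets_M_iff closed_segment_eq_real_ivl)
  define B where "B = (2 * K + 8 * C * K * measure M S) / measure M S"
  have "(U n q)\<^sup>2 \<le> B" for n
  proof -
    note UL = C1_pair_L2(1)[OF U[of n]]
    have pt: "(U n q)\<^sup>2 \<le> 2 * (U n x)\<^sup>2 + 8 * C * K" if "x \<in> S" for x
    proof -
      have "x \<in> closed_segment q y" using that by (simp add: S_def)
      from C1_pair_oscillation[OF U C this, of n]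
      have "(U n x - U n q)\<^sup>2 \<le> 4 * C * K"
        using mult_left_mono[OF K(2)[of n], of "4 * C"] C0 by simp
      moreover have "(U n q)\<^sup>2 \<le> 2 * (U n x)\<^sup>2 + 2 * (U n x - U n q)\<^sup>2"
        using zero_le_power2[of "2 * U n x - U n q"] by (simp add: power2_eq_square algebra_simps)
      ultimately show ?thesis by simp
    qed
    have fin: "integrable M (indicator S :: real \<Rightarrow> real)"
      using S by (intro integrable_real_indicator) (auto simp: emeasure_eq_measure)
    have "(U n q)\<^sup>2 * measure M S = (\<integral>x. (U n q)\<^sup>2 * indicator S x \<partial>M)"
      using S fin by (simp add: S_def)
    also have "\<dots> \<le> (\<integral>x. 2 * (U n x)\<^sup>2 + 8 * C * K * indicator S x \<partial>M)"
      using pt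
      by (intro integral_mono Bochner_Integration.integrable_add integrable_mult_right fin
          L2_square_integrable[OF UL]) (auto simp: indicator_def)
    also have "\<dots> = 2 * sqnorm M (U n) + 8 * C * K * measure M S"
      using S fin L2_square_integrable[OF UL] by (simp add: sqnorm_def S_def)
    also have "\<dots> \<le> 2 * K + 8 * C * K * measure M S" using K(1) by simp
    finally show ?thesis using y(2) by (simp add: B_def S_def pos_le_divide_eq)
  qed
  then have "\<bar>U n q\<bar> \<le> sqrt B" for n using real_le_rsqrt[of "\<bar>U n q\<bar>"] by simp
  then show ?thesis by blast
qed

text \<open>
  Helly's theorem for the two monotone parts, normalised to vanish at \<open>q\<close>, and compactness of a
  bounded sequence of numbers for the values at \<open>q\<close>. On a class without mass the values at \<open>q\<close> need
  not be bounded.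
\<close>
lemma class_compactness:
  fixes U \<phi> :: "nat \<Rightarrow> real \<Rightarrow> real"
  assumes U: "\<And>n. C1_pair (U n) (\<phi> n)" and K: "\<And>n. sqnorm M (U n) \<le> K" "\<And>n. sqnorm M (\<phi> n) \<le> K"
    and mass: "measure M ({x. linked q x} \<inter> I) \<noteq> 0"
  shows "\<exists>r. strict_mono r \<and> (\<forall>x. linked q x \<longrightarrow> convergent (\<lambda>n. U (r n) x))"
proof -
  define J where "J = {x. linked q x}"
  have J: "is_interval J"
    unfolding is_interval_1
  proof (intro ballI allI impI)
    fix x z y assume "x \<in> J" "z \<in> J" and xyz: "x \<le> y \<and> y \<le> z"
    then have qx: "linked q x" and "linked q z" by (simp_all add: J_def)
    then have "linked x z" using linked_sym linked_trans by blast
    moreover have "y \<in> closed_segment x z" using xyz by (simp add: closed_segment_eq_real_ivl)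
    ultimately have "linked x y" by (rule linked_convex)
    with qx have "linked q y" by (rule linked_trans)
    then show "y \<in> J" by (simp add: J_def)
  qed
  have "\<forall>n. \<exists>P N. C1_pair P (\<lambda>x. max 0 (\<phi> n x)) \<and> C1_pair N (\<lambda>x. max 0 (- \<phi> n x)) \<and>
      P q = 0 \<and> N q = 0 \<and> (\<forall>x. U n x = U n q + P x - N x)"
    using C1_pair_monotone_decomposition[OF U] by blast
  then obtain P N where P: "\<And>n. C1_pair (P n) (\<lambda>x. max 0 (\<phi> n x))" "\<And>n. P n q = 0"
    and N: "\<And>n. C1_pair (N n) (\<lambda>x. max 0 (- \<phi> n x))" "\<And>n. N n q = 0"
    and U_eq: "\<And>n x. U n x = U n q + P n x - N n x"
    by metis
  have mono: "mono_on J (P n)" "mono_on J (N n)" for n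
    using C1_pair_mono[OF P(1)[of n]] C1_pair_mono[OF N(1)[of n]] by (auto intro!: mono_onI)
  have bdd: "\<exists>B. \<forall>n. \<bar>V n x\<bar> \<le> B"
    if "x \<in> J" and V: "\<And>n. C1_pair (V n) (\<psi> n)" "\<And>n t. 0 \<le> \<psi> n t" "\<And>n. V n q = 0" "\<And>n. sqnorm M (\<psi> n) \<le> K"
    for V \<psi> x
  proof -
    obtain C where C: "link_const C q x" using \<open>x \<in> J\<close> by (auto simp: J_def linked_def)
    have "(V n x)\<^sup>2 \<le> C * K" for n
    proof -
      have "(V n x)\<^sup>2 \<le> C * sqnorm M (\<psi> n)"
        using link_const_bound[OF C _ V(1)[of n] V(2), of x] V(3) by simp
      also have "\<dots> \<le> C * K" using C V(4) by (intro mult_left_mono) (auto simp: link_const_def)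
      finally show ?thesis .
    qed
    then have "\<bar>V n x\<bar> \<le> sqrt (C * K)" for n using real_le_rsqrt[of "\<bar>V n x\<bar>"] by simp
    then show ?thesis by blast
  qed
  have bddP: "\<exists>B. \<forall>n. \<bar>P n x\<bar> \<le> B" and bddN: "\<exists>B. \<forall>n. \<bar>N n x\<bar> \<le> B" if "x \<in> J" for x
    using sqnorm_parts_le[OF U] K(2)
    by (auto intro!: bdd[OF that P(1) _ P(2)] bdd[OF that N(1) _ N(2)] intro: order_trans)
  obtain r1 where r1: "strict_mono r1" "\<And>x. x \<in> J \<Longrightarrow> convergent (\<lambda>n. P (r1 n) x)"
    using Helly_selection_on_interval[of J P, OF J mono(1) bddP] by blast
  have "\<exists>B. \<forall>n. \<bar>N (r1 n) x\<bar> \<le> B" if "x \<in> J" for x using bddN[OF that] by blast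
  then obtain r2 where r2: "strict_mono r2" "\<And>x. x \<in> J \<Longrightarrow> convergent (\<lambda>n. N (r1 (r2 n)) x)"
    using Helly_selection_on_interval[of J "\<lambda>n. N (r1 n)"] J mono(2) by blast
  obtain B where "\<And>n. \<bar>U n q\<bar> \<le> B" using bounded_at_class_point[of U \<phi>, OF U K mass] by blast
  then obtain r3 where r3: "strict_mono r3" "convergent (\<lambda>n. U (r1 (r2 (r3 n))) q)"
    using convergent_subsequence_on_countable[of "{q}" "\<lambda>n. U (r1 (r2 n))"] by auto
  have "convergent (\<lambda>n. U (r1 (r2 (r3 n))) x)" if "linked q x" for x
  proof -
    have "convergent (\<lambda>n. P (r1 (r2 (r3 n))) x)"
      using convergent_subseq_convergent[OF r1(2) strict_mono_o[OF r2(1) r3(1)], of x] that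
      by (simp add: o_def J_def)
    moreover have "convergent (\<lambda>n. N (r1 (r2 (r3 n))) x)"
      using convergent_subseq_convergent[OF r2(2) r3(1), of x] that by (simp add: o_def J_def)
    ultimately have "convergent (\<lambda>n. U (r1 (r2 (r3 n))) q + P (r1 (r2 (r3 n))) x - N (r1 (r2 (r3 n))) x)"
      using r3(2) by (intro convergent_diff convergent_add)
    then show ?thesis by (simp flip: U_eq)
  qed
  then show ?thesis
    using strict_mono_o[OF r1(1) strict_mono_o[OF r2(1) r3(1)]]
    by (intro exI[of _ "r1 \<circ> (r2 \<circ> r3)"]) (auto simp: o_def)
qed

text \<open>
  Classes without mass are discarded: they are countably many and form a null set.
\<close>
lemma rigid_compactness:
  fixes U \<phi> :: "nat \<Rightarrow> real \<Rightarrow> real"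
  assumes U: "\<And>n. C1_pair (U n) (\<phi> n)" and K: "\<And>n. sqnorm M (U n) \<le> K" "\<And>n. sqnorm M (\<phi> n) \<le> K"
  shows "\<exists>r. strict_mono r \<and> (AE x in M. x \<in> rigid_part \<longrightarrow> convergent (\<lambda>n. U (r n) x))"
proof -
  have ne: "anchors \<noteq> {}" by (auto simp: anchors_def)
  define q where "q = from_nat_into anchors"
  define J where "J i = {x. linked (q i) x} \<inter> I" for i
  have J_sets: "J i \<in> sets M" for i
    using saturated_sets_borel[OF link_class_saturated] by (auto simp: J_def sets_M_iff)
  have "\<exists>r. strict_mono r \<and>
      (\<forall>i. \<forall>x \<in> (if measure M (J i) = 0 then {} else J i). convergent (\<lambda>n. U (r n) x))"
  proof (rule common_convergent_subsequence[where f = "\<lambda>i. U"])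
    fix i and s :: "nat \<Rightarrow> nat"
    show "\<exists>r. strict_mono r \<and> (\<forall>x \<in> (if measure M (J i) = 0 then {} else J i). convergent (\<lambda>n. U (s (r n)) x))"
    proof (cases "measure M (J i) = 0")
      case True
      then show ?thesis by (intro exI[of _ "\<lambda>n. n"]) (simp add: strict_mono_def)
    next
      case False
      then have "measure M ({x. linked (q i) x} \<inter> I) \<noteq> 0" by (simp add: J_def)
      from class_compactness[of "\<lambda>n. U (s n)" "\<lambda>n. \<phi> (s n)", OF U K this]
      obtain r where "strict_mono r" "\<forall>x. linked (q i) x \<longrightarrow> convergent (\<lambda>n. U (s (r n)) x)" by blast
      then show ?thesis using False by (intro exI[of _ r]) (auto simp: J_def)
    qed
  qed
  then obtain r where r: "strict_mono r"
      "\<And>i x. measure M (J i) \<noteq> 0 \<Longrightarrow> x \<in> J i \<Longrightarrow> convergent (\<lambda>n. U (r n) x)"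
    by (auto split: if_splits)
  have "AE x in M. \<forall>i. measure M (J i) = 0 \<longrightarrow> x \<notin> J i"
    unfolding AE_all_countable
  proof
    fix i
    show "AE x in M. measure M (J i) = 0 \<longrightarrow> x \<notin> J i"
    proof (cases "measure M (J i) = 0")
      case True
      then have "J i \<in> null_sets M" using J_sets by (simp add: null_sets_def emeasure_eq_measure)
      then show ?thesis by (auto dest: AE_not_in)
    qed simp
  qed
  then have "AE x in M. x \<in> rigid_part \<longrightarrow> convergent (\<lambda>n. U (r n) x)"
    using AE_space
  proof eventually_elim
    case (elim x)
    show ?case
    proof
      assume "x \<in> rigid_part"
      then obtain p where p: "p \<in> anchors" "linked p x" by (auto simp: rigid_part_def)
      obtain i where "q i = p" using from_nat_into_surj[OF countable_anchors p(1)] by (auto simp: q_def)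
      then have "x \<in> J i" using p(2) elim(2) by (simp add: J_def)
      then show "convergent (\<lambda>n. U (r n) x)" using elim(1) r(2) by blast
    qed
  qed
  with r(1) show ?thesis by blast
qed

lemma free_compactness:
  fixes f :: "nat \<Rightarrow> real \<Rightarrow> real"
  assumes f: "\<And>n. f n \<in> L2 M" and K: "\<And>n. sqnorm M (f n) \<le> K"
  shows "\<exists>r. strict_mono r \<and> (AE x in M. x \<in> free_part \<longrightarrow> convergent (\<lambda>n. monotonise (f (r n)) x))"
proof -
  define J where "J = {x. 0 < free.F x \<and> free.F x < free.mass}"
  have J: "is_interval J"
    unfolding is_interval_1 J_def using free.F_mono by (auto intro: less_le_trans le_less_trans)
  have fm: "f n \<in> borel_measurable free_measure" for n
    by (intro free_measure_measurable L2_measurable f)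
  have int: "integrable free_measure (\<lambda>x. (f n x)\<^sup>2)" for n
    unfolding free_measure_def
    using integrable_mult_indicator[OF free_part_sets L2_square_integrable[OF f]]
    by (subst integrable_restrict_space) auto
  have le: "(\<integral>x. (f n x)\<^sup>2 \<partial>free_measure) \<le> K" for n
  proof -
    have "(\<integral>x. (f n x)\<^sup>2 \<partial>free_measure) = (\<integral>x. indicator free_part x * (f n x)\<^sup>2 \<partial>M)"
      by (simp add: free_measure_def integral_restrict_space)
    also have "\<dots> \<le> sqnorm M (f n)"
      unfolding sqnorm_def
      using integrable_mult_indicator[OF free_part_sets L2_square_integrable[OF f[of n]]] f
      by (intro integral_mono L2_square_integrable) (auto simp: indicator_def)
    finally show ?thesis using K[of n] by simp
  qed
  have bdd: "\<exists>B. \<forall>n. \<bar>free.rearrangement (f n) x\<bar> \<le> B" if x: "x \<in> J" for x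
  proof -
    define m where "m = min (free.F x) (free.mass - free.F x)"
    have m: "0 < m" using x by (simp add: m_def J_def)
    have "(free.rearrangement (f n) x)\<^sup>2 \<le> K / m" for n
    proof -
      have "(free.rearrangement (f n) x)\<^sup>2 * m \<le> K"
        using free.rearrangement_pointwise_bound[OF fm int, of x n] x le[of n] by (simp add: m_def J_def)
      then show ?thesis using m by (simp add: pos_le_divide_eq)
    qed
    then have "\<bar>free.rearrangement (f n) x\<bar> \<le> sqrt (K / m)" for n
      using real_le_rsqrt[of "\<bar>free.rearrangement (f n) x\<bar>"] by simp
    then show ?thesis by blast
  qed
  have "mono_on J (free.rearrangement (f n))" for n
    unfolding J_def by (rule free.rearrangement_mono[OF fm])
  from Helly_selection_on_interval[of J "\<lambda>n. free.rearrangement (f n)", OF J this bdd]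
  obtain r where r: "strict_mono r" "\<forall>x\<in>J. convergent (\<lambda>n. free.rearrangement (f (r n)) x)" by blast
  have "AE x in free_measure. x \<in> J"
    using free.AE_interior by (simp add: J_def)
  then have "AE x in M. x \<in> free_part \<longrightarrow> x \<in> J"
    unfolding free_measure_def by (subst (asm) AE_restrict_space_iff) auto
  then have "AE x in M. x \<in> free_part \<longrightarrow> convergent (\<lambda>n. monotonise (f (r n)) x)"
    by eventually_elim (use r(2) in \<open>auto simp: monotonise_def free_part_def\<close>)
  with r(1) show ?thesis by blast
qed

text \<open>
  On the rigid part the maps are compared with \<open>C\<^sup>1\<close> functions close to them in \<open>L\<^sup>2\<close>, whose
  compactness is known and whose distance to the maps tends to 0 almost everywhere along a
  subsequence; on the free part the rearranged maps are monotone.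
\<close>
lemma monotonised_compactness:
  fixes f v :: "nat \<Rightarrow> real \<Rightarrow> real"
  assumes f: "\<And>n. f n \<in> L2 M" "\<And>n. sqnorm M (f n) \<le> K"
    and v: "\<And>n. v n \<in> gradients I M (f n)" "\<And>n. sqnorm M (v n) \<le> K"
  shows "\<exists>r. strict_mono r \<and> (AE x in M. convergent (\<lambda>n. monotonise (f (r n)) x))"
proof -
  have "\<exists>U \<phi>. C1_pair U \<phi> \<and> sqnorm M (\<lambda>x. U x - f n x) < 1 / real (Suc n) \<and>
      sqnorm M (\<lambda>x. \<phi> x - v n x) < 1 / real (Suc n)" for n
    using v(1)[of n] unfolding gradients_iff by simp
  then obtain U \<phi> where U: "\<And>n. C1_pair (U n) (\<phi> n)" "\<And>n. sqnorm M (\<lambda>x. U n x - f n x) < 1 / real (Suc n)"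
      "\<And>n. sqnorm M (\<lambda>x. \<phi> n x - v n x) < 1 / real (Suc n)"
    by metis
  have bound: "sqnorm M g \<le> 2 * K + 2"
    if "g \<in> L2 M" "h \<in> L2 M" "sqnorm M (\<lambda>x. g x - h x) < 1 / real (Suc n)" "sqnorm M h \<le> K" for g h n
  proof -
    have "sqnorm M (\<lambda>x. g x - h x) \<le> 1"
      using that(3) by (rule order_trans[OF less_imp_le]) simp
    moreover have "sqnorm M g \<le> 2 * sqnorm M (\<lambda>x. g x - h x) + 2 * sqnorm M h"
      using sqnorm_add_le[OF L2_diff[OF that(1,2)] that(2)] by simp
    ultimately show ?thesis using that(4) by linarith
  qed
  have KU: "sqnorm M (U n) \<le> 2 * K + 2" for n
    by (rule bound[OF C1_pair_L2(1)[OF U(1)] f(1) U(2) f(2)])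
  have K\<phi>: "sqnorm M (\<phi> n) \<le> 2 * K + 2" for n
    by (rule bound[OF C1_pair_L2(2)[OF U(1)] gradients_L2(2)[OF v(1)] U(3) v(2)])
  obtain r1 where r1: "strict_mono r1" "AE x in M. x \<in> rigid_part \<longrightarrow> convergent (\<lambda>n. U (r1 n) x)"
    using rigid_compactness[of U \<phi>, OF U(1) KU K\<phi>] by (elim exE conjE) (erule (1) that)
  define D where "D n x = U (r1 n) x - f (r1 n) x" for n x
  have D: "D n \<in> L2 M" for n
    unfolding D_def by (intro L2_diff f C1_pair_L2(1)[OF U(1)])
  have "(\<lambda>n. sqnorm M (D n)) \<longlonglongrightarrow> 0"
  proof (rule tendsto_sandwich[OF _ _ tendsto_const])
    show "(\<lambda>n. 1 / real (Suc (r1 n))) \<longlonglongrightarrow> 0"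
      using LIMSEQ_subseq_LIMSEQ[OF LIMSEQ_Suc[OF lim_const_over_n[of "1::real"]] r1(1)] by (simp add: o_def)
    show "\<forall>\<^sub>F n in sequentially. sqnorm M (D n) \<le> 1 / real (Suc (r1 n))"
      using U(2) by (intro always_eventually allI) (simp add: D_def[abs_def] less_imp_le)
  qed simp
  from sqnorm_tendsto_AE_subseq[of D, OF D this]
  obtain r2 where r2: "strict_mono r2" "AE x in M. (\<lambda>n. D (r2 n) x) \<longlonglongrightarrow> 0"
    by (elim exE conjE) (erule (1) that)
  obtain r3 where r3: "strict_mono r3"
      "AE x in M. x \<in> free_part \<longrightarrow> convergent (\<lambda>n. monotonise (f (r1 (r2 (r3 n)))) x)"
    using free_compactness[of "\<lambda>n. f (r1 (r2 n))" K, OF f] by (elim exE conjE) (erule (1) that)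
  have "AE x in M. convergent (\<lambda>n. monotonise (f (r1 (r2 (r3 n)))) x)"
    using r1(2) r2(2) r3(2) AE_space
  proof eventually_elim
    case (elim x)
    show ?case
    proof (cases "x \<in> rigid_part")
      case True
      have "convergent (\<lambda>n. U (r1 (r2 (r3 n))) x)"
        using convergent_subseq_convergent[OF _ strict_mono_o[OF r2(1) r3(1)], of "\<lambda>n. U (r1 n) x"] elim(1) True
        by (simp add: o_def)
      moreover have "convergent (\<lambda>n. D (r2 (r3 n)) x)"
        using LIMSEQ_subseq_LIMSEQ[OF elim(2) r3(1)] by (auto simp: o_def convergent_def)
      ultimately have "convergent (\<lambda>n. U (r1 (r2 (r3 n))) x - D (r2 (r3 n)) x)"
        by (rule convergent_diff)
      then show ?thesis using True by (simp add: D_def monotonise_def)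
    next
      case False
      then have "x \<in> free_part" using elim(4) by (simp add: free_part_def)
      then show ?thesis using elim(3) by simp
    qed
  qed
  then show ?thesis
    using strict_mono_o[OF r1(1) strict_mono_o[OF r2(1) r3(1)]]
    by (intro exI[of _ "r1 \<circ> (r2 \<circ> r3)"]) (simp add: o_def)
qed

lemma transport_energy_eq:
  assumes "T \<in> H1 I M"
  shows "transport_energy I M T = sqnorm M (\<lambda>x. T x - x) + sqnorm M (tangential_gradient I M T)"
proof -
  have "T \<in> L2 M" using assms by (simp add: H1_def)
  then show ?thesis
    unfolding transport_energy_def sqnorm_def power2_abs
    using gradients_L2(2)[OF tangential_gradient(1)[OF assms]] identity_L2
    by (intro Bochner_Integration.integral_add L2_square_integrable L2_diff)
qed

end

theorem theorem3p1:
  fixes a b :: real and I :: "real set" and \<mu> \<nu> :: "real measure"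
  assumes "a < b" and "I = {a<..<b}"
    and "finite_measure \<mu>" and "sets \<mu> = sets (restrict_space borel I)"
    and "prob_space \<nu>" and "sets \<nu> = sets borel"
    and "\<exists>T \<in> H1 I \<mu>. distr \<mu> borel T = \<nu>"
  shows "\<exists>T \<in> admissible_maps I \<mu> \<nu>.
           \<forall>S \<in> admissible_maps I \<mu> \<nu>. transport_energy I \<mu> T \<le> transport_energy I \<mu> S"
proof -
  interpret interval_measure \<mu> a b I
    using assms by (intro interval_measure.intro interval_measure_axioms.intro)
  let ?A = "admissible_maps I \<mu> \<nu>" and ?E = "transport_energy I \<mu>"
  have A_L2: "T \<in> L2 \<mu>" and A_H1: "T \<in> H1 I \<mu>" and A_law: "distr \<mu> borel T = \<nu>" if "T \<in> ?A" for T
    using that by (auto simp: admissible_maps_def H1_def)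
  obtain T\<^sub>0 where T0: "T\<^sub>0 \<in> ?A" using assms(7) by (auto simp: admissible_maps_def)
  have prob: "prob_space \<mu>"
    using assms(5) A_law[OF T0] by (intro prob_space_distrD[OF L2_measurable[OF A_L2[OF T0]]]) simp
  define e where "e = Inf (?E ` ?A)"
  have E_nonneg: "0 \<le> ?E T" for T
    unfolding transport_energy_def by (intro Bochner_Integration.integral_nonneg) simp
  then have bdd: "bdd_below (?E ` ?A)" by (intro bdd_belowI[of _ 0]) auto
  have e_le: "e \<le> ?E S" if "S \<in> ?A" for S
    unfolding e_def using that bdd by (intro cInf_lower) auto
  have "\<exists>T \<in> ?A. ?E T < e + 1 / real (Suc n)" for n
    using cInf_lessD[of "?E ` ?A" "e + 1 / real (Suc n)"] T0 by (auto simp: e_def)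
  then obtain T where T: "\<And>n. T n \<in> ?A" "\<And>n. ?E (T n) < e + 1 / real (Suc n)" by metis
  note TL = A_L2[OF T(1)]
  define v where "v n = tangential_gradient I \<mu> (T n)" for n
  have v: "v n \<in> gradients I \<mu> (T n)" for n
    unfolding v_def by (rule tangential_gradient(1)[OF A_H1[OF T(1)]])
  have E_T: "?E (T n) = sqnorm \<mu> (\<lambda>x. T n x - x) + sqnorm \<mu> (v n)" for n
    unfolding v_def by (rule transport_energy_eq[OF A_H1[OF T(1)]])
  have T_norm: "sqnorm \<mu> (T n) = sqnorm \<mu> T\<^sub>0" for n
    using same_law_L2(2)[OF A_L2[OF T0] L2_measurable[OF TL[of n]]] A_law[OF T(1)[of n]] A_law[OF T0] by simp
  have v_bound: "sqnorm \<mu> (v n) \<le> e + 1" for n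
  proof -
    have "1 / real (Suc n) \<le> 1" by simp
    then show ?thesis
      using T(2)[of n] E_T[of n] sqnorm_nonneg[of \<mu> "\<lambda>x. T n x - x"] by linarith
  qed
  obtain r where r: "strict_mono r" "AE x in \<mu>. convergent (\<lambda>n. monotonise (T (r n)) x)"
  proof -
    have "sqnorm \<mu> (T n) \<le> max (sqnorm \<mu> T\<^sub>0) (e + 1)"
        "sqnorm \<mu> (v n) \<le> max (sqnorm \<mu> T\<^sub>0) (e + 1)" for n
      using T_norm[of n] v_bound[of n] by (simp_all add: le_max_iff_disj)
    from monotonised_compactness[of T _ v, OF TL this(1) v this(2)] show thesis
      by (elim exE conjE) (erule (1) that)
  qed
  define R where "R n = monotonise (T (r n))" for n
  have RL: "R n \<in> L2 \<mu>" for n unfolding R_def by (rule monotonise_L2(1)[OF TL])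
  have R_law: "distr \<mu> borel (R n) = \<nu>" for n
    unfolding R_def using monotonise_law[OF L2_measurable[OF TL]] A_law[OF T(1)] by simp
  define Q where "Q x = lim (\<lambda>n. R n x)" for x
  have R_lim: "AE x in \<mu>. (\<lambda>n. R n x) \<longlonglongrightarrow> Q x"
    using r(2) by (simp add: R_def Q_def convergent_LIMSEQ_iff)
  have Q_meas: "Q \<in> borel_measurable \<mu>"
    unfolding Q_def[abs_def] by (rule borel_measurable_lim_metric[OF L2_measurable[OF RL]])
  have Q_law: "distr \<mu> borel Q = \<nu>"
    by (rule AE_limit_same_law[of \<mu> R, OF prob L2_measurable[OF RL] Q_meas R_law R_lim])
  have QL: "Q \<in> L2 \<mu>"
    using same_law_L2(1)[OF A_L2[OF T0] Q_meas] Q_law A_law[OF T0] by simp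
  have R_Q_norm: "sqnorm \<mu> (R n) = sqnorm \<mu> Q" for n
    using same_law_L2(2)[OF QL L2_measurable[OF RL[of n]]] Q_law R_law by simp
  have R_Q: "(\<lambda>n. sqnorm \<mu> (\<lambda>x. R n x - Q x)) \<longlonglongrightarrow> 0"
    by (rule AE_and_norm_convergence_imp_L2[of R, OF RL QL R_lim R_Q_norm])
  \<comment> \<open>The transport cost of the limit is at most what the minimising sequence spends on it, up to an
    error; whatever remains of \<open>e\<close> bounds the gradients.\<close>
  have "\<exists>w \<in> gradients I \<mu> Q. sqnorm \<mu> w \<le> e - sqnorm \<mu> (\<lambda>x. Q x - x)"
  proof (rule gradient_lower_semicontinuity[OF QL])
    fix d :: real assume d: "0 < d"
    have 1: "\<forall>\<^sub>F n in sequentially. sqnorm \<mu> (\<lambda>x. Q x - x) \<le> sqnorm \<mu> (\<lambda>x. R n x - x) + d / 2"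
      using R_Q d by (intro sqnorm_lower_semicontinuous L2_diff RL QL identity_L2) auto
    have "(\<lambda>n. 1 / real (Suc n)) \<longlonglongrightarrow> 0" by (rule LIMSEQ_Suc) (rule lim_const_over_n)
    from LIMSEQ_subseq_LIMSEQ[OF this r(1)] have "(\<lambda>n. 1 / real (Suc (r n))) \<longlonglongrightarrow> 0" by (simp add: o_def)
    then have 2: "\<forall>\<^sub>F n in sequentially. 1 / real (Suc (r n)) < d / 2"
      using d by (intro order_tendstoD) auto
    have 3: "\<forall>\<^sub>F n in sequentially. sqnorm \<mu> (\<lambda>x. R n x - Q x) < d"
      using R_Q d by (intro order_tendstoD) auto
    obtain n where n: "sqnorm \<mu> (\<lambda>x. Q x - x) \<le> sqnorm \<mu> (\<lambda>x. R n x - x) + d / 2"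
        "1 / real (Suc (r n)) < d / 2" "sqnorm \<mu> (\<lambda>x. R n x - Q x) < d"
      using eventually_happens[OF eventually_conj[OF 1 eventually_conj[OF 2 3]]] by auto
    have "sqnorm \<mu> (\<lambda>x. R n x - x) \<le> sqnorm \<mu> (\<lambda>x. T (r n) x - x)"
      unfolding R_def by (rule monotonise_distance[OF TL])
    then have "sqnorm \<mu> (v (r n)) \<le> e - sqnorm \<mu> (\<lambda>x. Q x - x) + d"
      using n(1,2) T(2)[of "r n"] E_T[of "r n"] by linarith
    moreover have "v (r n) \<in> gradients I \<mu> (R n)"
      unfolding R_def by (rule monotonise_gradients[OF v])
    ultimately show "\<exists>f' v'. v' \<in> gradients I \<mu> f' \<and> sqnorm \<mu> (\<lambda>x. f' x - Q x) < d \<and>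
        sqnorm \<mu> v' \<le> e - sqnorm \<mu> (\<lambda>x. Q x - x) + d"
      using n(3) by blast
  qed
  then obtain w where w: "w \<in> gradients I \<mu> Q" "sqnorm \<mu> w \<le> e - sqnorm \<mu> (\<lambda>x. Q x - x)" by blast
  have Q_H1: "Q \<in> H1 I \<mu>" using QL w(1) by (auto simp: H1_def)
  have "?E Q \<le> e"
    using transport_energy_eq[OF Q_H1] tangential_gradient(2)[OF Q_H1 w(1)] w(2) by linarith
  moreover have "Q \<in> ?A" using Q_H1 Q_law by (simp add: admissible_maps_def)
  ultimately show ?thesis using e_le by (intro bexI[of _ Q]) (auto intro: order_trans)
qed

end
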